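(* For all sufficiently large $d$, almost surely the subgraph of $\mathbb{Z}^d$ induced on $T_4(\mathbb{Z}^d)\cap\mathbb{Z}^d_+$ contains an infinite path $(v_1,v_2,\ldots)$ such that $v_{i+1}-v_i\in\{e_j:j\in[d]\}$ for all $i$.
   Context: Layers model: given a graph $G=(V,E)$, let $(X_v)_{v\in V}$ be i.i.d. Uniform$[0,1]$ random variables ("ages"). For an integer $k\ge1$, $T_k(G)$ is the (random) set of vertices $v$ having at most $k-1$ neighbors $u$ with $X_u<X_v$. $\mathbb{Z}^d$ is the usual nearest-neighbor lattice graph (so $T_4(\mathbb{Z}^d)$ is defined using neighbors in all of $\mathbb{Z}^d$), $[d]=\{1,\dots,d\}$, $e_j$ is the $j$th standard unit vector, and $\mathbb{Z}^d_+:=\{(x_1,\ldots,x_d)\in\mathbb{Z}^d: x_i\ge 0\text{ for all } i\in[d]\}$. *)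

theory Defs
  imports "HOL-Probability.Probability"
begin

type_synonym 'a graph = "'a set \<times> 'a set set"

definition verts :: "'a graph \<Rightarrow> 'a set" where
  "verts G = fst G"

definition edges :: "'a graph \<Rightarrow> 'a set set" where
  "edges G = snd G"

definition neighbors :: "'a graph \<Rightarrow> 'a \<Rightarrow> 'a set" where
  "neighbors G v = {u \<in> verts G. {u, v} \<in> edges G}"

definition induced_subgraph :: "'a graph \<Rightarrow> 'a set \<Rightarrow> 'a graph" where
  "induced_subgraph G S = (verts G \<inter> S, {e \<in> edges G. e \<subseteq> S})"

text \<open>Vertices of a path are distinct. The indexing starts at 0.\<close>

definition infinite_path :: "'a graph \<Rightarrow> (nat \<Rightarrow> 'a) \<Rightarrow> bool" where
  "infinite_path G p \<longleftrightarrow>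
     inj p \<and> range p \<subseteq> verts G \<and> (\<forall>i. {p i, p (Suc i)} \<in> edges G)"

definition iid_uniform_ages :: "'w measure \<Rightarrow> 'a graph \<Rightarrow> ('a \<Rightarrow> 'w \<Rightarrow> real) \<Rightarrow> bool" where
  "iid_uniform_ages M G X \<longleftrightarrow>
     prob_space M \<and>
     prob_space.indep_vars M (\<lambda>_. borel) X (verts G) \<and>
     (\<forall>v\<in>verts G. distr M borel (X v) = uniform_measure lborel {0..1})"

text \<open>The set \<open>T\<^sub>k(G)\<close> for a realization \<open>x\<close> of the ages, meant for \<open>k \<ge> 1\<close>.
  The finiteness condition is needed because \<^const>\<open>card\<close> is 0 on infinite sets.\<close>

definition layer_set :: "nat \<Rightarrow> 'a graph \<Rightarrow> ('a \<Rightarrow> real) \<Rightarrow> 'a set" where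
  "layer_set k G x =
     {v \<in> verts G. finite {u \<in> neighbors G v. x u < x v} \<and>
                   card {u \<in> neighbors G v. x u < x v} \<le> k - 1}"

text \<open>So that the dimension can be quantified over, \<open>\<int>\<^sup>d\<close> consists of functions on the naturals
  that vanish outside the coordinates \<open>1, \<dots>, d\<close>; subtraction is pointwise.\<close>

definition int_points :: "nat \<Rightarrow> (nat \<Rightarrow> int) set" where
  "int_points d = {x. \<forall>i. i \<notin> {1..d} \<longrightarrow> x i = 0}"

definition unit_vector :: "nat \<Rightarrow> nat \<Rightarrow> int" where
  "unit_vector j = (\<lambda>i. if i = j then 1 else 0)"

definition int_lattice :: "nat \<Rightarrow> (nat \<Rightarrow> int) graph" where
  "int_lattice d =
     (int_points d,
      {{x, y} | x y. x \<in> int_points d \<and> y \<in> int_points d \<and> (\<Sum>i\<in>{1..d}. \<bar>x i - y i\<bar>) = 1})"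

definition nonneg_orthant :: "nat \<Rightarrow> (nat \<Rightarrow> int) set" where
  "nonneg_orthant d = {x \<in> int_points d. \<forall>i\<in>{1..d}. 0 \<le> x i}"

end

theory Submission
  imports Defs "HOL-Library.Function_Algebras" "HOL-Real_Asymp.Real_Asymp"
begin

text \<open>
  Rescale ages by \<open>2 d\<close>, so that a vertex of rescaled age \<open>t\<close> has about Poisson(\<open>t\<close>) neighbours of
  smaller age, and cut an oriented path into blocks of two consecutive vertices. A block is open if,
  off the path, its vertex of smaller age has at most two neighbours of smaller age and its other
  vertex at most one; then both have at most three in total. The expected number of open
  continuations of a path by one block tends to \<open>1 + \<integral>\<integral>\<^bsub>s < t\<^esub> e\<^sup>-\<^sup>s (s\<^sup>2/2) e\<^sup>-\<^sup>t (1 + t) / 2 > 1\<close>, so the open paths are a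
  supercritical system.

  Excluding the few neighbours shared by two vertices of the path makes the blocks of one path
  independent. For two paths, the correlation of their openness is at most a product over the blocks
  of a weight that depends only on the difference of the paths: about \<open>d\<^sup>2/\<lambda>\<close> with \<open>\<lambda> > 1\<close> for a
  common block, \<open>O(d)\<close> for a block with one common vertex, \<open>1 + O(1/d)\<close> when the paths are close and
  \<open>1\<close> otherwise. The difference of two uniformly random oriented paths is a random walk, and
  \<open>1 + (\<kappa>/d) / (32 + |z|\<^sup>2) + B d [z = 0]\<close> is a supersolution for these weights. Hence the second
  moment of the normalized number of open paths stays bounded in their length, so that
  arbitrarily long open paths exist with probability bounded below, uniformly in the start. A
  sequence of almost independent starts and a compactness argument conclude.
\<close>

section \<open>Events depending on finitely many cells\<close>

text \<open>Ages are rounded to finitely many cells, so that every event is a predicate of finitely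
  many natural numbers: measurability is automatic, and independence reduces to disjointness of
  supports. Equal cells count as smaller, so rounding only loses probability. The weights are
  affordable for the following reason. From a common vertex the difference walk stays at
  \<open>0\<close> for both steps of a block with probability \<open>1/d^2\<close>, which turns the
  weight \<open>d^2/\<lambda>\<close> into a ratio below 1; the geometric series of common blocks
  then sums the cost \<open>O(d)\<close> of separating, whence the term \<open>B d\<close>. From a
  nonzero difference, \<open>0\<close> is hit in one step with probability at most
  \<open>1/d^2\<close>, so that these large terms contribute only \<open>O(1/d)\<close>, the order
  of the near weights. Such costs are paid by the strict superharmonicity of
  \<open>1/(32 + |z|^2)\<close> on bounded sets. Far away a fixed excess would accumulate over all
  blocks, so the weight there is exactly 1. Hence the order of choices: \<open>\<lambda> > 1\<close>
  fixes \<open>B\<close>, then \<open>B\<close> fixes \<open>\<kappa>\<close>, and \<open>d\<close>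
  comes last.\<close>

definition depends_on :: "'v set \<Rightarrow> (('v \<Rightarrow> nat) \<Rightarrow> bool) \<Rightarrow> bool" where
  "depends_on S Q \<longleftrightarrow> (\<forall>y y'. (\<forall>u\<in>S. y u = y' u) \<longrightarrow> Q y = Q y')"

definition binomial_cdf :: "nat \<Rightarrow> nat \<Rightarrow> real \<Rightarrow> real" where
  "binomial_cdf n k x = (\<Sum>j\<le>k. real (n choose j) * x ^ j * (1 - x) ^ (n - j))"

text \<open>\<open>y u\<close> is the age cell of \<open>u\<close>, and cell \<open>K\<close> collects all large ages. Besides the counted sets
  \<open>C\<close> and \<open>C'\<close>, each of \<open>v\<close> and \<open>w\<close> has the other one and one further neighbour on the path, so the
  bounds leave room for at most three smaller neighbours. The vertices of \<open>F\<close> are not counted and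
  must therefore be old.\<close>

definition block_open ::
  "nat \<Rightarrow> 'v \<Rightarrow> 'v \<Rightarrow> 'v set \<Rightarrow> 'v set \<Rightarrow> 'v set \<Rightarrow> ('v \<Rightarrow> nat) \<Rightarrow> bool" where
  "block_open K v w C C' F y \<longleftrightarrow>
     y v < K \<and> y w < K \<and>
     card {u\<in>C. y u \<le> y v} \<le> (if y v < y w then 2 else 1) \<and>
     card {u\<in>C'. y u \<le> y w} \<le> (if y w < y v then 2 else 1) \<and>
     (\<forall>u\<in>F. y u = K)"

lemma depends_on_mono: "depends_on S Q \<Longrightarrow> S \<subseteq> T \<Longrightarrow> depends_on T Q"
  unfolding depends_on_def by blast

lemma depends_on_conj:
  "depends_on S Q \<Longrightarrow> depends_on T R \<Longrightarrow> depends_on (S \<union> T) (\<lambda>y. Q y \<and> R y)"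
  unfolding depends_on_def by blast

lemma depends_on_not: "depends_on S Q \<Longrightarrow> depends_on S (\<lambda>y. \<not> Q y)"
  unfolding depends_on_def by blast

lemma depends_on_all:
  "(\<And>i. i \<in> I \<Longrightarrow> depends_on (S i) (Q i)) \<Longrightarrow> depends_on (\<Union>i\<in>I. S i) (\<lambda>y. \<forall>i\<in>I. Q i y)"
  unfolding depends_on_def by (metis UN_I)

lemma depends_on_ex:
  assumes "\<And>i. i \<in> I \<Longrightarrow> depends_on (S i) (Q i)"
  shows "depends_on (\<Union>i\<in>I. S i) (\<lambda>y. \<exists>i\<in>I. Q i y)"
  using depends_on_not[OF depends_on_all[of I S "\<lambda>i y. \<not> Q i y", OF depends_on_not[OF assms]]]
  by simp

lemma depends_on_point: "depends_on {v} (\<lambda>y. P (y v))"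
  unfolding depends_on_def by simp

lemma depends_on_count: "depends_on C (\<lambda>y. P (card {u\<in>C. y u \<le> p}))"
proof -
  have "{u\<in>C. y u \<le> p} = {u\<in>C. y' u \<le> p}" if "\<forall>u\<in>C. y u = y' u" for y y' :: "'a \<Rightarrow> nat"
    using that by auto
  from arg_cong[OF this, of _ _ "\<lambda>A. P (card A)"] show ?thesis unfolding depends_on_def by blast
qed

lemma depends_on_block_open:
  "depends_on ({v, w} \<union> (C \<union> C' \<union> F)) (block_open K v w C C' F)"
proof -
  have "block_open K v w C C' F y = block_open K v w C C' F y'"
    if eq: "\<forall>u\<in>{v, w} \<union> (C \<union> C' \<union> F). y u = y' u" for y y' :: "'a \<Rightarrow> nat"
  proof -
    have "{u\<in>C. y u \<le> y v} = {u\<in>C. y' u \<le> y' v}" "{u\<in>C'. y u \<le> y w} = {u\<in>C'. y' u \<le> y' w}"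
      "y v = y' v" "y w = y' w" "(\<forall>u\<in>F. y u = K) = (\<forall>u\<in>F. y' u = K)"
      using eq by auto
    then show ?thesis by (simp only: block_open_def)
  qed
  then show ?thesis unfolding depends_on_def by blast
qed

lemma block_open_mono:
  assumes "C1 \<subseteq> C" "C1' \<subseteq> C'" "F1 \<subseteq> F" "finite C" "finite C'" "block_open K v w C C' F y"
  shows "block_open K v w C1 C1' F1 y"
proof -
  have "card {u\<in>C1. y u \<le> y v} \<le> card {u\<in>C. y u \<le> y v}"
    using assms by (intro card_mono) auto
  moreover have "card {u\<in>C1'. y u \<le> y w} \<le> card {u\<in>C'. y u \<le> y w}"
    using assms by (intro card_mono) auto
  ultimately show ?thesis
    using assms(3,6) unfolding block_open_def by (auto simp: subset_iff)
qed

text \<open>Since \<open>v\<close> and \<open>w\<close> lie in cells below \<open>K\<close>, a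
  vertex in cell \<open>K\<close> is never counted. Deleted vertices can therefore be put back once
  they are known to be old; this is how a relaxation by deletion is undone.\<close>

lemma block_open_restore:
  assumes "block_open K v w (C - D) (C' - D) (F - D) y" "\<forall>u\<in>D \<inter> (C \<union> C' \<union> F). y u = K"
  shows "block_open K v w C C' F y"
proof -
  have lt: "y v < K" "y w < K"
    using assms(1) by (auto simp: block_open_def)
  have "{u\<in>C. y u \<le> y v} = {u\<in>C - D. y u \<le> y v}" "{u\<in>C'. y u \<le> y w} = {u\<in>C' - D. y u \<le> y w}"
    using lt assms(2) by force+
  with assms show ?thesis unfolding block_open_def by auto
qed

text \<open>Paley-Zygmund for a sum in which every indicator is divided by the probability of its
  event. Each index then contributes mean 1 although the events need not be equally likely, and the
  last hypothesis bounds the second moment by \<open>\<Gamma>\<close> times the squared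
  mean.\<close>

lemma (in prob_space) second_moment:
  assumes W: "finite W" "W \<noteq> {}" and A: "\<And>a. a \<in> W \<Longrightarrow> A a \<in> events"
    and pos: "\<And>a. a \<in> W \<Longrightarrow> prob (A a) > 0" and G: "\<Gamma> > 0"
    and bound: "(\<Sum>a\<in>W. \<Sum>b\<in>W. prob (A a \<inter> A b) / (prob (A a) * prob (A b))) \<le> \<Gamma> * (real (card W))\<^sup>2"
  shows "prob (\<Union>a\<in>W. A a) \<ge> 1 / \<Gamma>"
proof -
  define U where "U = (\<Union>a\<in>W. A a)"
  have U: "U \<in> events" using A W(1) unfolding U_def by auto
  define Z where "Z \<omega> = (\<Sum>a\<in>W. indicat_real (A a) \<omega> / prob (A a))" for \<omega>
  have [simp]: "integrable M (indicat_real B)" if "B \<in> events" for B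
    using that by (simp add: integrable_indicator_iff emeasure_finite less_top[symmetric])
  have E: "expectation (indicat_real B) = prob B" if "B \<in> events" for B
    using that by simp
  define n where "n = real (card W)"
  have n: "n > 0" using W by (simp add: n_def card_gt_0_iff)
  have ZZ: "(Z \<omega>)\<^sup>2 = (\<Sum>a\<in>W. \<Sum>b\<in>W. indicat_real (A a \<inter> A b) \<omega> / (prob (A a) * prob (A b)))" for \<omega>
    unfolding Z_def power2_eq_square sum_product by (simp add: indicator_inter_arith)
  have ZU: "Z \<omega> * indicat_real U \<omega> = Z \<omega>" for \<omega>
  proof -
    have "indicat_real (A a) \<omega> / prob (A a) * indicat_real U \<omega> = indicat_real (A a) \<omega> / prob (A a)"
      if "a \<in> W" for a
      using that by (auto simp: U_def indicator_def)
    then show ?thesis unfolding Z_def sum_distrib_right by (intro sum.cong) auto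
  qed
  have iZ: "integrable M Z" unfolding Z_def using A by (intro Bochner_Integration.integrable_sum) auto
  have iZZ: "integrable M (\<lambda>\<omega>. (Z \<omega>)\<^sup>2)"
    unfolding ZZ using A by (intro Bochner_Integration.integrable_sum) auto
  have EZ: "expectation Z = n"
  proof -
    have "expectation Z = (\<Sum>a\<in>W. prob (A a) / prob (A a))"
      unfolding Z_def using A by (subst Bochner_Integration.integral_sum) auto
    also have "\<dots> = (\<Sum>a\<in>W. 1)" using pos by (intro sum.cong) (auto simp: less_imp_neq[symmetric])
    finally show ?thesis by (simp add: n_def)
  qed
  have "expectation (\<lambda>\<omega>. (Z \<omega>)\<^sup>2) =
      (\<Sum>a\<in>W. \<Sum>b\<in>W. prob (A a \<inter> A b) / (prob (A a) * prob (A b)))"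
    unfolding ZZ using A by (simp add: Bochner_Integration.integral_sum)
  with bound have EZZ: "expectation (\<lambda>\<omega>. (Z \<omega>)\<^sup>2) \<le> \<Gamma> * n\<^sup>2" by (simp add: n_def)
  \<comment> \<open>The inequality is \<open>E (Z - t 1\<^bsub>U\<^esub>)\<^sup>2 \<ge> 0\<close> for this \<open>t\<close>, which avoids dividing by \<open>P(U)\<close>.\<close>
  define t where "t = \<Gamma> * n"
  have sq: "(Z \<omega> - t * indicat_real U \<omega>)\<^sup>2 = (Z \<omega>)\<^sup>2 - 2 * t * Z \<omega> + t\<^sup>2 * indicat_real U \<omega>" for \<omega>
  proof -
    have "indicat_real U \<omega> * indicat_real U \<omega> = indicat_real U \<omega>" by (simp add: indicator_def)
    then have "(Z \<omega> - t * indicat_real U \<omega>)\<^sup>2 = (Z \<omega>)\<^sup>2 - 2 * t * (Z \<omega> * indicat_real U \<omega>) + t\<^sup>2 * (indicat_real U \<omega> * indicat_real U \<omega>)"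
      by (simp only: power2_eq_square) (simp add: algebra_simps)
    then show ?thesis by (simp only: ZU \<open>indicat_real U \<omega> * indicat_real U \<omega> = indicat_real U \<omega>\<close>)
  qed
  have "0 \<le> expectation (\<lambda>\<omega>. (Z \<omega> - t * indicat_real U \<omega>)\<^sup>2)" by simp
  also have "\<dots> = expectation (\<lambda>\<omega>. (Z \<omega>)\<^sup>2) - 2 * t * n + t\<^sup>2 * prob U"
    unfolding sq using iZ iZZ U EZ by simp
  finally have "2 * t * n \<le> \<Gamma> * n\<^sup>2 + t\<^sup>2 * prob U" using EZZ by linarith
  then have "\<Gamma> * n\<^sup>2 * 1 \<le> \<Gamma> * n\<^sup>2 * (\<Gamma> * prob U)"
    by (simp add: t_def power2_eq_square algebra_simps)
  then have "1 \<le> \<Gamma> * prob U" using n G by (subst (asm) mult_le_cancel_left_pos) auto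
  then show ?thesis using G by (simp add: U_def field_simps)
qed

section \<open>Independent cells and the probabilities of finite events\<close>

locale cell_field = prob_space M for M :: "'w measure" +
  fixes V :: "'v set" and Y :: "'v \<Rightarrow> 'w \<Rightarrow> nat" and K :: nat and h :: real
  assumes indep: "indep_vars (\<lambda>_. count_space UNIV) Y V"
    and cell_le: "\<And>v p. v \<in> V \<Longrightarrow> p < K \<Longrightarrow> prob {\<omega>\<in>space M. Y v \<omega> \<le> p} = (real p + 1) * h"
    and Y_le: "\<And>v \<omega>. Y v \<omega> \<le> K"
    and h_pos: "0 < h" and Kh: "real K * h < 1"
begin

definition pr :: "(('v \<Rightarrow> nat) \<Rightarrow> bool) \<Rightarrow> real" where
  "pr Q = prob {\<omega>\<in>space M. Q (\<lambda>v. Y v \<omega>)}"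

definition regular :: "(('v \<Rightarrow> nat) \<Rightarrow> bool) \<Rightarrow> bool" where
  "regular Q \<longleftrightarrow> (\<exists>S. finite S \<and> S \<subseteq> V \<and> depends_on S Q)"

lemma regularI: "finite S \<Longrightarrow> S \<subseteq> V \<Longrightarrow> depends_on S Q \<Longrightarrow> regular Q"
  unfolding regular_def by blast

lemma restrict_vimage:
  assumes "depends_on S Q"
  shows "(\<lambda>\<omega>. restrict (\<lambda>i. Y i \<omega>) S) -` {y \<in> PiE S (\<lambda>_. UNIV). Q y} \<inter> space M
       = {\<omega>\<in>space M. Q (\<lambda>v. Y v \<omega>)}"
proof -
  have "Q (restrict (\<lambda>i. Y i \<omega>) S) = Q (\<lambda>v. Y v \<omega>)" for \<omega>
    using assms unfolding depends_on_def by (metis restrict_apply')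
  then show ?thesis by auto
qed

text \<open>A finite product of countable discrete spaces is discrete, so arbitrary predicates of
  finitely many cells are measurable.\<close>

lemma sets_PiM_cells:
  assumes "finite S" shows "{y \<in> PiE S (\<lambda>_. UNIV). Q y} \<in> sets (PiM S (\<lambda>_. count_space (UNIV :: nat set)))"
  using assms by (subst count_space_PiM_finite) auto

lemma event:
  assumes "regular Q"
  shows "{\<omega>\<in>space M. Q (\<lambda>v. Y v \<omega>)} \<in> events"
proof -
  obtain S where S: "finite S" "S \<subseteq> V" "depends_on S Q"
    using assms unfolding regular_def by blast
  have "(\<lambda>\<omega>. restrict (\<lambda>i. Y i \<omega>) S) \<in> measurable M (PiM S (\<lambda>_. count_space UNIV))"
    using indep S(2) by (auto simp: indep_vars_def intro!: measurable_restrict)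
  from measurable_sets[OF this sets_PiM_cells[OF S(1), of Q]] show ?thesis
    by (simp only: restrict_vimage[OF S(3)])
qed

lemma pr_indep:
  assumes J: "finite J" and S: "\<And>j. j \<in> J \<Longrightarrow> finite (S j)" "\<And>j. j \<in> J \<Longrightarrow> S j \<subseteq> V"
    and dep: "\<And>j. j \<in> J \<Longrightarrow> depends_on (S j) (Q j)"
    and disj: "disjoint_family_on S J"
  shows "pr (\<lambda>y. \<forall>j\<in>J. Q j y) = (\<Prod>j\<in>J. pr (Q j))"
proof (cases "J = {}")
  case True
  then show ?thesis by (simp add: pr_def prob_space)
next
  case False
  let ?X = "\<lambda>j \<omega>. restrict (\<lambda>i. Y i \<omega>) (S j)"
  let ?A = "\<lambda>j. {y \<in> PiE (S j) (\<lambda>_. UNIV). Q j y}"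
  have "indep_vars (\<lambda>j. PiM (S j) (\<lambda>_. count_space UNIV)) ?X J"
    by (rule indep_vars_restrict[OF indep S(2) disj])
  then have "prob (\<Inter>j\<in>J. ?X j -` ?A j \<inter> space M) = (\<Prod>j\<in>J. prob (?X j -` ?A j \<inter> space M))"
    by (rule indep_varsD_finite) (use False J S(1) sets_PiM_cells in auto)
  moreover have "(\<Inter>j\<in>J. ?X j -` ?A j \<inter> space M) = {\<omega>\<in>space M. \<forall>j\<in>J. Q j (\<lambda>v. Y v \<omega>)}"
    using False restrict_vimage[OF dep] by auto
  moreover have "(\<Prod>j\<in>J. prob (?X j -` ?A j \<inter> space M)) = (\<Prod>j\<in>J. pr (Q j))"
    unfolding pr_def by (intro prod.cong refl) (simp only: restrict_vimage[OF dep])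
  ultimately show ?thesis by (simp add: pr_def)
qed

lemma pr_indep2:
  assumes "finite S" "finite T" "S \<subseteq> V" "T \<subseteq> V" "depends_on S Q" "depends_on T R" "S \<inter> T = {}"
  shows "pr (\<lambda>y. Q y \<and> R y) = pr Q * pr R"
proof -
  have "pr (\<lambda>y. \<forall>j\<in>UNIV. (if j then Q else R) y) = (\<Prod>j\<in>UNIV. pr (if j then Q else R))"
    by (rule pr_indep[where S = "\<lambda>j. if j then S else T"])
      (use assms in \<open>auto simp: disjoint_family_on_def\<close>)
  moreover have "(\<forall>j\<in>UNIV. (if j then Q else R) y) = (Q y \<and> R y)" for y by (metis UNIV_I)
  ultimately show ?thesis by (simp add: UNIV_bool)
qed

lemma pr_mono: "regular R \<Longrightarrow> (\<And>y. Q y \<Longrightarrow> R y) \<Longrightarrow> pr Q \<le> pr R"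
  unfolding pr_def by (intro finite_measure_mono event) auto

lemma pr_nonneg: "0 \<le> pr Q"
  unfolding pr_def by simp

lemma pr_le_1: "pr Q \<le> 1"
  unfolding pr_def by simp

lemma pr_disjoint_sum:
  assumes "finite I" "\<And>i. i \<in> I \<Longrightarrow> regular (Q i)"
    and "\<And>i j y. i \<in> I \<Longrightarrow> j \<in> I \<Longrightarrow> Q i y \<Longrightarrow> Q j y \<Longrightarrow> i = j"
  shows "pr (\<lambda>y. \<exists>i\<in>I. Q i y) = (\<Sum>i\<in>I. pr (Q i))"
proof -
  have "(\<Sum>i\<in>I. pr (Q i)) = prob (\<Union>i\<in>I. {\<omega>\<in>space M. Q i (\<lambda>v. Y v \<omega>)})"
    unfolding pr_def using assms
    by (intro finite_measure_finite_Union[symmetric]) (auto simp: disjoint_family_on_def event)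
  also have "(\<Union>i\<in>I. {\<omega>\<in>space M. Q i (\<lambda>v. Y v \<omega>)}) = {\<omega>\<in>space M. \<exists>i\<in>I. Q i (\<lambda>v. Y v \<omega>)}"
    by auto
  finally show ?thesis by (simp add: pr_def)
qed

lemma pr_not:
  assumes "regular Q" shows "pr (\<lambda>y. \<not> Q y) = 1 - pr Q"
proof -
  have "prob (space M - {\<omega>\<in>space M. Q (\<lambda>v. Y v \<omega>)}) = 1 - pr Q"
    unfolding pr_def by (rule prob_compl[OF event[OF assms]])
  moreover have "space M - {\<omega>\<in>space M. Q (\<lambda>v. Y v \<omega>)} = {\<omega>\<in>space M. \<not> Q (\<lambda>v. Y v \<omega>)}" by auto
  ultimately show ?thesis by (simp add: pr_def)
qed

lemma regular_point: "v \<in> V \<Longrightarrow> regular (\<lambda>y. P (y v))"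
  by (rule regularI[OF _ _ depends_on_point]) auto

lemma pr_le: "v \<in> V \<Longrightarrow> p < K \<Longrightarrow> pr (\<lambda>y. y v \<le> p) = (real p + 1) * h"
  by (simp add: pr_def cell_le)

lemma pr_low:
  assumes "v \<in> V" shows "pr (\<lambda>y. y v < K) = real K * h"
proof (cases K)
  case 0
  then show ?thesis by (simp add: pr_def)
next
  case (Suc k)
  then have "pr (\<lambda>y. y v < K) = pr (\<lambda>y. y v \<le> k)" by (simp add: less_Suc_eq_le)
  then show ?thesis using pr_le[OF assms, of k] Suc by (simp add: add.commute)
qed

lemma pr_high:
  assumes "v \<in> V" shows "pr (\<lambda>y. y v = K) = 1 - real K * h"
proof -
  have "pr (\<lambda>y. y v = K) = pr (\<lambda>y. \<not> y v < K)"
    unfolding pr_def using Y_le by (intro arg_cong[where f = prob]) (auto simp: not_less le_antisym)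
  then show ?thesis using pr_not[OF regular_point[OF assms], of "\<lambda>k. k < K"] pr_low[OF assms] by simp
qed

lemma pr_eq:
  assumes "v \<in> V" "p < K" shows "pr (\<lambda>y. y v = p) = h"
proof (cases p)
  case 0
  then show ?thesis using pr_le[OF assms] by simp
next
  case (Suc k)
  have "pr (\<lambda>y. y v \<le> p) = pr (\<lambda>y. \<exists>i\<in>{True, False}. if i then y v = p else y v \<le> k)"
    using Suc by (intro arg_cong[where f = pr]) auto
  also have "\<dots> = (\<Sum>i\<in>{True, False}. pr (\<lambda>y. if i then y v = p else y v \<le> k))"
    by (rule pr_disjoint_sum) (use assms Suc in \<open>auto intro: regular_point split: if_splits\<close>)
  also have "\<dots> = pr (\<lambda>y. y v = p) + pr (\<lambda>y. y v \<le> k)" by simp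
  finally show ?thesis using pr_le[OF assms] pr_le[OF assms(1), of k] assms(2) Suc
    by (simp add: algebra_simps)
qed

lemma pr_all_high:
  assumes "finite F" "F \<subseteq> V"
  shows "pr (\<lambda>y. \<forall>u\<in>F. y u = K) = (1 - real K * h) ^ card F"
proof -
  have "pr (\<lambda>y. \<forall>u\<in>F. y u = K) = (\<Prod>u\<in>F. pr (\<lambda>y. y u = K))"
    by (rule pr_indep[where S = "\<lambda>u. {u}"])
      (use assms in \<open>auto simp: disjoint_family_on_def intro: depends_on_point\<close>)
  also have "\<dots> = (\<Prod>u\<in>F. 1 - real K * h)" using assms pr_high by (intro prod.cong) auto
  finally show ?thesis by simp
qed

text \<open>The event is split according to the exact set \<open>T\<close> of vertices of
  \<open>C\<close> in cells up to \<open>p\<close>; the probability of each piece depends only on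
  the size of \<open>T\<close>.\<close>

lemma pr_count:
  assumes C: "finite C" "C \<subseteq> V" and p: "p < K"
  shows "pr (\<lambda>y. card {u\<in>C. y u \<le> p} \<le> k) = binomial_cdf (card C) k ((real p + 1) * h)"
proof -
  let ?x = "(real p + 1) * h"
  define E where "E T y \<longleftrightarrow> (\<forall>u\<in>C. (y u \<le> p) = (u \<in> T))" for T and y :: "'v \<Rightarrow> nat"
  define I where "I = {T. T \<subseteq> C \<and> card T \<le> k}"
  have I: "finite I" unfolding I_def using C(1) by (auto intro: finite_subset[of _ "Pow C"])
  have depE: "depends_on C (E T)" for T
    unfolding depends_on_def E_def by auto
  have prE: "pr (E T) = ?x ^ card T * (1 - ?x) ^ (card C - card T)" if "T \<subseteq> C" for T
  proof -
    have "pr (E T) = (\<Prod>u\<in>C. pr (\<lambda>y. (y u \<le> p) = (u \<in> T)))"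
      unfolding E_def
      by (rule pr_indep[where S = "\<lambda>u. {u}"])
        (use C in \<open>auto simp: disjoint_family_on_def intro: depends_on_point\<close>)
    also have "\<dots> = (\<Prod>u\<in>C. if u \<in> T then ?x else 1 - ?x)"
    proof (intro prod.cong refl)
      fix u assume u: "u \<in> C"
      then have "pr (\<lambda>y. y u \<le> p) = ?x" using C pr_le p by auto
      moreover have "pr (\<lambda>y. \<not> y u \<le> p) = 1 - pr (\<lambda>y. y u \<le> p)"
        using u C by (intro pr_not regular_point) auto
      ultimately show "pr (\<lambda>y. (y u \<le> p) = (u \<in> T)) = (if u \<in> T then ?x else 1 - ?x)" by simp
    qed
    also have "\<dots> = ?x ^ card T * (1 - ?x) ^ card (C - T)"
      using that C(1) by (simp add: prod.If_cases Int_absorb1 set_diff_eq[symmetric] Diff_eq)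
    finally show ?thesis using that C(1) by (simp add: card_Diff_subset finite_subset)
  qed
  have "pr (\<lambda>y. card {u\<in>C. y u \<le> p} \<le> k) = pr (\<lambda>y. \<exists>T\<in>I. E T y)"
  proof -
    have "card {u\<in>C. y u \<le> p} \<le> k \<longleftrightarrow> (\<exists>T\<in>I. E T y)" for y
    proof
      assume "card {u\<in>C. y u \<le> p} \<le> k"
      then show "\<exists>T\<in>I. E T y" by (intro bexI[of _ "{u\<in>C. y u \<le> p}"]) (auto simp: I_def E_def)
    next
      assume "\<exists>T\<in>I. E T y"
      then obtain T where "T \<subseteq> C" "card T \<le> k" "E T y" by (auto simp: I_def)
      moreover from this have "{u\<in>C. y u \<le> p} = T" by (auto simp: E_def)
      ultimately show "card {u\<in>C. y u \<le> p} \<le> k" by simp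
    qed
    then show ?thesis by simp
  qed
  also have "\<dots> = (\<Sum>T\<in>I. pr (E T))"
  proof (rule pr_disjoint_sum[OF I])
    show "regular (E T)" for T by (rule regularI[OF C depE])
    show "T = T'" if "T \<in> I" "T' \<in> I" "E T y" "E T' y" for T T' y
      using that unfolding I_def E_def by blast
  qed
  also have "\<dots> = (\<Sum>T\<in>I. ?x ^ card T * (1 - ?x) ^ (card C - card T))"
    by (intro sum.cong refl prE) (auto simp: I_def)
  also have "\<dots> = (\<Sum>j\<le>k. \<Sum>T\<in>{T\<in>I. card T = j}. ?x ^ card T * (1 - ?x) ^ (card C - card T))"
    using I by (intro sum.group[symmetric]) (auto simp: I_def)
  also have "\<dots> = (\<Sum>j\<le>k. real (card C choose j) * ?x ^ j * (1 - ?x) ^ (card C - j))"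
  proof (intro sum.cong refl)
    fix j assume "j \<in> {..k}"
    then have "{T\<in>I. card T = j} = {T. T \<subseteq> C \<and> card T = j}" by (auto simp: I_def)
    then show "(\<Sum>T\<in>{T\<in>I. card T = j}. ?x ^ card T * (1 - ?x) ^ (card C - card T))
        = real (card C choose j) * ?x ^ j * (1 - ?x) ^ (card C - j)"
      using n_subsets[OF C(1), of j] by simp
  qed
  finally show ?thesis by (simp add: binomial_cdf_def)
qed

text \<open>\<open>Q'\<close> and the oldness of \<open>D\<close> have disjoint supports and
  together imply \<open>Q\<close>. Read as an upper bound on \<open>pr Q'\<close>, this is the price
  of deleting vertices: a factor \<open>1 / (1 - K h)\<close> for each.\<close>

lemma pr_relax:
  assumes "finite S" "S \<subseteq> V" "depends_on S Q'" "finite D" "D \<subseteq> V" "S \<inter> D = {}" "regular Q"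
    and "\<And>y. Q' y \<Longrightarrow> \<forall>u\<in>D. y u = K \<Longrightarrow> Q y"
  shows "pr Q' * (1 - real K * h) ^ card D \<le> pr Q"
proof -
  have "depends_on D (\<lambda>y. \<forall>u\<in>D. y u = K)"
    unfolding depends_on_def by simp
  then have "pr Q' * pr (\<lambda>y. \<forall>u\<in>D. y u = K) = pr (\<lambda>y. Q' y \<and> (\<forall>u\<in>D. y u = K))"
    using assms by (intro pr_indep2[symmetric, where S = S and T = D]) auto
  also have "\<dots> \<le> pr Q" using assms by (intro pr_mono) auto
  finally show ?thesis using pr_all_high[OF assms(4,5)] by simp
qed

end

section \<open>The probability that a block is open\<close>

text \<open>\<open>p\<close> and \<open>q\<close> stand for the cells of the two vertices,
  \<open>n\<close> bounds the sizes of both counted sets, and the squared factor is for at most two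
  vertices that must be old. For \<open>p = q\<close> both vertices get the stricter bound 1, which
  is the loss due to rounding.\<close>

definition block_bound :: "nat \<Rightarrow> nat \<Rightarrow> real \<Rightarrow> real" where
  "block_bound K n h = h\<^sup>2 * (1 - real K * h)\<^sup>2 *
     (\<Sum>p<K. \<Sum>q<K. binomial_cdf n (if p < q then 2 else 1) ((real p + 1) * h) *
                   binomial_cdf n (if q < p then 2 else 1) ((real q + 1) * h))"

lemma binomial_cdf_nonneg: "0 \<le> x \<Longrightarrow> x \<le> 1 \<Longrightarrow> 0 \<le> binomial_cdf n k x"
  unfolding binomial_cdf_def by (intro sum_nonneg mult_nonneg_nonneg) auto

context cell_field
begin

lemma pr_block_open_ge:
  assumes V: "infinite V" and vw: "v \<in> V" "w \<in> V" "v \<noteq> w"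
    and C: "finite C" "C \<subseteq> V" "card C \<le> n" and C': "finite C'" "C' \<subseteq> V" "card C' \<le> n"
    and F: "finite F" "F \<subseteq> V" "card F \<le> 2"
    and disj: "C \<inter> C' = {}" "C \<inter> F = {}" "C' \<inter> F = {}" "v \<notin> C \<union> C' \<union> F" "w \<notin> C \<union> C' \<union> F"
  shows "block_bound K n h \<le> pr (block_open K v w C C' F)"
proof -
  \<comment> \<open>Padding \<open>C\<close> and \<open>C'\<close> with fresh vertices to size
    exactly \<open>n\<close> only shrinks the event. This replaces an argument about monotonicity of
    \<open>binomial_cdf\<close> in its first argument; the fresh vertices exist because
    \<open>V\<close> is infinite.\<close>
  obtain T where T: "finite T" "card T = n - card C" "T \<subseteq> V - ({v, w} \<union> C \<union> C' \<union> F)"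
    using infinite_arbitrarily_large[of "V - ({v, w} \<union> C \<union> C' \<union> F)" "n - card C"] V C C' F
    by (auto intro: that)
  obtain T' where T': "finite T'" "card T' = n - card C'" "T' \<subseteq> V - ({v, w} \<union> C \<union> C' \<union> F \<union> T)"
    using infinite_arbitrarily_large[of "V - ({v, w} \<union> C \<union> C' \<union> F \<union> T)" "n - card C'"] V C C' F T
    by (auto intro: that)
  define B B' where "B = C \<union> T" and "B' = C' \<union> T'"
  have "C \<inter> T = {}" "C' \<inter> T' = {}" using T T' by auto
  then have B: "finite B" "B \<subseteq> V" "card B = n" "finite B'" "B' \<subseteq> V" "card B' = n"
    using C C' T T' unfolding B_def B'_def by (simp_all add: card_Un_disjoint) auto
  have dB: "B \<inter> B' = {}" "B \<inter> F = {}" "B' \<inter> F = {}" "v \<notin> B \<union> B' \<union> F" "w \<notin> B \<union> B' \<union> F"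
    using disj T T' unfolding B_def B'_def by auto
  let ?kp = "\<lambda>p q. if p < q then 2 else 1 :: nat"
  define Qv Qw Qc Qd where "Qv p y \<longleftrightarrow> y v = p" and "Qw p y \<longleftrightarrow> y w = p"
    and "Qc p k y \<longleftrightarrow> card {u\<in>B. y u \<le> p} \<le> k" and "Qd p k y \<longleftrightarrow> card {u\<in>B'. y u \<le> p} \<le> k"
    for p k :: nat and y :: "'v \<Rightarrow> nat"
  define QF where "QF y \<longleftrightarrow> (\<forall>u\<in>F. y u = K)" for y :: "'v \<Rightarrow> nat"
  have deps: "depends_on {v} (Qv p)" "depends_on {w} (Qw p)" "depends_on B (Qc p k)"
    "depends_on B' (Qd p k)" "depends_on F QF" for p k
    unfolding Qv_def Qw_def Qc_def Qd_def QF_def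
    by (rule depends_on_point depends_on_count | simp add: depends_on_def)+
  \<comment> \<open>Fixing the cells \<open>z\<close> of \<open>v\<close> and \<open>w\<close> turns
    the thresholds into constants, so the five conditions have disjoint supports. The nesting lets
    \<open>pr_indep2\<close> split off one factor at a time.\<close>
  define Q where "Q z y \<longleftrightarrow> Qv (fst z) y \<and> (Qw (snd z) y \<and> (Qc (fst z) (?kp (fst z) (snd z)) y \<and>
    (Qd (snd z) (?kp (snd z) (fst z)) y \<and> QF y)))" for z y
  have dQ: "depends_on ({v} \<union> ({w} \<union> (B \<union> (B' \<union> F)))) (Q z)" for z
    unfolding Q_def by (intro depends_on_conj deps)
  have reg: "regular (Q z)" for z
    by (rule regularI[OF _ _ dQ]) (use vw B F in auto)
  have sum: "pr (\<lambda>y. \<exists>z\<in>{..<K} \<times> {..<K}. Q z y) = (\<Sum>z\<in>{..<K} \<times> {..<K}. pr (Q z))"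
  proof (intro pr_disjoint_sum reg)
    show "z = z'" if "Q z y" "Q z' y" for z z' y
      using that unfolding Q_def Qv_def Qw_def by (intro prod_eqI) auto
  qed simp
  have prQ: "pr (Q (p, q)) = h * (h * (binomial_cdf n (?kp p q) ((real p + 1) * h) *
      (binomial_cdf n (?kp q p) ((real q + 1) * h) * (1 - real K * h) ^ card F)))"
    if "p < K" "q < K" for p q
  proof -
    have "pr (\<lambda>y. Qd q (?kp q p) y \<and> QF y) = pr (Qd q (?kp q p)) * pr QF"
      by (rule pr_indep2[OF _ _ _ _ deps(4,5)]) (use B F dB in auto)
    moreover have "pr (\<lambda>y. Qc p (?kp p q) y \<and> (Qd q (?kp q p) y \<and> QF y)) =
        pr (Qc p (?kp p q)) * pr (\<lambda>y. Qd q (?kp q p) y \<and> QF y)"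
      by (rule pr_indep2[OF _ _ _ _ deps(3) depends_on_conj[OF deps(4,5)]]) (use B F dB in auto)
    moreover have "pr (\<lambda>y. Qw q y \<and> (Qc p (?kp p q) y \<and> (Qd q (?kp q p) y \<and> QF y))) =
        pr (Qw q) * pr (\<lambda>y. Qc p (?kp p q) y \<and> (Qd q (?kp q p) y \<and> QF y))"
      by (rule pr_indep2[OF _ _ _ _ deps(2) depends_on_conj[OF deps(3) depends_on_conj[OF deps(4,5)]]])
        (use B F dB vw in auto)
    moreover have "pr (Q (p, q)) =
        pr (Qv p) * pr (\<lambda>y. Qw q y \<and> (Qc p (?kp p q) y \<and> (Qd q (?kp q p) y \<and> QF y)))"
      unfolding Q_def fst_conv snd_conv
      by (rule pr_indep2[OF _ _ _ _ deps(1) depends_on_conj[OF deps(2)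
              depends_on_conj[OF deps(3) depends_on_conj[OF deps(4,5)]]]])
        (use B F dB vw in auto)
    moreover have "pr (Qv p) = h" "pr (Qw q) = h"
      unfolding Qv_def Qw_def using pr_eq vw that by auto
    moreover have "pr (Qc p (?kp p q)) = binomial_cdf n (?kp p q) ((real p + 1) * h)"
      "pr (Qd q (?kp q p)) = binomial_cdf n (?kp q p) ((real q + 1) * h)"
      unfolding Qc_def Qd_def using pr_count[of B p] pr_count[of B' q] B that by auto
    moreover have "pr QF = (1 - real K * h) ^ card F"
      unfolding QF_def using F pr_all_high by auto
    ultimately show ?thesis by simp
  qed
  have bnd: "0 \<le> (real p + 1) * h \<and> (real p + 1) * h \<le> 1" if "p < K" for p
  proof -
    have "(real p + 1) * h \<le> real K * h" using that h_pos by (intro mult_right_mono) auto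
    moreover have "0 \<le> (real p + 1) * h" using h_pos by simp
    ultimately show ?thesis using Kh by linarith
  qed
  have "block_bound K n h = (\<Sum>z\<in>{..<K} \<times> {..<K}. h\<^sup>2 * (1 - real K * h)\<^sup>2 *
     (binomial_cdf n (?kp (fst z) (snd z)) ((real (fst z) + 1) * h) *
      binomial_cdf n (?kp (snd z) (fst z)) ((real (snd z) + 1) * h)))"
    unfolding block_bound_def sum.cartesian_product sum_distrib_left by (simp add: case_prod_beta)
  also have "\<dots> \<le> (\<Sum>z\<in>{..<K} \<times> {..<K}. pr (Q z))"
  proof (intro sum_mono)
    fix z assume z: "z \<in> {..<K} \<times> {..<K}"
    obtain p q where pq: "z = (p, q)" "p < K" "q < K" using z by auto
    have "(1 - real K * h)\<^sup>2 \<le> (1 - real K * h) ^ card F"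
      using F(3) Kh h_pos by (intro power_decreasing) auto
    moreover define \<beta> \<beta>' where "\<beta> = binomial_cdf n (?kp p q) ((real p + 1) * h)"
      and "\<beta>' = binomial_cdf n (?kp q p) ((real q + 1) * h)"
    moreover have "0 \<le> \<beta>" "0 \<le> \<beta>'"
      unfolding \<beta>_def \<beta>'_def using bnd[OF pq(2)] bnd[OF pq(3)] by (auto intro: binomial_cdf_nonneg)
    ultimately have "h\<^sup>2 * (\<beta> * \<beta>') * (1 - real K * h)\<^sup>2 \<le> h\<^sup>2 * (\<beta> * \<beta>') * (1 - real K * h) ^ card F"
      by (intro mult_left_mono) auto
    then show "h\<^sup>2 * (1 - real K * h)\<^sup>2 *
     (binomial_cdf n (?kp (fst z) (snd z)) ((real (fst z) + 1) * h) *
      binomial_cdf n (?kp (snd z) (fst z)) ((real (snd z) + 1) * h)) \<le> pr (Q z)"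
      using prQ[OF pq(2,3)]
      unfolding pq fst_conv snd_conv \<beta>_def[symmetric] \<beta>'_def[symmetric]
      by (simp add: power2_eq_square[of h] ac_simps)
  qed
  also have "\<dots> = pr (\<lambda>y. \<exists>z\<in>{..<K} \<times> {..<K}. Q z y)" using sum by simp
  also have "\<dots> \<le> pr (block_open K v w C C' F)"
  proof (rule pr_mono)
    show "regular (block_open K v w C C' F)"
      by (rule regularI[OF _ _ depends_on_block_open]) (use vw C C' F in auto)
    fix y assume "\<exists>z\<in>{..<K} \<times> {..<K}. Q z y"
    then have "block_open K v w B B' F y"
      by (auto simp: block_open_def Q_def Qv_def Qw_def Qc_def Qd_def QF_def)
    then show "block_open K v w C C' F y"
      by (rule block_open_mono[rotated -1]) (use B in \<open>auto simp: B_def B'_def\<close>)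
  qed
  finally show ?thesis .
qed

end

section \<open>Poisson limit and a numerical lower bound\<close>

lemma binomial_cdf_limit:
  fixes t :: real
  assumes k: "k \<in> {1, 2}"
  shows "(\<lambda>n. binomial_cdf n k (t / real n)) \<longlonglongrightarrow> exp (- t) * (if k = 1 then 1 + t else 1 + t + t\<^sup>2 / 2)"
proof -
  have base: "(\<lambda>n. (1 - t / real n) ^ n) \<longlonglongrightarrow> exp (- t)"
    using tendsto_exp_limit_sequentially[of "-t"] by simp
  have ev: "eventually (\<lambda>n. 1 - t / real n \<noteq> 0 \<and> n \<ge> 2) sequentially"
  proof -
    have "eventually (\<lambda>n. 1 - t / real n > 0) sequentially" by real_asymp
    then show ?thesis using eventually_ge_at_top[of 2] by eventually_elim auto
  qed
  have inv: "(\<lambda>n. 1 / real n) \<longlonglongrightarrow> 0" "(\<lambda>n. t / real n) \<longlonglongrightarrow> 0" by real_asymp+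
  have "(\<lambda>n. if k = 1 then 0 else (1 - 1 / real n) * t\<^sup>2 / 2 / (1 - t / real n)\<^sup>2)
    \<longlonglongrightarrow> (if k = 1 then 0 else (1 - 0) * t\<^sup>2 / 2 / (1 - 0)\<^sup>2)"
  proof (cases "k = 1")
    case False
    then show ?thesis by (simp only: if_False, intro tendsto_intros inv) auto
  qed simp
  then have "(\<lambda>n. (1 - t / real n) ^ n * (1 + t / (1 - t / real n)
      + (if k = 1 then 0 else (1 - 1 / real n) * t\<^sup>2 / 2 / (1 - t / real n)\<^sup>2)))
    \<longlonglongrightarrow> exp (- t) * (1 + t / (1 - 0) + (if k = 1 then 0 else (1 - 0) * t\<^sup>2 / 2 / (1 - 0)\<^sup>2))"
    by (intro tendsto_mult tendsto_add tendsto_diff tendsto_divide tendsto_const base inv) auto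
  moreover have "eventually (\<lambda>n. (1 - t / real n) ^ n * (1 + t / (1 - t / real n)
      + (if k = 1 then 0 else (1 - 1 / real n) * t\<^sup>2 / 2 / (1 - t / real n)\<^sup>2))
      = binomial_cdf n k (t / real n)) sequentially"
    using ev
  proof eventually_elim
    case (elim n)
    let ?y = "1 - t / real n"
    have y: "?y \<noteq> 0" and n: "n \<ge> 2" using elim by auto
    have p: "?y ^ (n - 1) = ?y ^ n / ?y" "?y ^ (n - 2) = ?y ^ n / ?y\<^sup>2"
      using y n power_diff[OF y, of 1 n] power_diff[OF y, of 2 n] by auto
    have c2: "real (n choose 2) = real n * (real n - 1) / 2"
    proof -
      have "even (n * (n - 1))" by (cases "even n") auto
      then show ?thesis using n unfolding choose_two by (simp add: real_of_nat_div of_nat_diff)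
    qed
    have "real n * (real n - 1) / 2 * (t / real n)\<^sup>2 = (1 - 1 / real n) * t\<^sup>2 / 2"
      using n by (simp add: field_simps power2_eq_square)
    then have 2: "real (n choose 2) * (t / real n)\<^sup>2 = (1 - 1 / real n) * t\<^sup>2 / 2" by (simp add: c2)
    have 1: "real n * (t / real n) = t" using n by simp
    have b1: "binomial_cdf n 1 (t / real n) = ?y ^ n * (1 + t / ?y)"
    proof -
      have "binomial_cdf n 1 (t / real n) = ?y ^ n + real n * (t / real n) * ?y ^ (n - 1)"
        by (simp add: binomial_cdf_def)
      then show ?thesis by (simp only: p(1) 1) (simp add: distrib_left)
    qed
    show ?case
    proof (cases "k = 1")
      case False
      then have "binomial_cdf n k (t / real n) = binomial_cdf n 1 (t / real n)
          + real (n choose 2) * (t / real n)\<^sup>2 * ?y ^ (n - 2)"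
        using k by (simp add: binomial_cdf_def numeral_2_eq_2)
      also have "\<dots> = ?y ^ n * (1 + t / ?y) + (1 - 1 / real n) * t\<^sup>2 / 2 * (?y ^ n / ?y\<^sup>2)"
        by (simp only: b1 2 p(2))
      finally show ?thesis using False by (simp add: distrib_left)
    qed (simp add: b1[simplified])
  qed
  ultimately have "(\<lambda>n. binomial_cdf n k (t / real n)) \<longlonglongrightarrow>
     exp (- t) * (1 + t / (1 - 0) + (if k = 1 then 0 else (1 - 0) * t\<^sup>2 / 2 / (1 - 0)\<^sup>2))"
    by (rule Lim_transform_eventually)
  then show ?thesis by (simp add: if_distrib cong: if_cong)
qed


lemma lessThan_30: "{..<30::nat} = {0, 1, 2, 3, 4, 5, 6, 7, 8, 9, 10, 11, 12, 13, 14, 15, 16, 17, 18, 19, 20, 21, 22, 23, 24, 25, 26, 27, 28, 29}"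
  by (simp add: lessThan_nat_numeral lessThan_Suc insert_commute)

text \<open>\<open>10\<^sup>4 e\<^sup>-\<^sup>t (1 + t)\<close> and \<open>10\<^sup>4 e\<^sup>-\<^sup>t (1 + t + t\<^sup>2/2)\<close> at \<open>t = (p + 1)/4\<close>, rounded down after
  replacing \<open>e\<^bsup>-1/4\<^esup>\<close> by \<open>3893/5000\<close>.\<close>

definition pois1 :: "nat list" where
  "pois1 = [9732, 9093, 8260, 7350, 6438, 5569, 4770, 4051, 3417, 2865, 2390, 1985, 1642, 1353, 1112, 912, 745, 608, 495, 402, 326, 264, 213, 172, 139, 112, 90, 72, 58, 46]"

definition pois2 :: "nat list" where
  "pois2 = [9975, 9851, 9587, 9187, 8673, 8075, 7426, 6752, 6079, 5424, 4800, 4218, 3683, 3196, 2759, 2371, 2028, 1727, 1466, 1240, 1045, 878, 736, 615, 513, 427, 355, 294, 243, 201]"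

text \<open>The bound comes from \<open>(1 - 1/1024)^256\<close>, computed by four successive fourth
  powers, each rounded down to six decimals so that the numerals stay small.\<close>

lemma exp_quarter: "exp (- 1 / 4 :: real) \<ge> 3893 / 5000"
proof -
  have step: "y \<le> exp (4 * x)" if "z \<le> exp x" "0 \<le> z" "y \<le> z ^ 4" for x y z :: real
    using that power_mono[of z "exp x" 4] by (simp add: exp_of_nat_mult[symmetric] flip: exp_of_nat2_mult)
  have "1023 / 1024 \<le> exp (- 1 / 1024 :: real)"
    using exp_ge_add_one_self[of "- 1 / 1024 :: real"] by simp
  then have "996099 / 10 ^ 6 \<le> exp (4 * (- 1 / 1024) :: real)" by (rule step) (simp_all add: power_divide)
  then have "984487 / 10 ^ 6 \<le> exp (4 * (4 * (- 1 / 1024)) :: real)" by (rule step) (simp_all add: power_divide)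
  then have "939377 / 10 ^ 6 \<le> exp (4 * (4 * (4 * (- 1 / 1024))) :: real)" by (rule step) (simp_all add: power_divide)
  then have "778681 / 10 ^ 6 \<le> exp (4 * (4 * (4 * (4 * (- 1 / 1024)))) :: real)" by (rule step) (simp_all add: power_divide)
  then show ?thesis by simp
qed

lemma poisson_table:
  assumes "p < 30"
  defines "t \<equiv> (real p + 1) / 4"
  shows "real (pois1 ! p) / 10 ^ 4 \<le> exp (- t) * (1 + t)"
    and "real (pois2 ! p) / 10 ^ 4 \<le> exp (- t) * (1 + t + t\<^sup>2 / 2)"
proof -
  have "exp (- t) = exp (- 1 / 4) ^ (p + 1)"
    by (simp add: t_def exp_of_nat_mult[symmetric] algebra_simps flip: exp_add)
  also have "\<dots> \<ge> (3893 / 5000) ^ (p + 1)" using exp_quarter by (intro power_mono) auto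
  finally have e: "(3893 / 5000) ^ (p + 1) \<le> exp (- t)" .
  have p: "p \<in> {0, 1, 2, 3, 4, 5, 6, 7, 8, 9, 10, 11, 12, 13, 14, 15, 16, 17, 18, 19, 20, 21, 22, 23, 24, 25, 26, 27, 28, 29}" using assms(1) unfolding lessThan_30[symmetric] by simp
  have "real (pois1 ! p) / 10 ^ 4 \<le> (3893 / 5000) ^ (p + 1) * (1 + t) \<and>
     real (pois2 ! p) / 10 ^ 4 \<le> (3893 / 5000) ^ (p + 1) * (1 + t + t\<^sup>2 / 2)"
    using p unfolding t_def pois1_def pois2_def
    by (elim insertE emptyE; simp add: power_divide)
  moreover have "(3893 / 5000) ^ (p + 1) * (1 + t) \<le> exp (- t) * (1 + t)"
    "(3893 / 5000) ^ (p + 1) * (1 + t + t\<^sup>2 / 2) \<le> exp (- t) * (1 + t + t\<^sup>2 / 2)"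
    using e by (intro mult_right_mono; simp add: t_def)+
  ultimately show "real (pois1 ! p) / 10 ^ 4 \<le> exp (- t) * (1 + t)"
    "real (pois2 ! p) / 10 ^ 4 \<le> exp (- t) * (1 + t + t\<^sup>2 / 2)" by linarith+
qed

lemma pois_sum:
  "(\<Sum>p<30. \<Sum>q<30. (if p < q then pois2 ! p else pois1 ! p) *
      (if q < p then pois2 ! q else pois1 ! q)) \<ge> (6784 * 10 ^ 6 :: nat)"
  unfolding lessThan_30 pois1_def pois2_def by simp

text \<open>Only that the constant exceeds \<open>1\<close> matters. Blocks of a single vertex would give exactly \<open>1\<close>.
  The cell width \<open>1/(8 d)\<close> is \<open>1/4\<close> in rescaled age.\<close>

lemma block_bound_large:
  "eventually (\<lambda>d. 105 / 100 / (real d)\<^sup>2 \<le> block_bound 30 (2 * d) (1 / (8 * real d))) sequentially"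
proof -
  define t where "t p = (real p + 1) / 4" for p
  define G where "G p k = exp (- t p) * (if k = 1 then 1 + t p else 1 + t p + (t p)\<^sup>2 / 2)" for p k :: nat
  let ?kp = "\<lambda>p q. if p < q then 2 else 1 :: nat"
  define S where "S = (\<Sum>p<30. \<Sum>q<30. G p (?kp p q) * G q (?kp q p))"
  have lim: "(\<lambda>d. binomial_cdf (2 * d) (?kp p q) ((real p + 1) * (1 / (8 * real d)))) \<longlonglongrightarrow> G p (?kp p q)"
    for p q
  proof -
    have "filterlim (\<lambda>d. 2 * d) sequentially (sequentially :: nat filter)" by real_asymp
    from filterlim_compose[OF binomial_cdf_limit[of "?kp p q" "t p"] this]
    have "(\<lambda>d. binomial_cdf (2 * d) (?kp p q) (t p / real (2 * d))) \<longlonglongrightarrow> G p (?kp p q)"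
      unfolding G_def by simp
    moreover have "t p / real (2 * d) = (real p + 1) * (1 / (8 * real d))" for d
      by (simp add: t_def)
    ultimately show ?thesis by simp
  qed
  have 0: "(\<lambda>d. real 30 * (1 / (8 * real d))) \<longlonglongrightarrow> 0" by real_asymp
  have "(\<lambda>d. (1 / 8)\<^sup>2 * (1 - real 30 * (1 / (8 * real d)))\<^sup>2 *
     (\<Sum>p<30. \<Sum>q<30. binomial_cdf (2 * d) (?kp p q) ((real p + 1) * (1 / (8 * real d))) *
                   binomial_cdf (2 * d) (?kp q p) ((real q + 1) * (1 / (8 * real d)))))
     \<longlonglongrightarrow> (1 / 8)\<^sup>2 * (1 - 0)\<^sup>2 * S"
    unfolding S_def by (intro tendsto_intros 0 lim)
  \<comment> \<open>The factor \<open>1/8\<close> per vertex is \<open>d * h\<close>, the number of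
    directions times the probability of a cell. The table gives \<open>S \<ge> 67.84\<close>, and
    \<open>67.84 / 64 = 1.06\<close>.\<close>
  moreover have "(1 / 8)\<^sup>2 * (1 - 0)\<^sup>2 * S > 105 / 100"
  proof -
    have "6784 * 10 ^ 6 / 10 ^ 8 \<le> real (\<Sum>p<30. \<Sum>q<30. (if p < q then pois2 ! p else pois1 ! p) *
      (if q < p then pois2 ! q else pois1 ! q)) / 10 ^ 8"
      using of_nat_mono[OF pois_sum, where 'a = real] by (intro divide_right_mono) auto
    also have "\<dots> = (\<Sum>p<30. \<Sum>q<30. (real (if p < q then pois2 ! p else pois1 ! p) / 10 ^ 4) *
      (real (if q < p then pois2 ! q else pois1 ! q) / 10 ^ 4))"
      by (simp add: sum_divide_distrib)
    also have "\<dots> \<le> S"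
      unfolding S_def
    proof (intro sum_mono mult_mono)
      fix p q :: nat assume "p \<in> {..<30}" "q \<in> {..<30}"
      then show "real (if p < q then pois2 ! p else pois1 ! p) / 10 ^ 4 \<le> G p (?kp p q)"
        "real (if q < p then pois2 ! q else pois1 ! q) / 10 ^ 4 \<le> G q (?kp q p)"
        using poisson_table[of p] poisson_table[of q] unfolding G_def t_def by auto
    qed (auto simp: G_def t_def)
    finally show ?thesis by (simp add: power2_eq_square)
  qed
  ultimately have "eventually (\<lambda>d. 105 / 100 < (1 / 8)\<^sup>2 * (1 - real 30 * (1 / (8 * real d)))\<^sup>2 *
     (\<Sum>p<30. \<Sum>q<30. binomial_cdf (2 * d) (?kp p q) ((real p + 1) * (1 / (8 * real d))) *
                   binomial_cdf (2 * d) (?kp q p) ((real q + 1) * (1 / (8 * real d))))) sequentially"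
    by (rule order_tendstoD(1))
  then show ?thesis using eventually_gt_at_top[of 0]
  proof eventually_elim
    case (elim d)
    let ?A = "(1 - real 30 * (1 / (8 * real d)))\<^sup>2 *
     (\<Sum>p<30. \<Sum>q<30. binomial_cdf (2 * d) (?kp p q) ((real p + 1) * (1 / (8 * real d))) *
                   binomial_cdf (2 * d) (?kp q p) ((real q + 1) * (1 / (8 * real d))))"
    have "105 / 100 / (real d)\<^sup>2 \<le> (1 / 8)\<^sup>2 * ?A / (real d)\<^sup>2"
      using elim(1) by (intro divide_right_mono) (auto simp: mult.assoc)
    also have "\<dots> = (1 / (8 * real d))\<^sup>2 * ?A" by (simp add: power_mult_distrib power_divide)
    finally show ?case by (simp add: block_bound_def mult.assoc)
  qed
qed

section \<open>A supersolution for pairs of random words\<close>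

definition sq_norm :: "nat \<Rightarrow> (nat \<Rightarrow> int) \<Rightarrow> real" where
  "sq_norm d x = (\<Sum>i\<in>{1..d}. (real_of_int (x i))\<^sup>2)"

text \<open>Not the Green function of the difference walk, but an explicit function that one step
  decreases on average by at least its square. The offset 32 keeps the leading variance term of the
  expansion at most a quarter of the leading drift term.\<close>

definition green :: "nat \<Rightarrow> (nat \<Rightarrow> int) \<Rightarrow> real" where
  "green d x = 1 / (32 + sq_norm d x)"

text \<open>The one-step expectation for the difference of two independent uniformly random oriented
  paths, one moving in direction \<open>a\<close> and the other in direction
  \<open>b\<close>.\<close>

definition avg :: "nat \<Rightarrow> ((nat \<Rightarrow> int) \<Rightarrow> real) \<Rightarrow> (nat \<Rightarrow> int) \<Rightarrow> real" where
  "avg d g x = (\<Sum>a\<in>{1..d}. \<Sum>b\<in>{1..d}. g (x + unit_vector a - unit_vector b)) / (real d)\<^sup>2"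

lemma sq_norm_nonneg: "0 \<le> sq_norm d x"
  unfolding sq_norm_def by (intro sum_nonneg) auto

lemma sq_norm_step:
  assumes "a \<in> {1..d}" "b \<in> {1..d}"
  shows "sq_norm d (x + unit_vector a - unit_vector b) =
    sq_norm d x + (if a = b then 0 else 2 * real_of_int (x a - x b) + 2)"
proof (cases "a = b")
  case False
  have "sq_norm d (x + unit_vector a - unit_vector b) = (\<Sum>i\<in>{1..d}. (real_of_int (x i))\<^sup>2 +
      (if i = a then 2 * real_of_int (x a) + 1 else 0) + (if i = b then 1 - 2 * real_of_int (x b) else 0))"
    unfolding sq_norm_def using False
    by (intro sum.cong refl) (auto simp: unit_vector_def power2_eq_square algebra_simps)
  also have "\<dots> = sq_norm d x + (2 * real_of_int (x a) + 1) + (1 - 2 * real_of_int (x b))"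
    unfolding sum.distrib sq_norm_def using assms by (simp add: sum.delta)
  finally show ?thesis using False by simp
qed simp

lemma diff_sq_le:
  assumes "a \<in> {1..d}" "b \<in> {1..d}"
  shows "(real_of_int (x a - x b))\<^sup>2 \<le> 2 * sq_norm d x"
proof (cases "a = b")
  case False
  have "(\<Sum>i\<in>{a, b}. (real_of_int (x i))\<^sup>2) \<le> sq_norm d x"
    unfolding sq_norm_def using assms by (intro sum_mono2) auto
  then have "(real_of_int (x a))\<^sup>2 + (real_of_int (x b))\<^sup>2 \<le> sq_norm d x" using False by simp
  moreover have "0 \<le> (real_of_int (x a) + real_of_int (x b))\<^sup>2" by simp
  ultimately show ?thesis by (simp add: power2_eq_square algebra_simps)
qed (use sq_norm_nonneg[of d x] in simp)

lemma green_bounds: "0 < green d x" "green d x \<le> 1"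
  using sq_norm_nonneg[of d x] by (auto simp: green_def)

text \<open>Second-order expansion of \<open>1 / (N + \<zeta>)\<close>: in high dimension the drift \<open>2\<close> of the squared
  norm beats its variance.\<close>

lemma avg_green_le:
  assumes d: "d \<ge> 68"
  shows "avg d (green d) x \<le> green d x - (green d x)\<^sup>2"
proof -
  define N where "N = 32 + sq_norm d x"
  define D where "D a b = real_of_int (x a - x b)" for a b
  define Z where "Z a b = (if a = b then 0 else 2 * D a b + 2)" for a b
  have N: "N \<ge> 32" "N > 0" using sq_norm_nonneg[of d x] by (auto simp: N_def)
  have pt: "green d (x + unit_vector a - unit_vector b) \<le> 1 / N - Z a b / N\<^sup>2 + 2 * (Z a b)\<^sup>2 / N ^ 3"
    if ab: "a \<in> {1..d}" "b \<in> {1..d}" for a b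
  proof -
    have "(D a b)\<^sup>2 \<le> 2 * (N - 32)" using diff_sq_le[OF ab, of x] by (simp add: N_def D_def)
    \<comment> \<open>This square absorbs \<open>2 * D\<close> into \<open>D^2 / 4\<close>, hence
      into \<open>(N - 32) / 2\<close>: one step leaves at least half of the denominator.\<close>
    moreover have "0 \<le> (D a b / 2 + 2)\<^sup>2" by simp
    ultimately have half: "N + Z a b \<ge> N / 2"
      using N by (simp add: Z_def power2_eq_square algebra_simps)
    then have pos: "N + Z a b > 0" using N by linarith
    have G: "green d (x + unit_vector a - unit_vector b) = 1 / (N + Z a b)"
      unfolding green_def sq_norm_step[OF ab] N_def Z_def D_def by (simp add: add.assoc)
    have "1 / (N + Z a b) = 1 / N - Z a b / N\<^sup>2 + (Z a b)\<^sup>2 / N\<^sup>2 * (1 / (N + Z a b))"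
    proof -
      have "1 / p = 1 / N - (p - N) / N\<^sup>2 + (p - N)\<^sup>2 / N\<^sup>2 * (1 / p)" if "p > 0" for p
        using that N by (simp add: field_simps power2_eq_square)
      from this[OF pos] show ?thesis by (simp only: add_diff_cancel_left')
    qed
    moreover have "(Z a b)\<^sup>2 / N\<^sup>2 * (1 / (N + Z a b)) \<le> (Z a b)\<^sup>2 / N\<^sup>2 * (2 / N)"
      using half N pos by (intro mult_left_mono) (simp_all add: field_simps)
    moreover have "(Z a b)\<^sup>2 / N\<^sup>2 * (2 / N) = 2 * (Z a b)\<^sup>2 / N ^ 3"
      by (simp add: power2_eq_square power3_eq_cube)
    ultimately show ?thesis unfolding G by linarith
  qed
  \<comment> \<open>\<open>D\<close> is antisymmetric, so the first-order term retains only the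
    drift 2 of the pairs with \<open>a \<noteq> b\<close>.\<close>
  have sumD: "(\<Sum>a\<in>{1..d}. \<Sum>b\<in>{1..d}. D a b) = 0"
    unfolding D_def by (simp add: sum_subtractf sum_distrib_left)
  have "(\<Sum>a\<in>{1..d}. \<Sum>b\<in>{1..d}. Z a b) = (\<Sum>a\<in>{1..d}. \<Sum>b\<in>{1..d}. (2 * D a b + 2) - (if b = a then 2 else 0))"
    by (intro sum.cong refl) (auto simp: Z_def D_def)
  also have "\<dots> = 2 * (real d)\<^sup>2 - 2 * real d"
    unfolding sum_subtractf sum.distrib sum_distrib_left[symmetric] sumD
    by (simp add: sum.delta power2_eq_square)
  finally have sumZ: "(\<Sum>a\<in>{1..d}. \<Sum>b\<in>{1..d}. Z a b) = 2 * (real d)\<^sup>2 - 2 * real d" .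
  have "(\<Sum>a\<in>{1..d}. \<Sum>b\<in>{1..d}. (D a b)\<^sup>2) =
     (\<Sum>a\<in>{1..d}. \<Sum>b\<in>{1..d}. (real_of_int (x a))\<^sup>2 + (real_of_int (x b))\<^sup>2 - 2 * (real_of_int (x a) * real_of_int (x b)))"
    by (intro sum.cong refl) (simp add: D_def power2_eq_square algebra_simps)
  also have "\<dots> = 2 * real d * sq_norm d x - 2 * (\<Sum>a\<in>{1..d}. real_of_int (x a))\<^sup>2"
    unfolding sum_subtractf sum.distrib sum_distrib_left[symmetric]
    by (simp add: sq_norm_def power2_eq_square[of "sum _ _"] sum_product flip: sum_distrib_left)
  also have "\<dots> \<le> 2 * real d * sq_norm d x" by simp
  finally have sumDD: "(\<Sum>a\<in>{1..d}. \<Sum>b\<in>{1..d}. (D a b)\<^sup>2) \<le> 2 * real d * sq_norm d x" .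
  have "(Z a b)\<^sup>2 \<le> 8 * (D a b)\<^sup>2 + 8" for a b
  proof -
    have "0 \<le> (2 * D a b - 2)\<^sup>2" by simp
    then show ?thesis by (simp add: Z_def power2_eq_square algebra_simps)
  qed
  then have "(\<Sum>a\<in>{1..d}. \<Sum>b\<in>{1..d}. (Z a b)\<^sup>2) \<le> (\<Sum>a\<in>{1..d}. \<Sum>b\<in>{1..d}. 8 * (D a b)\<^sup>2 + 8)"
    by (intro sum_mono)
  also have "\<dots> = 8 * (\<Sum>a\<in>{1..d}. \<Sum>b\<in>{1..d}. (D a b)\<^sup>2) + 8 * (real d)\<^sup>2"
    by (simp add: sum.distrib sum_distrib_left power2_eq_square)
  also have "\<dots> \<le> 16 * real d * N + 8 * (real d)\<^sup>2"
  proof -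
    have "2 * real d * sq_norm d x \<le> 2 * real d * N" by (intro mult_left_mono) (auto simp: N_def)
    then show ?thesis using sumDD by linarith
  qed
  finally have sumZZ: "(\<Sum>a\<in>{1..d}. \<Sum>b\<in>{1..d}. (Z a b)\<^sup>2) \<le> 16 * real d * N + 8 * (real d)\<^sup>2" .
  have "(real d)\<^sup>2 * avg d (green d) x = (\<Sum>a\<in>{1..d}. \<Sum>b\<in>{1..d}. green d (x + unit_vector a - unit_vector b))"
    using d by (simp add: avg_def)
  also have "\<dots> \<le> (\<Sum>a\<in>{1..d}. \<Sum>b\<in>{1..d}. 1 / N - Z a b / N\<^sup>2 + 2 * (Z a b)\<^sup>2 / N ^ 3)"
    by (intro sum_mono pt)
  also have "\<dots> = (real d)\<^sup>2 / N - (\<Sum>a\<in>{1..d}. \<Sum>b\<in>{1..d}. Z a b) / N\<^sup>2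
      + 2 * (\<Sum>a\<in>{1..d}. \<Sum>b\<in>{1..d}. (Z a b)\<^sup>2) / N ^ 3"
    by (simp add: sum.distrib sum_subtractf sum_divide_distrib sum_distrib_left power2_eq_square)
  also have "\<dots> \<le> (real d)\<^sup>2 / N - (2 * (real d)\<^sup>2 - 2 * real d) / N\<^sup>2
      + 2 * (16 * real d * N + 8 * (real d)\<^sup>2) / N ^ 3"
    unfolding sumZ using sumZZ N by (intro add_left_mono divide_right_mono) auto
  also have "2 * (16 * real d * N + 8 * (real d)\<^sup>2) / N ^ 3 = (32 * real d + 16 * (real d)\<^sup>2 / N) / N\<^sup>2"
    using N by (simp add: field_simps power2_eq_square power3_eq_cube)
  also have "\<dots> \<le> (32 * real d + (real d)\<^sup>2 / 2) / N\<^sup>2"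
  proof -
    have "16 * (real d)\<^sup>2 / N \<le> 16 * (real d)\<^sup>2 / 32" using N by (intro divide_left_mono) auto
    then show ?thesis using N by (intro divide_right_mono) auto
  qed
  also have "(real d)\<^sup>2 / N - (2 * (real d)\<^sup>2 - 2 * real d) / N\<^sup>2 + (32 * real d + (real d)\<^sup>2 / 2) / N\<^sup>2
      = (real d)\<^sup>2 / N - (3 / 2 * (real d)\<^sup>2 - 34 * real d) / N\<^sup>2"
    by (simp add: diff_divide_distrib add_divide_distrib)
  also have "\<dots> \<le> (real d)\<^sup>2 / N - (real d)\<^sup>2 / N\<^sup>2"
  proof -
    \<comment> \<open>The linear loss \<open>34 d\<close>, of which \<open>2 d\<close> comes from
      the pairs \<open>a = b\<close> and \<open>32 d\<close> from the squares of \<open>D\<close>,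
      has to stay below \<open>d^2 / 2\<close>.\<close>
    have "68 * real d \<le> (real d)\<^sup>2" using d unfolding power2_eq_square by (intro mult_right_mono) auto
    then have "(real d)\<^sup>2 \<le> 3 / 2 * (real d)\<^sup>2 - 34 * real d" by linarith
    then show ?thesis by (intro diff_left_mono divide_right_mono) auto
  qed
  also have "\<dots> = (real d)\<^sup>2 * (green d x - (green d x)\<^sup>2)"
    by (simp add: green_def N_def power_divide algebra_simps)
  finally show ?thesis using d by simp
qed

lemma avg_mono: "(\<And>a b. a \<in> {1..d} \<Longrightarrow> b \<in> {1..d} \<Longrightarrow>
    g (x + unit_vector a - unit_vector b) \<le> g' (x + unit_vector a - unit_vector b))
    \<Longrightarrow> avg d g x \<le> avg d g' x"
  unfolding avg_def by (intro divide_right_mono sum_mono) auto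

lemma avg_add: "avg d (\<lambda>y. g y + g' y) x = avg d g x + avg d g' x"
  unfolding avg_def by (simp add: sum.distrib add_divide_distrib)

lemma avg_cmult: "avg d (\<lambda>y. c * g y) x = c * avg d g x"
  unfolding avg_def by (simp add: sum_distrib_left[symmetric])

lemma avg_const: "d > 0 \<Longrightarrow> avg d (\<lambda>y. c) x = c"
  unfolding avg_def by (simp add: power2_eq_square)

lemma unit_vector_eq_iff: "unit_vector a = unit_vector b \<longleftrightarrow> a = b"
  unfolding unit_vector_def by (metis zero_neq_one)

text \<open>From \<open>0\<close> the pairs that stay are those with \<open>a = b\<close>, which are
  \<open>d\<close> out of \<open>d^2\<close>. From \<open>x \<noteq> 0\<close> the equation
  \<open>x = e_b - e_a\<close> determines the pair, and it forces squared norm 2.\<close>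

lemma avg_hit_zero:
  assumes d: "d > 0"
  shows "avg d (\<lambda>y. if y = 0 then 1 else 0) x \<le>
    (if x = 0 then 1 / real d else if sq_norm d x \<le> 2 then 1 / (real d)\<^sup>2 else 0)"
proof -
  let ?g = "\<lambda>y :: nat \<Rightarrow> int. if y = 0 then 1 else 0 :: real"
  let ?H = "{(a, b). a \<in> {1..d} \<and> b \<in> {1..d} \<and> x + unit_vector a - unit_vector b = 0}"
  have fin: "finite ?H" by (rule finite_subset[of _ "{1..d} \<times> {1..d}"]) auto
  have "(\<Sum>a\<in>{1..d}. \<Sum>b\<in>{1..d}. ?g (x + unit_vector a - unit_vector b)) =
      (\<Sum>z\<in>{1..d} \<times> {1..d}. if z \<in> ?H then 1 else 0)"
    unfolding sum.cartesian_product
  proof (intro sum.cong refl)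
    fix z assume "z \<in> {1..d} \<times> {1..d}"
    then obtain a b where "z = (a, b)" "a \<in> {1..d}" "b \<in> {1..d}" by auto
    then show "(case z of (a, b) \<Rightarrow> ?g (x + unit_vector a - unit_vector b)) = (if z \<in> ?H then 1 else 0)"
      by simp
  qed
  also have "\<dots> = real (card ?H)"
  proof -
    have "({1..d} \<times> {1..d}) \<inter> {z. z \<in> ?H} = ?H" by auto
    then show ?thesis by (subst sum.If_cases) simp_all
  qed
  finally have avg: "avg d ?g x = real (card ?H) / (real d)\<^sup>2" by (simp add: avg_def)
  show ?thesis
  proof (cases "x = 0")
    case True
    have "?H = (\<lambda>a. (a, a)) ` {1..d}" using True by (auto simp: unit_vector_eq_iff)
    then have "card ?H = d" by (simp add: card_image inj_on_def)
    then show ?thesis using True d avg by (simp add: power2_eq_square)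
  next
    case False
    have uniq: "z = z'" if "z \<in> ?H" "z' \<in> ?H" for z z'
    proof -
      obtain a b a' b' where z: "z = (a, b)" "z' = (a', b')" by (cases z; cases z')
      have 1: "x + unit_vector a - unit_vector b = 0" "x + unit_vector a' - unit_vector b' = 0"
        using that z by auto
      then have "a \<noteq> b" "a' \<noteq> b'" using False by auto
      moreover have "x i + unit_vector a i - unit_vector b i = 0" "x i + unit_vector a' i - unit_vector b' i = 0" for i
        using fun_cong[OF 1(1), of i] fun_cong[OF 1(2), of i] by simp_all
      then have "unit_vector a i - unit_vector b i = unit_vector a' i - unit_vector b' i" for i
        by (smt (verit))
      from this[of a] this[of b] have "a = a'" "b = b'"
        using \<open>a \<noteq> b\<close> \<open>a' \<noteq> b'\<close> by (auto simp: unit_vector_def split: if_splits)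
      then show ?thesis using z by simp
    qed
    have "card ?H \<le> 1" using fin uniq by (auto simp: card_le_Suc0_iff_eq)
    then have "avg d ?g x \<le> 1 / (real d)\<^sup>2" unfolding avg by (intro divide_right_mono) auto
    moreover have "avg d ?g x = 0" if "\<not> sq_norm d x \<le> 2"
    proof (rule ccontr)
      assume "avg d ?g x \<noteq> 0"
      then have "?H \<noteq> {}" unfolding avg by (metis card.empty of_nat_0 div_0)
      then obtain a b where ab: "a \<in> {1..d}" "b \<in> {1..d}" "x + unit_vector a - unit_vector b = 0" by auto
      then have "x = unit_vector b - unit_vector a" by (metis add_diff_cancel_right' diff_add_eq diff_eq_eq diff_zero eq_iff_diff_eq_0)
      then have "x = 0 + unit_vector b - unit_vector a" by simp
      then have "sq_norm d x \<le> 2" using sq_norm_step[OF ab(2,1), of 0]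
        by (simp add: sq_norm_def split: if_splits)
      then show False using that by simp
    qed
    ultimately show ?thesis using False by auto
  qed
qed

text \<open>From squared norm at most 2, a step adds at most \<open>2 * 2 + 2\<close>. Consequently
  a difference far enough to have weight 1 cannot reach \<open>0\<close> within the two steps of a
  block.\<close>

lemma sq_norm_near:
  assumes "a \<in> {1..d}" "b \<in> {1..d}" "sq_norm d (x + unit_vector a - unit_vector b) \<le> 2"
  shows "sq_norm d x \<le> 8"
proof -
  define y where "y = x + unit_vector a - unit_vector b"
  have "x = y + unit_vector b - unit_vector a" by (simp add: y_def)
  then have x: "sq_norm d x = sq_norm d y + (if b = a then 0 else 2 * real_of_int (y b - y a) + 2)"
    using sq_norm_step[OF assms(2,1), of y] by metis
  have y: "sq_norm d y \<le> 2" using assms(3) by (simp add: y_def)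
  have "(real_of_int (y b - y a))\<^sup>2 \<le> 2\<^sup>2" using diff_sq_le[OF assms(2,1), of y] y by simp
  then have "real_of_int (y b - y a) \<le> 2" by (rule power2_le_imp_le) simp
  then show ?thesis using x y by (cases "b = a") simp_all
qed

text \<open>\<open>x\<close> and \<open>y\<close> are the differences of two paths at the first and second vertex of a block.\<close>

definition pair_weight :: "real \<Rightarrow> real \<Rightarrow> real \<Rightarrow> nat \<Rightarrow> (nat \<Rightarrow> int) \<Rightarrow> (nat \<Rightarrow> int) \<Rightarrow> real" where
  "pair_weight rf rp rn d x y =
    (if x = 0 \<and> y = 0 then rf else if x = 0 \<or> y = 0 then rp else if sq_norm d x \<le> 36 then rn else 1)"

definition potential :: "real \<Rightarrow> real \<Rightarrow> nat \<Rightarrow> (nat \<Rightarrow> int) \<Rightarrow> real" where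
  "potential \<kappa> B d x = 1 + \<kappa> / real d * green d x + B * real d * (if x = 0 then 1 else 0)"

lemma potential_ge_1: "0 \<le> \<kappa> \<Longrightarrow> 0 \<le> B \<Longrightarrow> 1 \<le> potential \<kappa> B d x"
  using green_bounds[of d x] by (simp add: potential_def)

text \<open>The outer average is the step inside a block, the inner one the step leaving it.
  \<open>zero\<close> is the balance at a common vertex after division by \<open>d\<close>, and
  \<open>near\<close> is the balance of the \<open>O(1/d)\<close> terms at a nonzero difference of
  squared norm at most 36. Farther away the superharmonicity of \<open>green\<close>
  suffices.\<close>

lemma potential_supersolution:
  assumes d: "d \<ge> 68" and nn: "0 \<le> \<kappa>" "0 \<le> B" "0 \<le> b0" "0 \<le> \<eta>" "0 \<le> \<rho>"
    and rf: "0 \<le> rf" "rf \<le> \<rho> * (real d)\<^sup>2" and rp: "0 \<le> rp" "rp \<le> b0 * real d"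
    and rn: "1 \<le> rn" "rn \<le> 1 + \<eta> / real d"
    and zero: "\<rho> * (1 + \<kappa> / real d + B) + b0 * (1 + \<kappa> / real d + B / real d) \<le> B"
    and near: "b0 * (1 + \<kappa> / real d + B) + \<eta> + B + \<eta> * (\<kappa> + B) / real d \<le> \<kappa> / 4624"
  shows "avg d (\<lambda>y. pair_weight rf rp rn d x y * avg d (potential \<kappa> B d) y) x \<le> potential \<kappa> B d x"
proof -
  let ?P = "avg d (potential \<kappa> B d)"
  let ?o = "\<lambda>y :: nat \<Rightarrow> int. if y = 0 then 1 else 0 :: real"
  let ?n = "\<lambda>y. if sq_norm d y \<le> 2 then 1 else 0 :: real"
  have d0: "real d > 0" "d > 0" using d by auto
  have sub: "avg d (green d) y \<le> green d y" for y
    using avg_green_le[OF d, of y] by (smt (verit) zero_le_power2)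
  have P: "?P y = 1 + \<kappa> / real d * avg d (green d) y + B * real d * avg d ?o y" for y
  proof -
    have "potential \<kappa> B d = (\<lambda>x. 1 + \<kappa> / real d * green d x + B * real d * ?o x)"
      by (rule ext) (simp add: potential_def)
    then show ?thesis by (simp only: avg_add avg_cmult avg_const[OF d0(2)])
  qed
  have P0: "?P y \<le> 1 + \<kappa> / real d + B" if "y = 0" for y
  proof -
    have "\<kappa> / real d * avg d (green d) y \<le> \<kappa> / real d * 1"
      using sub[of y] green_bounds[of d y] nn by (intro mult_left_mono) auto
    moreover have "B * real d * avg d ?o y \<le> B * real d * (1 / real d)"
      using avg_hit_zero[OF d0(2), of y] nn that by (intro mult_left_mono) auto
    ultimately show ?thesis using d0 by (simp add: P)
  qed
  have P1: "?P y \<le> 1 + \<kappa> / real d * green d y + B / real d * ?n y" if "y \<noteq> 0" for y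
  proof -
    have "\<kappa> / real d * avg d (green d) y \<le> \<kappa> / real d * green d y"
      using sub[of y] nn by (intro mult_left_mono) auto
    moreover have "B * real d * avg d ?o y \<le> B * real d * (?n y / (real d)\<^sup>2)"
      using avg_hit_zero[OF d0(2), of y] nn that by (intro mult_left_mono) (auto split: if_splits)
    moreover have "B * real d * (?n y / (real d)\<^sup>2) = B / real d * ?n y"
      using d0 by (simp add: power2_eq_square)
    ultimately show ?thesis unfolding P by linarith
  qed
  have pos: "0 \<le> ?P y" for y
    unfolding avg_def using potential_ge_1[OF nn(1,2)] by (intro divide_nonneg_nonneg sum_nonneg) (auto intro: order_trans[OF zero_le_one])
  let ?R = "pair_weight rf rp rn d x"
  show ?thesis
  proof (cases "x = 0")
    case True
    let ?c = "1 + \<kappa> / real d + B / real d"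
    have "?R y * ?P y \<le> \<rho> * (real d)\<^sup>2 * (1 + \<kappa> / real d + B) * ?o y + b0 * real d * ?c" for y
    proof (cases "y = 0")
      case y: True
      have "?R y * ?P y \<le> \<rho> * (real d)\<^sup>2 * (1 + \<kappa> / real d + B)"
        using True y rf P0[OF y] pos[of y] unfolding pair_weight_def by (auto intro!: mult_mono)
      moreover have "0 \<le> b0 * real d * ?c" using nn by simp
      ultimately show ?thesis using y by simp
    next
      case y: False
      have "\<kappa> / real d * green d y \<le> \<kappa> / real d * 1" using nn green_bounds[of d y] by (intro mult_left_mono) auto
      moreover have "B / real d * ?n y \<le> B / real d" using nn by auto
      ultimately have "?P y \<le> ?c" using P1[OF y] by linarith
      then have "?R y * ?P y \<le> b0 * real d * ?c"
        using True y rp pos[of y] nn unfolding pair_weight_def by (auto intro!: mult_mono)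
      then show ?thesis using y by simp
    qed
    then have "avg d (\<lambda>y. ?R y * ?P y) x \<le> avg d (\<lambda>y. \<rho> * (real d)\<^sup>2 * (1 + \<kappa> / real d + B) * ?o y + b0 * real d * ?c) x"
      by (intro avg_mono)
    also have "\<dots> = \<rho> * (real d)\<^sup>2 * (1 + \<kappa> / real d + B) * avg d ?o x + b0 * real d * ?c"
      by (simp only: avg_add avg_cmult avg_const[OF d0(2)])
    also have "\<dots> \<le> \<rho> * (real d)\<^sup>2 * (1 + \<kappa> / real d + B) * (1 / real d) + b0 * real d * ?c"
      using avg_hit_zero[OF d0(2), of x] True nn by (intro add_right_mono mult_left_mono) auto
    also have "\<dots> = real d * (\<rho> * (1 + \<kappa> / real d + B) + b0 * ?c)"
      using d0 by (simp add: power2_eq_square field_simps)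
    also have "\<dots> \<le> real d * B" using zero by (intro mult_left_mono) auto
    also have "\<dots> \<le> potential \<kappa> B d x"
      using True nn green_bounds[of d x] by (simp add: potential_def)
    finally show ?thesis .
  next
    case False
    show ?thesis
    proof (cases "sq_norm d x \<le> 36")
      case True
      let ?c0 = "b0 * real d * (1 + \<kappa> / real d + B)"
      \<comment> \<open>The bounds for \<open>y = 0\<close> and \<open>y \<noteq> 0\<close> are
        added, so that the average splits into the probability of hitting \<open>0\<close> and the
        average of \<open>green\<close>.\<close>
      have pt: "?R y * ?P y \<le> ?c0 * ?o y + rn * (1 + B / real d + \<kappa> / real d * green d y)" for y
      proof (cases "y = 0")
        case y: True
        have "?R y * ?P y \<le> ?c0"
          using False y rp P0[OF y] pos[of y] nn unfolding pair_weight_def by (auto intro!: mult_mono)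
        moreover have "0 \<le> rn * (1 + B / real d + \<kappa> / real d * green d y)"
          using nn rn green_bounds(1)[of d y] by (intro mult_nonneg_nonneg add_nonneg_nonneg) auto
        ultimately show ?thesis using y by simp
      next
        case y: False
        have "B / real d * ?n y \<le> B / real d" using nn by auto
        then have "?P y \<le> 1 + B / real d + \<kappa> / real d * green d y" using P1[OF y] by linarith
        then show ?thesis
          using False y True rn unfolding pair_weight_def by (auto intro!: mult_left_mono)
      qed
      let ?g = "green d x"
      \<comment> \<open>\<open>68 = 32 + 36\<close>, so \<open>green\<close> is at least
        \<open>1/68\<close> in the near region, and \<open>4624 = 68^2\<close>.\<close>
      have g: "1 / 4624 \<le> ?g\<^sup>2"
      proof -
        have "(1 / 68)\<^sup>2 \<le> ?g\<^sup>2"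
          unfolding green_def using True sq_norm_nonneg[of d x] by (intro power_mono divide_left_mono) auto
        then show ?thesis by (simp add: power2_eq_square)
      qed
      have "avg d (\<lambda>y. ?R y * ?P y) x \<le> avg d (\<lambda>y. ?c0 * ?o y + rn * (1 + B / real d + \<kappa> / real d * green d y)) x"
        by (intro avg_mono pt)
      also have "\<dots> = ?c0 * avg d ?o x + rn * (1 + B / real d + \<kappa> / real d * avg d (green d) x)"
        by (simp only: avg_add avg_cmult avg_const[OF d0(2)])
      also have "\<dots> \<le> ?c0 * (1 / (real d)\<^sup>2) + rn * (1 + B / real d + \<kappa> / real d * (?g - 1 / 4624))"
      proof (intro add_mono mult_left_mono order_refl)
        show "avg d ?o x \<le> 1 / (real d)\<^sup>2" using avg_hit_zero[OF d0(2), of x] False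
          by (smt (verit) zero_le_divide_1_iff zero_le_power2)
        show "avg d (green d) x \<le> ?g - 1 / 4624" using avg_green_le[OF d, of x] g by linarith
      qed (use nn rn in auto)
      also have "\<dots> \<le> ?c0 * (1 / (real d)\<^sup>2) + (1 + \<eta> / real d) * (1 + B / real d + \<kappa> / real d * (?g - 1 / 4624))"
      proof (intro add_left_mono mult_right_mono rn)
        have "avg d (green d) x \<ge> 0"
          unfolding avg_def using green_bounds(1) by (intro divide_nonneg_nonneg sum_nonneg) (auto intro: less_imp_le)
        then have "?g - 1 / 4624 \<ge> 0" using avg_green_le[OF d, of x] g by linarith
        then show "0 \<le> 1 + B / real d + \<kappa> / real d * (?g - 1 / 4624)" using nn by simp
      qed
      also have "\<dots> = 1 + \<kappa> / real d * ?g + (b0 * (1 + \<kappa> / real d + B) + \<eta> + B + \<eta> * (\<kappa> * (?g - 1 / 4624) + B) / real d - \<kappa> / 4624) / real d"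
        using d0 by (simp add: power2_eq_square field_simps)
      also have "\<dots> \<le> 1 + \<kappa> / real d * ?g"
      proof -
        have "\<kappa> * (?g - 1 / 4624) \<le> \<kappa> * 1" using nn green_bounds[of d x] by (intro mult_left_mono) auto
        then have "\<eta> * (\<kappa> * (?g - 1 / 4624) + B) / real d \<le> \<eta> * (\<kappa> + B) / real d"
          using nn by (intro divide_right_mono mult_left_mono) auto
        then have "b0 * (1 + \<kappa> / real d + B) + \<eta> + B + \<eta> * (\<kappa> * (?g - 1 / 4624) + B) / real d - \<kappa> / 4624 \<le> 0"
          using near by linarith
        then show ?thesis using d0 by (simp add: divide_nonpos_pos)
      qed
      finally show ?thesis using False by (simp add: potential_def)
    next
      case far: False
      have "?R (x + unit_vector a - unit_vector b) * ?P (x + unit_vector a - unit_vector b)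
          \<le> 1 + \<kappa> / real d * green d (x + unit_vector a - unit_vector b)"
        if ab: "a \<in> {1..d}" "b \<in> {1..d}" for a b
      proof -
        let ?y = "x + unit_vector a - unit_vector b"
        have "\<not> sq_norm d ?y \<le> 2" using sq_norm_near[OF ab, of x] far by auto
        moreover have "sq_norm d 0 \<le> 2" by (simp add: sq_norm_def)
        ultimately have "\<not> sq_norm d ?y \<le> 2" "?y \<noteq> 0" by metis+
        then show ?thesis using P1[of ?y] far False by (simp add: pair_weight_def)
      qed
      then have "avg d (\<lambda>y. ?R y * ?P y) x \<le> avg d (\<lambda>y. 1 + \<kappa> / real d * green d y) x"
        by (intro avg_mono)
      also have "\<dots> = 1 + \<kappa> / real d * avg d (green d) x"
        by (simp only: avg_add avg_cmult avg_const[OF d0(2)])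
      also have "\<dots> \<le> 1 + \<kappa> / real d * green d x"
        using sub[of x] nn by (intro add_left_mono mult_left_mono) auto
      finally show ?thesis using False by (simp add: potential_def)
    qed
  qed
qed

text \<open>Padding with direction 1 makes the words of length \<open>m\<close> a finite set of
  total functions, so that walks and blocks may read any position.\<close>

definition words :: "nat \<Rightarrow> nat \<Rightarrow> (nat \<Rightarrow> nat) set" where
  "words d m = {a. (\<forall>i<m. a i \<in> {1..d}) \<and> (\<forall>i\<ge>m. a i = 1)}"

primrec walk :: "(nat \<Rightarrow> int) \<Rightarrow> (nat \<Rightarrow> nat) \<Rightarrow> nat \<Rightarrow> nat \<Rightarrow> int" where
  "walk x a 0 = x"
| "walk x a (Suc m) = walk x a m + unit_vector (a m)"

lemma walk_cong: "(\<And>i. i < m \<Longrightarrow> a i = b i) \<Longrightarrow> walk x a m = walk x b m"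
  by (induction m) auto

lemma words_0: "words d 0 = {\<lambda>_. 1}"
  by (auto simp: words_def)

lemma words_Suc: "words d (Suc m) = (\<lambda>(a, j). a(m := j)) ` (words d m \<times> {1..d})"
proof (intro set_eqI iffI)
  fix a assume a: "a \<in> words d (Suc m)"
  then have "a = (\<lambda>(a, j). a(m := j)) (a(m := 1), a m)" "(a(m := 1), a m) \<in> words d m \<times> {1..d}"
    by (auto simp: words_def)
  then show "a \<in> (\<lambda>(a, j). a(m := j)) ` (words d m \<times> {1..d})" by (rule image_eqI)
qed (auto simp: words_def split: if_splits)

lemma inj_words: "inj_on (\<lambda>(a, j). a(m := j)) (words d m \<times> {1..d})"
proof (rule inj_onI, clarify)
  fix a b i j assume ab: "a \<in> words d m" "b \<in> words d m" and eq: "a(m := i) = b(m := j)"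
  have "a k = b k" for k
    using fun_cong[OF eq, of k] ab by (cases "k = m") (auto simp: words_def)
  moreover have "i = j" using fun_cong[OF eq, of m] by simp
  ultimately show "a = b \<and> i = j" by auto
qed

lemma sum_words_Suc: "(\<Sum>a\<in>words d (Suc m). g a) = (\<Sum>a\<in>words d m. \<Sum>j\<in>{1..d}. g (a(m := j)))"
  unfolding words_Suc sum.reindex[OF inj_words]
  by (simp add: sum.cartesian_product case_prod_beta)

lemma finite_words: "finite (words d m)"
  by (induction m) (auto simp: words_0 words_Suc)

lemma card_words: "card (words d m) = d ^ m"
proof (induction m)
  case (Suc m)
  then show ?case unfolding words_Suc card_image[OF inj_words] card_cartesian_product by simp
qed (simp add: words_0)

lemma sum_pair_words_Suc:
  "(\<Sum>a\<in>words d (Suc m). \<Sum>b\<in>words d (Suc m). g a b) =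
   (\<Sum>a\<in>words d m. \<Sum>b\<in>words d m. \<Sum>i\<in>{1..d}. \<Sum>j\<in>{1..d}. g (a(m := i)) (b(m := j)))"
proof -
  have "(\<Sum>a\<in>words d (Suc m). \<Sum>b\<in>words d (Suc m). g a b) =
     (\<Sum>a\<in>words d m. \<Sum>i\<in>{1..d}. \<Sum>b\<in>words d m. \<Sum>j\<in>{1..d}. g (a(m := i)) (b(m := j)))"
    by (simp only: sum_words_Suc)
  also have "\<dots> = (\<Sum>a\<in>words d m. \<Sum>b\<in>words d m. \<Sum>i\<in>{1..d}. \<Sum>j\<in>{1..d}. g (a(m := i)) (b(m := j)))"
    by (intro sum.cong refl sum.swap)
  finally show ?thesis .
qed

definition walk_diff :: "(nat \<Rightarrow> nat) \<Rightarrow> (nat \<Rightarrow> nat) \<Rightarrow> nat \<Rightarrow> nat \<Rightarrow> int" where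
  "walk_diff a b m = walk 0 a m - walk 0 b m"

lemma walk_shift: "walk x a m = x + walk 0 a m"
  by (induction m) (auto simp: add.assoc)

lemma walk_diff_eq: "walk x a m - walk x b m = walk_diff a b m"
  unfolding walk_diff_def by (subst (1 2) walk_shift) simp

lemma walk_diff_Suc:
  "walk_diff a b (Suc m) = walk_diff a b m + unit_vector (a m) - unit_vector (b m)"
  by (simp add: walk_diff_def)

lemma walk_diff_cong:
  "(\<And>i. i < m \<Longrightarrow> a i = a' i) \<Longrightarrow> (\<And>i. i < m \<Longrightarrow> b i = b' i) \<Longrightarrow> walk_diff a b m = walk_diff a' b' m"
  unfolding walk_diff_def using walk_cong by metis

text \<open>Summing over the last letters of both words, which \<open>G\<close> does not read,
  amounts to \<open>d^2\<close> times one averaging step of the difference.\<close>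

lemma pair_words_step:
  assumes "d > 0" and dep: "\<And>a b i j. G (a(m := i)) (b(m := j)) = G a b"
  shows "(\<Sum>a\<in>words d (Suc m). \<Sum>b\<in>words d (Suc m). G a b * g (walk_diff a b m) (walk_diff a b (Suc m))) =
    (real d)\<^sup>2 * (\<Sum>a\<in>words d m. \<Sum>b\<in>words d m. G a b * avg d (g (walk_diff a b m)) (walk_diff a b m))"
proof -
  have 1: "walk_diff (a(m := i)) (b(m := j)) m = walk_diff a b m" for a b i j
    by (rule walk_diff_cong) auto
  have "(\<Sum>i\<in>{1..d}. \<Sum>j\<in>{1..d}. G (a(m := i)) (b(m := j)) *
       g (walk_diff (a(m := i)) (b(m := j)) m) (walk_diff (a(m := i)) (b(m := j)) (Suc m)))
     = (real d)\<^sup>2 * (G a b * avg d (g (walk_diff a b m)) (walk_diff a b m))" for a b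
  proof -
    have "(real d)\<^sup>2 * avg d f x = (\<Sum>i\<in>{1..d}. \<Sum>j\<in>{1..d}. f (x + unit_vector i - unit_vector j))"
      for f x using assms(1) by (simp add: avg_def)
    then have "(real d)\<^sup>2 * (c * avg d f x) = (\<Sum>i\<in>{1..d}. \<Sum>j\<in>{1..d}. c * f (x + unit_vector i - unit_vector j))"
      for c f x by (simp only: sum_distrib_left[symmetric] mult.left_commute[of "(real d)\<^sup>2"])
    then show ?thesis unfolding dep walk_diff_Suc 1 by simp
  qed
  then show ?thesis unfolding sum_pair_words_Suc by (simp add: sum_distrib_left)
qed

text \<open>Each block consumes two letters per word: summing over the later ones turns
  \<open>\<Phi>\<close> into its average, and the sum over the earlier ones is closed by
  \<open>super\<close>. Carrying \<open>\<Phi>\<close> at the endpoint is what makes the induction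
  work.\<close>

lemma pair_words_sum:
  assumes d: "d > 0" and R: "\<And>x y. 0 \<le> R x y"
    and super: "\<And>x. avg d (\<lambda>y. R x y * avg d \<Phi> y) x \<le> \<Phi> x"
  shows "(\<Sum>a\<in>words d (2 * n). \<Sum>b\<in>words d (2 * n).
      (\<Prod>i<n. R (walk_diff a b (2 * i)) (walk_diff a b (2 * i + 1))) * \<Phi> (walk_diff a b (2 * n)))
    \<le> (real d) ^ (4 * n) * \<Phi> 0"
proof (induction n)
  case 0
  then show ?case by (simp add: words_0 walk_diff_def)
next
  case (Suc n)
  let ?D = "walk_diff"
  let ?G = "\<lambda>n a b. \<Prod>i<n. R (?D a b (2 * i)) (?D a b (2 * i + 1))"
  have G: "?G n' (a(m := i)) (b(m := j)) = ?G n' a b" if "2 * n' \<le> m" for n' m a b i j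
  proof (intro prod.cong refl arg_cong2[where f = R])
    fix k assume "k \<in> {..<n'}"
    then have "2 * k + 1 \<le> m" using that by auto
    then show "?D (a(m := i)) (b(m := j)) (2 * k) = ?D a b (2 * k)"
      "?D (a(m := i)) (b(m := j)) (2 * k + 1) = ?D a b (2 * k + 1)"
      by (intro walk_diff_cong; simp)+
  qed
  have G': "?G (Suc n) (a(Suc (2 * n) := i)) (b(Suc (2 * n) := j)) = ?G (Suc n) a b" for a b i j
  proof -
    have "?D (a(Suc (2 * n) := i)) (b(Suc (2 * n) := j)) k = ?D a b k" if "k \<le> Suc (2 * n)" for k
      using that by (intro walk_diff_cong) auto
    then show ?thesis using G[of n "Suc (2 * n)" a i b j] by simp
  qed
  define S2 where "S2 = (\<Sum>a\<in>words d (2 * Suc n). \<Sum>b\<in>words d (2 * Suc n).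
    ?G (Suc n) a b * \<Phi> (?D a b (2 * Suc n)))"
  define S1 where "S1 = (\<Sum>a\<in>words d (Suc (2 * n)). \<Sum>b\<in>words d (Suc (2 * n)).
        ?G (Suc n) a b * avg d \<Phi> (?D a b (Suc (2 * n))))"
  define S0 where "S0 = (\<Sum>a\<in>words d (2 * n). \<Sum>b\<in>words d (2 * n). ?G n a b *
        avg d (\<lambda>y. R (?D a b (2 * n)) y * avg d \<Phi> y) (?D a b (2 * n)))"
  have "S2 = (real d)\<^sup>2 * S1"
    unfolding S2_def S1_def mult_Suc_right add_2_eq_Suc
    by (rule pair_words_step[OF d, of "?G (Suc n)" "Suc (2 * n)" "\<lambda>x y. \<Phi> y"]) (rule G')
  moreover have "S1 = (real d)\<^sup>2 * S0"
  proof -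
    have "S1 = (\<Sum>a\<in>words d (Suc (2 * n)). \<Sum>b\<in>words d (Suc (2 * n)). ?G n a b *
        (R (?D a b (2 * n)) (?D a b (Suc (2 * n))) * avg d \<Phi> (?D a b (Suc (2 * n)))))"
      unfolding S1_def by (simp add: mult.assoc)
    then show ?thesis
      using pair_words_step[OF d, of "?G n" "2 * n" "\<lambda>x y. R x y * avg d \<Phi> y"] G[of n "2 * n"]
      by (simp add: S0_def)
  qed
  moreover have "S0 \<le> (\<Sum>a\<in>words d (2 * n). \<Sum>b\<in>words d (2 * n). ?G n a b * \<Phi> (?D a b (2 * n)))"
    unfolding S0_def by (intro sum_mono mult_left_mono super prod_nonneg ballI R)
  ultimately have "S2 \<le> (real d)\<^sup>2 * ((real d)\<^sup>2 * ((real d) ^ (4 * n) * \<Phi> 0))"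
    using mult_left_mono[OF order_trans[OF _ Suc.IH], of S0 "(real d)\<^sup>2 * (real d)\<^sup>2"]
    by (simp only: mult.assoc) simp
  also have "\<dots> = (real d) ^ (4 * Suc n) * \<Phi> 0"
  proof -
    have "(real d) ^ (2 + (2 + 4 * n)) = (real d)\<^sup>2 * ((real d)\<^sup>2 * (real d) ^ (4 * n))"
      by (simp only: power_add)
    moreover have "2 + (2 + 4 * n) = 4 * Suc n" by simp
    ultimately show ?thesis by (simp only: mult.assoc)
  qed
  finally show ?case unfolding S2_def .
qed

text \<open>The last block still reads letter \<open>2 * n\<close> through its \<open>flip\<close>,
  so the words are longer by two than the part seen by the weights; each extra position contributes
  a factor \<open>d^2\<close>.\<close>

lemma pair_words_bound:
  assumes d: "d > 0" and R: "\<And>x y. 0 \<le> R x y" and \<Phi>: "\<And>x. 1 \<le> \<Phi> x"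
    and super: "\<And>x. avg d (\<lambda>y. R x y * avg d \<Phi> y) x \<le> \<Phi> x"
  shows "(\<Sum>a\<in>words d (2 * n + 2). \<Sum>b\<in>words d (2 * n + 2).
      \<Prod>i<n. R (walk_diff a b (2 * i)) (walk_diff a b (2 * i + 1)))
    \<le> \<Phi> 0 * (real (card (words d (2 * n + 2))))\<^sup>2"
proof -
  let ?D = "walk_diff"
  let ?G = "\<lambda>a b. \<Prod>i<n. R (?D a b (2 * i)) (?D a b (2 * i + 1))"
  have G: "?G (a(m := i)) (b(m := j)) = ?G a b" if "2 * n \<le> m" for m a b i j
  proof (intro prod.cong refl arg_cong2[where f = R])
    fix k assume "k \<in> {..<n}"
    then have "2 * k + 1 \<le> m" using that by auto
    then show "?D (a(m := i)) (b(m := j)) (2 * k) = ?D a b (2 * k)"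
      "?D (a(m := i)) (b(m := j)) (2 * k + 1) = ?D a b (2 * k + 1)"
      by (intro walk_diff_cong; simp)+
  qed
  have step: "(\<Sum>a\<in>words d (Suc m). \<Sum>b\<in>words d (Suc m). ?G a b) = (real d)\<^sup>2 * (\<Sum>a\<in>words d m. \<Sum>b\<in>words d m. ?G a b)"
    if "2 * n \<le> m" for m
    using pair_words_step[OF d, of ?G m "\<lambda>_ _. 1"] G[OF that] by (simp add: avg_const[OF d])
  have "(\<Sum>a\<in>words d (2 * n + 2). \<Sum>b\<in>words d (2 * n + 2). ?G a b) =
      (real d)\<^sup>2 * (real d)\<^sup>2 * (\<Sum>a\<in>words d (2 * n). \<Sum>b\<in>words d (2 * n). ?G a b * 1)"
    using step[of "2 * n"] step[of "Suc (2 * n)"] by simp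
  also have "\<dots> \<le> (real d)\<^sup>2 * (real d)\<^sup>2 * (\<Sum>a\<in>words d (2 * n). \<Sum>b\<in>words d (2 * n). ?G a b * \<Phi> (?D a b (2 * n)))"
    using \<Phi> R by (intro mult_left_mono sum_mono prod_nonneg) auto
  also have "\<dots> \<le> (real d)\<^sup>2 * (real d)\<^sup>2 * ((real d) ^ (4 * n) * \<Phi> 0)"
    by (intro mult_left_mono pair_words_sum d R super) auto
  also have "\<dots> = \<Phi> 0 * (real (card (words d (2 * n + 2))))\<^sup>2"
  proof -
    have "(real d)\<^sup>2 * (real d)\<^sup>2 * (real d) ^ (4 * n) = (real d ^ (2 * n + 2))\<^sup>2"
    proof -
      have "(real d ^ (2 * n + 2))\<^sup>2 = real d ^ (2 + 2 + 4 * n)"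
      proof -
        have "(2 * n + 2) * 2 = 2 + 2 + 4 * n" by simp
        then show ?thesis by (simp only: power_mult[symmetric])
      qed
      then show ?thesis by (simp only: power_add)
    qed
    then show ?thesis unfolding card_words of_nat_power mult.assoc[symmetric] by simp
  qed
  finally show ?thesis .
qed

section \<open>Oriented lattice paths\<close>

text \<open>The grading that every oriented step raises by 1. It makes walks injective, and two
  walks with the same start can meet only at equal times.\<close>

definition level :: "nat \<Rightarrow> (nat \<Rightarrow> int) \<Rightarrow> int" where
  "level d x = (\<Sum>i\<in>{1..d}. x i)"

definition l1_dist :: "nat \<Rightarrow> (nat \<Rightarrow> int) \<Rightarrow> (nat \<Rightarrow> int) \<Rightarrow> int" where
  "l1_dist d x y = (\<Sum>i\<in>{1..d}. \<bar>x i - y i\<bar>)"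

abbreviation nbrs :: "nat \<Rightarrow> (nat \<Rightarrow> int) \<Rightarrow> (nat \<Rightarrow> int) set" where
  "nbrs d \<equiv> neighbors (int_lattice d)"

lemma l1_dist_commute: "l1_dist d x y = l1_dist d y x"
  unfolding l1_dist_def by (simp add: abs_minus_commute)

lemma l1_dist_triangle: "l1_dist d x z \<le> l1_dist d x y + l1_dist d y z"
  unfolding l1_dist_def sum.distrib[symmetric] by (intro sum_mono) auto

lemma l1_dist_unit: "j \<in> {1..d} \<Longrightarrow> l1_dist d (x + unit_vector j) x = 1"
proof -
  assume j: "j \<in> {1..d}"
  have "l1_dist d (x + unit_vector j) x = (\<Sum>i\<in>{1..d}. if i = j then 1 else 0)"
    unfolding l1_dist_def by (intro sum.cong) (auto simp: unit_vector_def)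
  then show ?thesis using j by simp
qed

lemma in_nbrs_iff:
  assumes "v \<in> int_points d"
  shows "u \<in> nbrs d v \<longleftrightarrow> u \<in> int_points d \<and> l1_dist d u v = 1"
proof -
  have "{u, v} \<in> edges (int_lattice d) \<longleftrightarrow> l1_dist d u v = 1" if "u \<in> int_points d"
  proof
    assume "{u, v} \<in> edges (int_lattice d)"
    then obtain x y where xy: "{u, v} = {x, y}" "l1_dist d x y = 1"
      unfolding edges_def int_lattice_def l1_dist_def by auto
    then have "u = x \<and> v = y \<or> u = y \<and> v = x" by (auto simp: doubleton_eq_iff)
    then show "l1_dist d u v = 1" using xy l1_dist_commute by auto
  qed (use that assms in \<open>auto simp: edges_def int_lattice_def l1_dist_def\<close>)
  then show ?thesis by (auto simp: neighbors_def verts_def int_lattice_def)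
qed

lemma nbrs_points: "v \<in> int_points d \<Longrightarrow> u \<in> nbrs d v \<Longrightarrow> u \<in> int_points d"
  by (simp add: in_nbrs_iff)

lemma add_unit_point: "v \<in> int_points d \<Longrightarrow> j \<in> {1..d} \<Longrightarrow> v + unit_vector j \<in> int_points d"
  by (auto simp: int_points_def unit_vector_def)

lemma add_unit_nbr: "v \<in> int_points d \<Longrightarrow> j \<in> {1..d} \<Longrightarrow> v + unit_vector j \<in> nbrs d v"
  by (simp add: in_nbrs_iff add_unit_point l1_dist_unit)

lemma nbrs_cases:
  assumes v: "v \<in> int_points d" and u: "u \<in> nbrs d v"
  obtains j where "j \<in> {1..d}" "u = v + unit_vector j"
  | j where "j \<in> {1..d}" "v = u + unit_vector j"
proof -
  have up: "u \<in> int_points d" and s: "(\<Sum>i\<in>{1..d}. \<bar>u i - v i\<bar>) = 1"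
    using u in_nbrs_iff[OF v] by (auto simp: l1_dist_def)
  obtain j where j: "j \<in> {1..d}" "u j \<noteq> v j"
    using s by (metis (mono_tags, lifting) abs_0 cancel_comm_monoid_add_class.diff_cancel sum.neutral zero_neq_one)
  have "(\<Sum>i\<in>{1..d}. \<bar>u i - v i\<bar>) = \<bar>u j - v j\<bar> + (\<Sum>i\<in>{1..d} - {j}. \<bar>u i - v i\<bar>)"
    using j by (simp add: sum.remove)
  moreover have "0 \<le> (\<Sum>i\<in>{1..d} - {j}. \<bar>u i - v i\<bar>)" by (intro sum_nonneg) auto
  ultimately have one: "\<bar>u j - v j\<bar> = 1" and "(\<Sum>i\<in>{1..d} - {j}. \<bar>u i - v i\<bar>) = 0"
    using s j by linarith+
  then have "\<forall>i\<in>{1..d} - {j}. \<bar>u i - v i\<bar> = 0" by (subst (asm) sum_nonneg_eq_0_iff) auto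
  then have eq: "u i = v i" if "i \<noteq> j" for i
    using that up v by (cases "i \<in> {1..d}") (auto simp: int_points_def)
  from one have "u j = v j + 1 \<or> v j = u j + 1" by linarith
  then show thesis
  proof
    assume "u j = v j + 1"
    then have "u = v + unit_vector j" using eq by (auto simp: unit_vector_def fun_eq_iff)
    then show thesis using that j by blast
  next
    assume "v j = u j + 1"
    then have "v = u + unit_vector j" using eq by (auto simp: unit_vector_def fun_eq_iff)
    then show thesis using that j by blast
  qed
qed

lemma nbrs_subset:
  assumes "v \<in> int_points d"
  shows "nbrs d v \<subseteq> (\<lambda>j. v + unit_vector j) ` {1..d} \<union> (\<lambda>j. v - unit_vector j) ` {1..d}"
proof
  fix u assume "u \<in> nbrs d v"
  then show "u \<in> (\<lambda>j. v + unit_vector j) ` {1..d} \<union> (\<lambda>j. v - unit_vector j) ` {1..d}"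
    by (rule nbrs_cases[OF assms]) auto
qed

lemma nbr_coord:
  assumes v: "v \<in> int_points d" and u: "u \<in> nbrs d v"
  shows "u k = v k \<or> u = v + unit_vector k \<or> u = v - unit_vector k"
proof (rule nbrs_cases[OF v u])
  fix j assume "u = v + unit_vector j"
  then show ?thesis by (cases "j = k") (auto simp: unit_vector_def)
next
  fix j assume "v = u + unit_vector j"
  then have "u = v - unit_vector j" by simp
  then show ?thesis by (cases "j = k") (auto simp: unit_vector_def)
qed

lemma finite_nbrs: "v \<in> int_points d \<Longrightarrow> finite (nbrs d v)"
  by (rule finite_subset[OF nbrs_subset]) auto

lemma card_nbrs_le: 
  assumes "v \<in> int_points d" shows "card (nbrs d v) \<le> 2 * d"
proof -
  have "card (nbrs d v) \<le> card ((\<lambda>j. v + unit_vector j) ` {1..d} \<union> (\<lambda>j. v - unit_vector j) ` {1..d})"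
    by (intro card_mono nbrs_subset assms) auto
  also have "\<dots> \<le> card ((\<lambda>j. v + unit_vector j) ` {1..d}) + card ((\<lambda>j. v - unit_vector j) ` {1..d})"
    by (rule card_Un_le)
  also have "\<dots> \<le> d + d" by (intro add_mono order_trans[OF card_image_le]) auto
  finally show ?thesis by simp
qed

text \<open>A common neighbour differs from one of the two vertices in any coordinate that separates them.\<close>

lemma card_common_nbrs:
  assumes v: "v \<in> int_points d" and w: "w \<in> int_points d" and ne: "v \<noteq> w"
  shows "card (nbrs d v \<inter> nbrs d w) \<le> 4"
proof -
  obtain k where k: "v k \<noteq> w k" using ne by auto
  let ?S = "{v + unit_vector k, v - unit_vector k, w + unit_vector k, w - unit_vector k}"
  have "nbrs d v \<inter> nbrs d w \<subseteq> ?S"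
  proof
    fix u assume u: "u \<in> nbrs d v \<inter> nbrs d w"
    have 1: "u k = v k \<or> u \<in> {v + unit_vector k, v - unit_vector k}"
      using nbr_coord[OF v, of u k] u by blast
    have 2: "u k = w k \<or> u \<in> {w + unit_vector k, w - unit_vector k}"
      using nbr_coord[OF w, of u k] u by blast
    show "u \<in> ?S" using 1 2 k by (metis insert_iff)
  qed
  then have "card (nbrs d v \<inter> nbrs d w) \<le> card ?S" by (intro card_mono) auto
  also have "\<dots> \<le> 4"
    using card_length[of "[v + unit_vector k, v - unit_vector k, w + unit_vector k, w - unit_vector k]"]
    by simp
  finally show ?thesis .
qed

lemma level_unit: "j \<in> {1..d} \<Longrightarrow> level d (x + unit_vector j) = level d x + 1"
  by (simp add: level_def sum.distrib unit_vector_def)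

lemma level_nbr:
  assumes "v \<in> int_points d" "u \<in> nbrs d v"
  shows "level d u = level d v + 1 \<or> level d u = level d v - 1"
  using assms by (elim nbrs_cases) (auto simp: level_unit)

lemma sq_norm_le_l1:
  "sq_norm d (x - y) \<le> (real_of_int (l1_dist d x y))\<^sup>2"
proof -
  let ?z = "\<lambda>i. \<bar>real_of_int (x i - y i)\<bar>"
  have "sq_norm d (x - y) = (\<Sum>i\<in>{1..d}. ?z i * ?z i)"
    unfolding sq_norm_def by (simp add: power2_eq_square)
  also have "\<dots> \<le> (\<Sum>i\<in>{1..d}. ?z i * (\<Sum>k\<in>{1..d}. ?z k))"
    by (intro sum_mono mult_left_mono member_le_sum) auto
  also have "\<dots> = (real_of_int (l1_dist d x y))\<^sup>2"
    by (simp add: l1_dist_def power2_eq_square sum_distrib_right)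
  finally show ?thesis .
qed

lemma infinite_int_points:
  assumes "d \<ge> 1" shows "infinite (int_points d)"
proof
  assume fin: "finite (int_points d)"
  have "range (\<lambda>n::nat. (\<lambda>i. if i = 1 then int n else 0)) \<subseteq> int_points d"
    using assms by (auto simp: int_points_def)
  moreover have "inj (\<lambda>n::nat. (\<lambda>i::nat. if i = 1 then int n else 0))"
    by (auto simp: inj_def fun_eq_iff)
  ultimately show False using fin finite_subset range_inj_infinite by blast
qed

text \<open>Apart from \<open>walk x a (m + 1)\<close>, this is the only common neighbour of \<open>walk x a m\<close> and
  \<open>walk x a (m + 2)\<close>; the two coincide iff the two steps are equal.\<close>

definition flip :: "(nat \<Rightarrow> int) \<Rightarrow> (nat \<Rightarrow> nat) \<Rightarrow> nat \<Rightarrow> nat \<Rightarrow> int" where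
  "flip x a m = walk x a m + unit_vector (a (Suc m))"

text \<open>A flip is adjacent to two walk vertices and is assigned to the lower one as its
  \<open>corner\<close>, so both \<open>flip x a m\<close> and \<open>flip x a (m - 2)\<close> leave
  the side. For \<open>m < 2\<close> the truncated differences name vertices that are not adjacent
  to \<open>walk x a m\<close> or are removed anyway.\<close>

definition side :: "nat \<Rightarrow> (nat \<Rightarrow> int) \<Rightarrow> (nat \<Rightarrow> nat) \<Rightarrow> nat \<Rightarrow> (nat \<Rightarrow> int) set" where
  "side d x a m =
     nbrs d (walk x a m) - {walk x a (m - 1), walk x a (Suc m), flip x a m, flip x a (m - 2)}"

definition corner :: "(nat \<Rightarrow> int) \<Rightarrow> (nat \<Rightarrow> nat) \<Rightarrow> nat \<Rightarrow> (nat \<Rightarrow> int) set" where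
  "corner x a m = {flip x a m} - {walk x a (Suc m)}"

definition surround :: "nat \<Rightarrow> (nat \<Rightarrow> int) \<Rightarrow> (nat \<Rightarrow> nat) \<Rightarrow> nat \<Rightarrow> (nat \<Rightarrow> int) set" where
  "surround d x a m = side d x a m \<union> corner x a m"

locale direction_word =
  fixes d :: nat and x :: "nat \<Rightarrow> int" and a :: "nat \<Rightarrow> nat"
  assumes x: "x \<in> int_points d" and a: "a i \<in> {1..d}"
begin

lemma walk_point: "walk x a m \<in> int_points d"
proof (induction m)
  case (Suc m)
  then show ?case using add_unit_point[OF Suc a[of m]] by (simp only: walk.simps)
qed (simp add: x)

lemma level_walk: "level d (walk x a m) = level d x + int m"
proof (induction m)
  case (Suc m)
  then show ?case using level_unit[OF a[of m], of "walk x a m"] by (simp only: walk.simps)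
qed simp

lemma walk_eq_iff: "walk x a m = walk x a k \<longleftrightarrow> m = k"
  using level_walk by (metis add_left_cancel of_nat_eq_iff)

lemma level_flip: "level d (flip x a m) = level d x + int m + 1"
  unfolding flip_def using a by (simp add: level_unit level_walk)

lemma surround_nbrs: "u \<in> surround d x a m \<Longrightarrow> u \<in> nbrs d (walk x a m)"
  unfolding surround_def side_def corner_def flip_def using add_unit_nbr[OF walk_point a] by auto

lemma surround_point: "u \<in> surround d x a m \<Longrightarrow> u \<in> int_points d"
  using surround_nbrs nbrs_points walk_point by blast

lemma finite_surround: "finite (surround d x a m)"
  by (rule finite_subset[OF _ finite_nbrs[OF walk_point[of m]]]) (use surround_nbrs in blast)

lemma level_surround:
  "u \<in> surround d x a m \<Longrightarrow> level d u = level d x + int m + 1 \<or> level d u = level d x + int m - 1"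
  using level_nbr[OF walk_point surround_nbrs] level_walk by auto

lemma surround_not_walk:
  assumes "u \<in> surround d x a m" shows "u \<noteq> walk x a k"
proof
  assume u: "u = walk x a k"
  then have "k = Suc m \<or> Suc k = m"
    using level_surround[OF assms] level_walk[of k] by auto
  then show False
  proof
    assume "k = Suc m"
    then show False using assms u by (auto simp: surround_def side_def corner_def)
  next
    assume k: "Suc k = m"
    then have "u \<notin> side d x a m" using u by (auto simp: side_def)
    moreover have "u \<notin> corner x a m" using u k level_flip[of m] level_walk[of k] by (auto simp: corner_def)
    ultimately show False using assms by (auto simp: surround_def)
  qed
qed

lemma side_corner_disjoint: "side d x a m \<inter> corner x a m = {}"
  by (auto simp: side_def corner_def)

text \<open>By levels a common vertex forces \<open>k = m + 2\<close> and lies between the two walk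
  vertices. It is then \<open>walk x a (m + 1)\<close> or the flip: the former is in neither set,
  and the latter is kept only at \<open>m\<close>.\<close>

lemma surround_disjoint_less:
  assumes "m < k" shows "surround d x a m \<inter> surround d x a k = {}"
proof (rule ccontr)
  assume "surround d x a m \<inter> surround d x a k \<noteq> {}"
  then obtain u where u: "u \<in> surround d x a m" "u \<in> surround d x a k" by auto
  have k: "k = Suc (Suc m)" and lu: "level d u = level d x + int m + 1"
    using level_surround[OF u(1)] level_surround[OF u(2)] assms by auto
  obtain p where p: "p \<in> {1..d}" "u = walk x a m + unit_vector p"
    using surround_nbrs[OF u(1)]
    by (rule nbrs_cases[OF walk_point]) (use lu level_walk[of m] level_unit in auto)
  obtain q where q: "q \<in> {1..d}" "walk x a k = u + unit_vector q"
    using surround_nbrs[OF u(2)]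
    by (rule nbrs_cases[OF walk_point]) (use lu level_walk[of k] level_unit k in auto)
  have "walk x a m p + unit_vector (a m) p + unit_vector (a (Suc m)) p = walk x a m p + unit_vector p p + unit_vector q p"
    using fun_cong[OF q(2), of p] unfolding p(2) k by simp
  then have "p = a m \<or> p = a (Suc m)" by (auto simp: unit_vector_def split: if_splits)
  then have "u = walk x a (Suc m) \<or> u = flip x a m" using p(2) by (auto simp: flip_def)
  then have "u = flip x a m" using surround_not_walk[OF u(1)] by blast
  then have "u \<notin> side d x a k" "u \<notin> corner x a k"
    using k level_flip[of m] level_flip[of k] by (auto simp: side_def corner_def)
  then show False using u(2) by (auto simp: surround_def)
qed

lemma surround_disjoint: "m \<noteq> k \<Longrightarrow> surround d x a m \<inter> surround d x a k = {}"
  using surround_disjoint_less by (metis inf_commute nat_neq_iff)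

lemma l1_walk_surround: "u \<in> surround d x a m \<Longrightarrow> l1_dist d u (walk x a m) = 1"
  using surround_nbrs in_nbrs_iff[OF walk_point] by blast

lemma l1_walk_le: "l1_dist d (walk x a (m + k)) (walk x a m) \<le> int k"
proof (induction k)
  case (Suc k)
  have "l1_dist d (walk x a (Suc (m + k))) (walk x a (m + k)) = 1"
    using l1_dist_unit[OF a] by (simp only: walk.simps)
  then show ?case
    using l1_dist_triangle[of d "walk x a (Suc (m + k))" "walk x a m" "walk x a (m + k)"] Suc
    by (simp only: add_Suc_right)
qed (simp add: l1_dist_def)

lemma l1_walk_le': "k \<le> m + j \<Longrightarrow> m \<le> k + j \<Longrightarrow> l1_dist d (walk x a m) (walk x a k) \<le> int j"
proof (cases "m \<le> k")
  case True
  assume "k \<le> m + j"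
  then show ?thesis using l1_walk_le[of m "k - m"] True l1_dist_commute[of d "walk x a m" "walk x a k"] by simp
next
  case False
  assume "m \<le> k + j"
  then show ?thesis using l1_walk_le[of k "m - k"] False by simp
qed

end

section \<open>Correlation of two paths\<close>

declare walk.simps(2) [simp del]

text \<open>Deletion only weakens the requirement. \<open>D\<close> will be the set of vertices
  through which two paths depend on each other.\<close>

definition deleted_open ::
  "nat \<Rightarrow> nat \<Rightarrow> (nat \<Rightarrow> int) set \<Rightarrow> (nat \<Rightarrow> int) \<Rightarrow> (nat \<Rightarrow> nat) \<Rightarrow> nat \<Rightarrow> ((nat \<Rightarrow> int) \<Rightarrow> nat) \<Rightarrow> bool" where
  "deleted_open K d D x a i =
     block_open K (walk x a (2 * i)) (walk x a (2 * i + 1))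
       (side d x a (2 * i) - D) (side d x a (2 * i + 1) - D)
       ((corner x a (2 * i) \<union> corner x a (2 * i + 1)) - D)"

definition path_open ::
  "nat \<Rightarrow> nat \<Rightarrow> nat \<Rightarrow> (nat \<Rightarrow> int) \<Rightarrow> (nat \<Rightarrow> nat) \<Rightarrow> ((nat \<Rightarrow> int) \<Rightarrow> nat) \<Rightarrow> bool" where
  "path_open K d n x a y \<longleftrightarrow> (\<forall>i\<in>{..<n}. deleted_open K d {} x a i y)"

definition shell :: "nat \<Rightarrow> (nat \<Rightarrow> int) \<Rightarrow> (nat \<Rightarrow> nat) \<Rightarrow> nat \<Rightarrow> (nat \<Rightarrow> int) set" where
  "shell d x a i = surround d x a (2 * i) \<union> surround d x a (2 * i + 1)"

lemma shell_eq:
  "shell d x a i = side d x a (2 * i) \<union> side d x a (2 * i + 1) \<union> (corner x a (2 * i) \<union> corner x a (2 * i + 1))"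
  by (auto simp: shell_def surround_def)

context direction_word
begin

lemma finite_shell: "finite (shell d x a i)"
  by (simp add: shell_def finite_surround)

lemma shell_points: "shell d x a i \<subseteq> int_points d"
  using surround_point by (auto simp: shell_def)

lemma shell_not_walk: "walk x a k \<notin> shell d x a i"
  using surround_not_walk by (auto simp: shell_def)

lemma shell_disjoint: "i \<noteq> j \<Longrightarrow> shell d x a i \<inter> shell d x a j = {}"
proof -
  assume "i \<noteq> j"
  then have "2 * i \<noteq> 2 * j" "2 * i \<noteq> 2 * j + 1" "2 * i + 1 \<noteq> 2 * j" "2 * i + 1 \<noteq> 2 * j + 1" by presburger+
  from this[THEN surround_disjoint] show ?thesis by (auto simp: shell_def)
qed

lemma depends_deleted_open:
  "depends_on ({walk x a (2 * i), walk x a (2 * i + 1)} \<union> (shell d x a i - D)) (deleted_open K d D x a i)"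
proof -
  have "side d x a (2 * i) - D \<union> (side d x a (2 * i + 1) - D) \<union> ((corner x a (2 * i) \<union> corner x a (2 * i + 1)) - D)
     = shell d x a i - D" by (auto simp: shell_eq)
  then show ?thesis
    using depends_on_block_open[of "walk x a (2 * i)" "walk x a (2 * i + 1)" "side d x a (2 * i) - D" "side d x a (2 * i + 1) - D"
        "(corner x a (2 * i) \<union> corner x a (2 * i + 1)) - D" K]
    unfolding deleted_open_def[abs_def] by simp
qed

lemma deleted_open_antimono:
  assumes "deleted_open K d {} x a i y" shows "deleted_open K d D x a i y"
proof -
  have "finite (side d x a m)" for m
    using finite_surround[of m] by (simp add: surround_def)
  then show ?thesis
    unfolding deleted_open_def
    by (intro block_open_mono[OF _ _ _ _ _ assms[unfolded deleted_open_def]]) auto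
qed

end

locale lattice_field = cell_field M "int_points d" Y K h
  for M :: "'w measure" and d :: nat and Y :: "(nat \<Rightarrow> int) \<Rightarrow> 'w \<Rightarrow> nat" and K :: nat and h :: real +
  assumes d: "d \<ge> 1" and bb_pos: "block_bound K (2 * d) h > 0"
begin

abbreviation \<tau> :: real where "\<tau> \<equiv> real K * h"
abbreviation q0 :: real where "q0 \<equiv> block_bound K (2 * d) h"

lemma \<tau>_bounds: "0 \<le> \<tau>" "\<tau> < 1"
  using h_pos Kh by auto

lemma regular_deleted_open:
  assumes "direction_word d x a" shows "regular (deleted_open K d D x a i)"
proof -
  interpret direction_word d x a by fact
  show ?thesis
    by (rule regularI[OF _ _ depends_deleted_open]) (use finite_shell shell_points walk_point in auto)
qed

lemma pr_deleted_open_ge: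
  assumes "direction_word d x a" shows "q0 \<le> pr (deleted_open K d {} x a i)"
proof -
  interpret direction_word d x a by fact
  have fin: "finite (side d x a m)" "finite (corner x a m)" and sub: "side d x a m \<subseteq> int_points d" "corner x a m \<subseteq> int_points d" for m
    using finite_surround[of m] surround_point[of _ m] by (auto simp: surround_def)
  have card_s: "card (side d x a m) \<le> 2 * d" for m
    by (rule order_trans[OF card_mono[OF finite_nbrs[OF walk_point]] card_nbrs_le[OF walk_point]])
      (auto simp: side_def)
  have card_c: "card (corner x a m) \<le> 1" for m
    unfolding corner_def by (rule order_trans[OF card_mono[of "{flip x a m}"]]) auto
  have dis: "surround d x a (2 * i) \<inter> surround d x a (2 * i + 1) = {}"
    by (rule surround_disjoint) simp
  have "q0 \<le> pr (block_open K (walk x a (2 * i)) (walk x a (2 * i + 1)) (side d x a (2 * i)) (side d x a (2 * i + 1))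
     (corner x a (2 * i) \<union> corner x a (2 * i + 1)))"
  proof (rule pr_block_open_ge[OF infinite_int_points[OF d] walk_point walk_point])
    show "walk x a (2 * i) \<noteq> walk x a (2 * i + 1)" unfolding walk_eq_iff by simp
    show "card (corner x a (2 * i) \<union> corner x a (2 * i + 1)) \<le> 2"
      using card_Un_le[of "corner x a (2 * i)" "corner x a (2 * i + 1)"] card_c[of "2 * i"] card_c[of "2 * i + 1"]
      by linarith
    show "side d x a (2 * i) \<inter> side d x a (2 * i + 1) = {}"
      "side d x a (2 * i) \<inter> (corner x a (2 * i) \<union> corner x a (2 * i + 1)) = {}"
      "side d x a (2 * i + 1) \<inter> (corner x a (2 * i) \<union> corner x a (2 * i + 1)) = {}"
      using dis side_corner_disjoint[of "2 * i"] side_corner_disjoint[of "2 * i + 1"]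
      unfolding surround_def by blast+
    show "walk x a (2 * i) \<notin> side d x a (2 * i) \<union> side d x a (2 * i + 1) \<union> (corner x a (2 * i) \<union> corner x a (2 * i + 1))"
      "walk x a (2 * i + 1) \<notin> side d x a (2 * i) \<union> side d x a (2 * i + 1) \<union> (corner x a (2 * i) \<union> corner x a (2 * i + 1))"
      using shell_not_walk[of _ i] unfolding shell_eq by blast+
  qed (use fin sub card_s in auto)
  then show ?thesis unfolding deleted_open_def[abs_def] by simp
qed

lemma pr_deleted_open_relax:
  assumes "direction_word d x a" and c: "card (shell d x a i \<inter> D) \<le> c"
  shows "pr (deleted_open K d D x a i) * (1 - \<tau>) ^ c \<le> pr (deleted_open K d {} x a i)"
proof -
  interpret direction_word d x a by fact
  let ?S = "{walk x a (2 * i), walk x a (2 * i + 1)} \<union> (shell d x a i - D)"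
  have "pr (deleted_open K d D x a i) * (1 - \<tau>) ^ c \<le> pr (deleted_open K d D x a i) * (1 - \<tau>) ^ card (shell d x a i \<inter> D)"
    using c \<tau>_bounds by (intro mult_left_mono power_decreasing pr_nonneg) auto
  also have "\<dots> \<le> pr (deleted_open K d {} x a i)"
  proof (rule pr_relax[OF _ _ depends_deleted_open])
    show "{walk x a (2 * i), walk x a (2 * i + 1)} \<union> (shell d x a i - D) \<subseteq> int_points d"
      using walk_point shell_points by blast
    show "shell d x a i \<inter> D \<subseteq> int_points d" using shell_points by blast
    show "({walk x a (2 * i), walk x a (2 * i + 1)} \<union> (shell d x a i - D)) \<inter> (shell d x a i \<inter> D) = {}"
      using shell_not_walk[of _ i] by blast
    show "regular (deleted_open K d {} x a i)" by (rule regular_deleted_open) fact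
    show "deleted_open K d {} x a i y" if "deleted_open K d D x a i y" "\<forall>u\<in>shell d x a i \<inter> D. y u = K" for y
    proof -
      have "block_open K (walk x a (2 * i)) (walk x a (2 * i + 1)) (side d x a (2 * i)) (side d x a (2 * i + 1))
         (corner x a (2 * i) \<union> corner x a (2 * i + 1)) y"
        by (rule block_open_restore[where D = D])
          (use that in \<open>auto simp only: deleted_open_def shell_eq Int_commute\<close>)
      then show ?thesis unfolding deleted_open_def by simp
    qed
  qed (use finite_shell in auto)
  finally show ?thesis .
qed

lemma regular_path_open:
  assumes "direction_word d x a" shows "regular (path_open K d n x a)"
proof -
  interpret direction_word d x a by fact
  show ?thesis unfolding path_open_def[abs_def]
    by (rule regularI[OF _ _ depends_on_all[OF depends_deleted_open]])
      (use finite_shell shell_points walk_point in auto)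
qed

lemma pr_path_open:
  assumes "direction_word d x a"
  shows "pr (path_open K d n x a) = (\<Prod>i<n. pr (deleted_open K d {} x a i))"
proof -
  interpret direction_word d x a by fact
  show ?thesis unfolding path_open_def[abs_def]
  proof (rule pr_indep[OF _ _ _ depends_deleted_open])
    show "disjoint_family_on (\<lambda>i. {walk x a (2 * i), walk x a (2 * i + 1)} \<union> (shell d x a i - {})) {..<n}"
      unfolding disjoint_family_on_def
    proof (intro ballI impI)
      fix i j :: nat assume "i \<noteq> j"
      then have "2 * i \<noteq> 2 * j" "2 * i \<noteq> 2 * j + 1" "2 * i + 1 \<noteq> 2 * j" "2 * i + 1 \<noteq> 2 * j + 1" by presburger+
      then have "{walk x a (2 * i), walk x a (2 * i + 1)} \<inter> {walk x a (2 * j), walk x a (2 * j + 1)} = {}"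
        using walk_eq_iff by blast
      then show "({walk x a (2 * i), walk x a (2 * i + 1)} \<union> (shell d x a i - {})) \<inter>
         ({walk x a (2 * j), walk x a (2 * j + 1)} \<union> (shell d x a j - {})) = {}"
        using shell_not_walk shell_disjoint[OF \<open>i \<noteq> j\<close>] by blast
    qed
  qed (use finite_shell shell_points walk_point in auto)
qed

lemma pr_path_open_pos: "direction_word d x a \<Longrightarrow> pr (path_open K d n x a) > 0"
  unfolding pr_path_open using pr_deleted_open_ge bb_pos by (intro prod_pos) (auto intro: less_le_trans)

end

text \<open>Counting the deleted vertices around one vertex \<open>v\<close>: \<open>S\<close> is the set of vertices near \<open>v\<close> that
  also occur near the other path \<open>W\<close>.\<close>

lemma card_deleted_le:
  assumes v: "v \<in> int_points d" and W: "\<And>l. W l \<in> int_points d" and L: "card L \<le> 3" "finite L"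
    and S: "\<And>u. u \<in> S \<Longrightarrow> u = p \<or> u = q \<or> (\<exists>l\<in>L. W l \<noteq> v \<and> u \<in> nbrs d v \<inter> nbrs d (W l))"
  shows "finite S \<and> card S \<le> 14"
proof -
  define B where "B l = (if W l \<noteq> v then nbrs d v \<inter> nbrs d (W l) else {})" for l
  have B: "finite (B l)" "card (B l) \<le> 4" for l
    unfolding B_def using finite_nbrs[OF v] card_common_nbrs[OF v W[of l]] by auto
  have sub: "S \<subseteq> {p, q} \<union> (\<Union>l\<in>L. B l)"
  proof
    fix u assume "u \<in> S"
    from S[OF this] show "u \<in> {p, q} \<union> (\<Union>l\<in>L. B l)"
    proof (elim disjE bexE conjE)
      fix l assume "l \<in> L" "W l \<noteq> v" "u \<in> nbrs d v \<inter> nbrs d (W l)"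
      then have "u \<in> B l" by (simp add: B_def)
      then show ?thesis using \<open>l \<in> L\<close> by blast
    qed auto
  qed
  have fin: "finite ({p, q} \<union> (\<Union>l\<in>L. B l))" using L B by auto
  have "card (\<Union>l\<in>L. B l) \<le> (\<Sum>l\<in>L. card (B l))" by (rule card_UN_le[OF L(2)])
  also have "\<dots> \<le> (\<Sum>l\<in>L. 4)" by (intro sum_mono B)
  also have "\<dots> \<le> 12" using L by simp
  finally have "card ({p, q} \<union> (\<Union>l\<in>L. B l)) \<le> 2 + 12"
    using card_Un_le[of "{p, q}" "\<Union>l\<in>L. B l"] card_length[of "[p, q]"] by simp
  then show ?thesis using card_mono[OF fin sub] finite_subset[OF sub fin] by simp
qed

section \<open>Vertices shared by the neighbourhoods of two paths\<close>

locale word_pair = A: direction_word d x a + B: direction_word d x b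
  for d :: nat and x :: "nat \<Rightarrow> int" and a b :: "nat \<Rightarrow> nat" +
  fixes n :: nat
begin

definition apart :: "nat \<Rightarrow> bool" where
  "apart i \<longleftrightarrow> walk x a (2 * i) \<noteq> walk x b (2 * i) \<and> walk x a (2 * i + 1) \<noteq> walk x b (2 * i + 1)"

text \<open>Deleting this set from all neighbourhoods makes the blocks of both paths independent. Blocks of
  the second path that meet the first path are dropped from the estimate and need no deletion.\<close>

definition shared :: "(nat \<Rightarrow> int) set" where
  "shared = range (walk x a) \<union> range (walk x b) \<union>
     ((\<Union>i\<in>{..<n}. shell d x a i) \<inter> (\<Union>i\<in>{i\<in>{..<n}. apart i}. shell d x b i))"

lemma walks_meet: "walk x a m = walk x b k \<Longrightarrow> m = k"
  using A.level_walk[of m] B.level_walk[of k] by simp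

lemma shell_cases:
  assumes "u \<in> shell d y c i" obtains m where "m \<in> {2 * i, 2 * i + 1}" "u \<in> surround d y c m"
  using assms by (auto simp: shell_def)

lemma apart_walk: "apart i \<Longrightarrow> m \<in> {2 * i, 2 * i + 1} \<Longrightarrow> walk x a m \<noteq> walk x b m"
  by (auto simp: apart_def)

lemma surround_levels:
  assumes "u \<in> surround d x a m" "u \<in> surround d x b l"
  shows "l = m \<or> l = m + 2 \<or> l + 2 = m"
  using A.level_surround[OF assms(1)] B.level_surround[OF assms(2)] by auto

lemma surround_walk_levels:
  "u \<in> surround d x a m \<Longrightarrow> u = walk x b k \<Longrightarrow> k = m + 1 \<or> k + 1 = m"
  "u \<in> surround d x b m \<Longrightarrow> u = walk x a k \<Longrightarrow> k = m + 1 \<or> k + 1 = m"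
  using A.level_surround[of u m] B.level_walk[of k] B.level_surround[of u m] A.level_walk[of k] by auto

text \<open>Levels leave two candidates on the other walk and three vertices
  \<open>walk x b l\<close> whose neighbourhoods can meet this one. As \<open>shared\<close> only
  uses shells of apart blocks of the second path, these vertices differ from
  \<open>walk x a m\<close> and give at most four common neighbours each:
  \<open>2 + 3 * 4 = 14\<close>.\<close>

lemma card_shared_A:
  "finite (surround d x a m \<inter> shared) \<and> card (surround d x a m \<inter> shared) \<le> 14"
proof (rule card_deleted_le[OF A.walk_point, where W = "walk x b" and L = "{m, m + 2, m - 2}"])
  fix u assume u: "u \<in> surround d x a m \<inter> shared"
  then have "u \<notin> range (walk x a)" using A.surround_not_walk by blast
  then consider k where "u = walk x b k" | i where "apart i" "u \<in> shell d x b i"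
    using u unfolding shared_def by blast
  then show "u = walk x b (m + 1) \<or> u = walk x b (m - 1) \<or>
     (\<exists>l\<in>{m, m + 2, m - 2}. walk x b l \<noteq> walk x a m \<and> u \<in> nbrs d (walk x a m) \<inter> nbrs d (walk x b l))"
  proof cases
    case (1 k)
    then have "k = m + 1 \<or> k = m - 1" using surround_walk_levels(1)[of u m k] u by auto
    then show ?thesis using 1 by blast
  next
    case (2 i)
    obtain l where l: "l \<in> {2 * i, 2 * i + 1}" "u \<in> surround d x b l" using 2(2) by (rule shell_cases)
    have "l \<in> {m, m + 2, m - 2}" using surround_levels[of u m l] u l by auto
    moreover have "walk x b l \<noteq> walk x a m"
      using walks_meet[of m l] apart_walk[OF 2(1) l(1)] by metis
    moreover have "u \<in> nbrs d (walk x a m) \<inter> nbrs d (walk x b l)"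
      using A.surround_nbrs B.surround_nbrs u l by blast
    ultimately show ?thesis by blast
  qed
qed (use B.walk_point card_length[of "[m, m + 2, m - 2]"] in auto)

lemma card_shared_B:
  assumes ap: "apart i" "m \<in> {2 * i, 2 * i + 1}"
  shows "finite (surround d x b m \<inter> shared) \<and> card (surround d x b m \<inter> shared) \<le> 14"
proof (rule card_deleted_le[OF B.walk_point, where W = "walk x a" and L = "{m, m + 2, m - 2}"])
  fix u assume u: "u \<in> surround d x b m \<inter> shared"
  then have "u \<notin> range (walk x b)" using B.surround_not_walk by blast
  then consider k where "u = walk x a k" | j where "u \<in> shell d x a j"
    using u unfolding shared_def by blast
  then show "u = walk x a (m + 1) \<or> u = walk x a (m - 1) \<or>
     (\<exists>l\<in>{m, m + 2, m - 2}. walk x a l \<noteq> walk x b m \<and> u \<in> nbrs d (walk x b m) \<inter> nbrs d (walk x a l))"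
  proof cases
    case (1 k)
    then have "k = m + 1 \<or> k = m - 1" using surround_walk_levels(2)[of u m k] u by auto
    then show ?thesis using 1 by blast
  next
    case (2 j)
    obtain l where l: "l \<in> {2 * j, 2 * j + 1}" "u \<in> surround d x a l" using 2 by (rule shell_cases)
    have "l \<in> {m, m + 2, m - 2}" using surround_levels[of u l m] u l by auto
    moreover have "walk x a l \<noteq> walk x b m"
      using walks_meet[of l m] apart_walk[OF ap] by metis
    moreover have "u \<in> nbrs d (walk x b m) \<inter> nbrs d (walk x a l)"
      using A.surround_nbrs B.surround_nbrs u l by blast
    ultimately show ?thesis by blast
  qed
qed (use A.walk_point card_length[of "[m, m + 2, m - 2]"] in auto)

lemma card_shell_shared:
  "card (shell d x a i \<inter> shared) \<le> 28"
  "apart i \<Longrightarrow> card (shell d x b i \<inter> shared) \<le> 28"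
proof -
  have "card (shell d y c i \<inter> D) \<le> card (surround d y c (2 * i) \<inter> D) + card (surround d y c (2 * i + 1) \<inter> D)" for y c D
    unfolding shell_def Int_Un_distrib2 by (rule card_Un_le)
  note le = this
  show "card (shell d x a i \<inter> shared) \<le> 28"
    using le[of x a shared] card_shared_A[of "2 * i"] card_shared_A[of "2 * i + 1"] by linarith
  assume "apart i"
  then show "card (shell d x b i \<inter> shared) \<le> 28"
    using le[of x b shared] card_shared_B[of i "2 * i"] card_shared_B[of i "2 * i + 1"] by simp
qed

text \<open>Moving along the walks to \<open>m\<close> and \<open>l\<close> costs 1 and 3 in some
  order, and \<open>u\<close> bridges a distance of 2. The sum 6 is the origin of the threshold
  \<open>36 = 6^2\<close> in \<open>pair_weight\<close>.\<close>

lemma l1_shared: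
  assumes u: "l1_dist d u (walk x a m) \<le> 1" "l1_dist d u (walk x b l) \<le> 1"
    and ml: "m \<le> l + 2" "l \<le> m + 2" and i: "m \<in> {2 * i, 2 * i + 1} \<or> l \<in> {2 * i, 2 * i + 1}"
  shows "l1_dist d (walk x a (2 * i)) (walk x b (2 * i)) \<le> 6"
proof -
  have ab: "l1_dist d (walk x a m) (walk x b l) \<le> 2"
    using l1_dist_triangle[of d "walk x a m" "walk x b l" u] u l1_dist_commute[of d u "walk x a m"] by linarith
  from i show ?thesis
  proof
    assume i: "m \<in> {2 * i, 2 * i + 1}"
    have "l1_dist d (walk x a (2 * i)) (walk x a m) \<le> int 1" by (rule A.l1_walk_le') (use i in auto)
    moreover have "l1_dist d (walk x b l) (walk x b (2 * i)) \<le> int 3" by (rule B.l1_walk_le') (use i ml in auto)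
    ultimately show ?thesis
      using ab l1_dist_triangle[of d "walk x a (2 * i)" "walk x b (2 * i)" "walk x a m"]
        l1_dist_triangle[of d "walk x a m" "walk x b (2 * i)" "walk x b l"] by linarith
  next
    assume i: "l \<in> {2 * i, 2 * i + 1}"
    have "l1_dist d (walk x a (2 * i)) (walk x a m) \<le> int 3" by (rule A.l1_walk_le') (use i ml in auto)
    moreover have "l1_dist d (walk x b l) (walk x b (2 * i)) \<le> int 1" by (rule B.l1_walk_le') (use i in auto)
    ultimately show ?thesis
      using ab l1_dist_triangle[of d "walk x a (2 * i)" "walk x b (2 * i)" "walk x a m"]
        l1_dist_triangle[of d "walk x a m" "walk x b (2 * i)" "walk x b l"] by linarith
  qed
qed

lemma l1_self: "l1_dist d z z = 0"
  by (simp add: l1_dist_def)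

lemma far_disjoint:
  assumes far: "\<not> sq_norm d (walk_diff a b (2 * i)) \<le> 36"
  shows "shell d x a i \<inter> shared = {}" "shell d x b i \<inter> shared = {}"
proof -
  have far': "\<not> l1_dist d (walk x a (2 * i)) (walk x b (2 * i)) \<le> 6"
  proof
    let ?l = "l1_dist d (walk x a (2 * i)) (walk x b (2 * i))"
    assume "?l \<le> 6"
    moreover have "0 \<le> ?l" by (simp add: l1_dist_def sum_nonneg)
    ultimately have "(real_of_int ?l)\<^sup>2 \<le> 6\<^sup>2" by (intro power_mono) auto
    then have "sq_norm d (walk_diff a b (2 * i)) \<le> 36"
      using sq_norm_le_l1[of d "walk x a (2 * i)" "walk x b (2 * i)"] unfolding walk_diff_eq by simp
    then show False using far by simp
  qed
  have near: "False" if "l1_dist d u (walk x a m) \<le> 1" "l1_dist d u (walk x b l) \<le> 1"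
    "m \<le> l + 2" "l \<le> m + 2" "m \<in> {2 * i, 2 * i + 1} \<or> l \<in> {2 * i, 2 * i + 1}" for u m l
    using l1_shared[OF that] far' by blast
  show "shell d x a i \<inter> shared = {}"
  proof (rule ccontr)
    assume "shell d x a i \<inter> shared \<noteq> {}"
    then obtain u where u: "u \<in> shell d x a i" "u \<in> shared" by auto
    obtain m where m: "m \<in> {2 * i, 2 * i + 1}" "u \<in> surround d x a m" using u(1) by (rule shell_cases)
    have um: "l1_dist d u (walk x a m) \<le> 1" using A.l1_walk_surround[OF m(2)] by simp
    have "u \<notin> range (walk x a)" using A.surround_not_walk[OF m(2)] by blast
    then consider k where "u = walk x b k" | j where "u \<in> shell d x b j"
      using u unfolding shared_def by blast
    then show False
    proof cases
      case (1 k)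
      then have "k = m + 1 \<or> k + 1 = m" using surround_walk_levels(1) m by blast
      then show False using near[OF um, of k] 1 l1_self[of u] m(1) by auto
    next
      case (2 j)
      obtain l where l: "l \<in> {2 * j, 2 * j + 1}" "u \<in> surround d x b l" using 2 by (rule shell_cases)
      then show False using near[OF um, of l] B.l1_walk_surround[OF l(2)] surround_levels[OF m(2) l(2)] m(1) by auto
    qed
  qed
  show "shell d x b i \<inter> shared = {}"
  proof (rule ccontr)
    assume "shell d x b i \<inter> shared \<noteq> {}"
    then obtain u where u: "u \<in> shell d x b i" "u \<in> shared" by auto
    obtain m where m: "m \<in> {2 * i, 2 * i + 1}" "u \<in> surround d x b m" using u(1) by (rule shell_cases)
    have um: "l1_dist d u (walk x b m) \<le> 1" using B.l1_walk_surround[OF m(2)] by simp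
    have "u \<notin> range (walk x b)" using B.surround_not_walk[OF m(2)] by blast
    then consider k where "u = walk x a k" | j where "u \<in> shell d x a j"
      using u unfolding shared_def by blast
    then show False
    proof cases
      case (1 k)
      then have "k = m + 1 \<or> k + 1 = m" using surround_walk_levels(2) m by blast
      then show False using near[OF _ um, of k] 1 l1_self[of u] m(1) by auto
    next
      case (2 j)
      obtain l where l: "l \<in> {2 * j, 2 * j + 1}" "u \<in> surround d x a l" using 2 by (rule shell_cases)
      then show False using near[OF _ um, of l] A.l1_walk_surround[OF l(2)] surround_levels[OF l(2) m(2)] m(1) by auto
    qed
  qed
qed

end

context lattice_field
begin

definition \<theta> :: real where "\<theta> = 1 / (1 - \<tau>) ^ 28"

lemma \<theta>_ge_1: "1 \<le> \<theta>"
  unfolding \<theta>_def using \<tau>_bounds by (simp add: power_le_one)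

lemma pr_all_low:
  assumes "finite S" "S \<subseteq> int_points d"
  shows "pr (\<lambda>y. \<forall>u\<in>S. y u < K) = \<tau> ^ card S"
proof -
  have "pr (\<lambda>y. \<forall>u\<in>S. y u < K) = (\<Prod>u\<in>S. pr (\<lambda>y. y u < K))"
    by (rule pr_indep[where S = "\<lambda>u. {u}"])
      (use assms in \<open>auto simp: disjoint_family_on_def intro: depends_on_point\<close>)
  also have "\<dots> = (\<Prod>u\<in>S. \<tau>)" using assms pr_low by (intro prod.cong) auto
  finally show ?thesis by simp
qed

lemma pr_deleted_open_theta:
  assumes "direction_word d x a" "card (shell d x a i \<inter> D) \<le> 28"
  shows "pr (deleted_open K d D x a i) \<le> \<theta> * pr (deleted_open K d {} x a i)"
  using pr_deleted_open_relax[OF assms] \<tau>_bounds by (simp add: \<theta>_def field_simps)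

text \<open>For an apart block, deleting \<open>shared\<close> makes the two events independent, at
  cost \<open>\<theta>\<close> each, or at no cost when far. For a common block the second event is
  dropped, and \<open>pb i / q0 \<ge> 1\<close> supplies its probability on the right. With exactly
  one common vertex, only three distinct vertices are required to lie in cells below
  \<open>K\<close>, with probability \<open>\<tau> ^ 3\<close>; as \<open>q0\<close> will have order
  \<open>1/d^2\<close>, that weight is \<open>O(d)\<close>.\<close>

lemma pr_pair_le:
  assumes wa: "direction_word d x a" and wb: "direction_word d x b"
  shows "pr (\<lambda>y. path_open K d n x a y \<and> path_open K d n x b y) \<le>
    pr (path_open K d n x a) * pr (path_open K d n x b) *
    (\<Prod>i<n. pair_weight (\<theta> / q0) (\<tau> ^ 3 / q0\<^sup>2) (\<theta>\<^sup>2) d (walk_diff a b (2 * i)) (walk_diff a b (2 * i + 1)))"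
proof -
  interpret word_pair d x a b n
    using wa wb by (simp add: word_pair_def)
  let ?w = "walk x a" and ?w' = "walk x b"
  define P where "P i = {?w (2 * i), ?w (2 * i + 1), ?w' (2 * i), ?w' (2 * i + 1)}" for i
  define both where "both i \<longleftrightarrow> ?w (2 * i) = ?w' (2 * i) \<and> ?w (2 * i + 1) = ?w' (2 * i + 1)" for i
  define E where "E i y \<longleftrightarrow> (if apart i then deleted_open K d shared x a i y \<and> deleted_open K d shared x b i y
     else if both i then deleted_open K d shared x a i y else (\<forall>u\<in>P i. y u < K))" for i y
  define T where "T i = P i \<union> (shell d x a i - shared) \<union> (if apart i then shell d x b i - shared else {})" for i
  note depA = A.depends_deleted_open and depB = B.depends_deleted_open
  have finT: "finite (T i)" "T i \<subseteq> int_points d" for i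
    using A.finite_shell[of i] B.finite_shell[of i] A.shell_points[of i] B.shell_points[of i]
      A.walk_point B.walk_point
    unfolding T_def P_def by auto
  have depT: "depends_on (T i) (E i)" for i
  proof -
    have "depends_on (T i) (\<lambda>y. deleted_open K d shared x a i y \<and> deleted_open K d shared x b i y)" if "apart i"
      by (rule depends_on_mono[OF depends_on_conj[OF depA depB]]) (use that in \<open>auto simp: T_def P_def\<close>)
    moreover have "depends_on (T i) (deleted_open K d shared x a i)"
      by (rule depends_on_mono[OF depA]) (auto simp: T_def P_def)
    moreover have "depends_on (T i) (\<lambda>y. \<forall>u\<in>P i. y u < K)"
      by (auto simp: T_def depends_on_def)
    ultimately show ?thesis unfolding E_def[abs_def] by (cases "apart i"; cases "both i") simp_all
  qed
  have imp: "\<forall>i\<in>{..<n}. E i y" if "path_open K d n x a y \<and> path_open K d n x b y" for y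
  proof
    fix i assume "i \<in> {..<n}"
    then have "deleted_open K d {} x a i y" "deleted_open K d {} x b i y"
      using that by (auto simp: path_open_def)
    moreover from this have "\<forall>u\<in>P i. y u < K"
      by (auto simp: P_def deleted_open_def block_open_def)
    ultimately show "E i y"
      unfolding E_def using A.deleted_open_antimono B.deleted_open_antimono by simp
  qed
  \<comment> \<open>All vertices of both walks belong to \<open>shared\<close>, so the remaining
    shells avoid the walk vertices of every block.\<close>
  have pub: "P i \<inter> (shell d x a j - shared) = {}" "P i \<inter> (shell d x b j - shared) = {}" for i j
    unfolding P_def shared_def by blast+
  have dis: "disjoint_family_on T {..<n}"
    unfolding disjoint_family_on_def
  proof (intro ballI impI)
    fix i j assume ij: "i \<in> {..<n}" "j \<in> {..<n}" "i \<noteq> j"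
    have lv: "level d u = level d x + 2 * int k \<or> level d u = level d x + 2 * int k + 1" if "u \<in> P k" for u k
      using that A.level_walk B.level_walk by (auto simp: P_def)
    have "P i \<inter> P j = {}"
    proof (rule ccontr)
      assume "P i \<inter> P j \<noteq> {}"
      then obtain u where "u \<in> P i" "u \<in> P j" by auto
      from lv[OF this(1)] lv[OF this(2)] ij(3) show False by presburger
    qed
    moreover have "(shell d x a i - shared) \<inter> (if apart j then shell d x b j - shared else {}) = {}"
      "(shell d x a j - shared) \<inter> (if apart i then shell d x b i - shared else {}) = {}"
      unfolding shared_def using ij by auto
    ultimately show "T i \<inter> T j = {}"
      unfolding T_def using pub[of i j] pub[of j i] A.shell_disjoint[OF ij(3)] B.shell_disjoint[OF ij(3)]
      by (auto split: if_splits; blast)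
  qed
  define pa pb where "pa i = pr (deleted_open K d {} x a i)" and "pb i = pr (deleted_open K d {} x b i)" for i
  have q: "q0 \<le> pa i" "q0 \<le> pb i" for i
    unfolding pa_def pb_def using pr_deleted_open_ge wa wb by auto
  then have pos: "0 < pa i" "0 < pb i" for i using bb_pos by (metis less_le_trans)+
  have lea: "pr (deleted_open K d shared x a i) \<le> \<theta> * pa i" for i
    unfolding pa_def by (rule pr_deleted_open_theta[OF wa card_shell_shared(1)])
  have leb: "pr (deleted_open K d shared x b i) \<le> \<theta> * pb i" if "apart i" for i
    unfolding pb_def by (rule pr_deleted_open_theta[OF wb card_shell_shared(2)[OF that]])
  let ?R = "\<lambda>i. pair_weight (\<theta> / q0) (\<tau> ^ 3 / q0\<^sup>2) (\<theta>\<^sup>2) d (walk_diff a b (2 * i)) (walk_diff a b (2 * i + 1))"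
  have zero: "walk_diff a b m = 0 \<longleftrightarrow> ?w m = ?w' m" for m
    unfolding walk_diff_eq[of x a m b, symmetric] by (rule right_minus_eq)
  have single: "pr (E i) \<le> pa i * pb i * ?R i" if "i < n" for i
  proof -
    consider "apart i" | "both i" "\<not> apart i" | "\<not> apart i" "\<not> both i" by blast
    then show ?thesis
    proof cases
      case 1
      have "pr (E i) = pr (\<lambda>y. deleted_open K d shared x a i y \<and> deleted_open K d shared x b i y)"
        using 1 by (simp add: E_def[abs_def])
      also have "\<dots> = pr (deleted_open K d shared x a i) * pr (deleted_open K d shared x b i)"
      proof (rule pr_indep2[OF _ _ _ _ depA depB])
        have "{?w (2 * i), ?w (2 * i + 1)} \<inter> {?w' (2 * i), ?w' (2 * i + 1)} = {}"
          using 1 walks_meet[of "2 * i" "2 * i + 1"] walks_meet[of "2 * i + 1" "2 * i"] unfolding apart_def by auto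
        moreover have "(shell d x a i - shared) \<inter> (shell d x b i - shared) = {}"
          unfolding shared_def using 1 that by auto
        ultimately show "({?w (2 * i), ?w (2 * i + 1)} \<union> (shell d x a i - shared)) \<inter>
           ({?w' (2 * i), ?w' (2 * i + 1)} \<union> (shell d x b i - shared)) = {}"
          using pub[of i i] unfolding P_def by blast
      qed (use A.finite_shell[of i] B.finite_shell[of i] A.shell_points[of i] B.shell_points[of i]
          A.walk_point B.walk_point in auto)
      also have "\<dots> \<le> pa i * pb i * ?R i"
      proof (cases "sq_norm d (walk_diff a b (2 * i)) \<le> 36")
        case True
        have "pr (deleted_open K d shared x a i) * pr (deleted_open K d shared x b i) \<le> (\<theta> * pa i) * (\<theta> * pb i)"
          using lea leb[OF 1] \<theta>_ge_1 pos[of i] by (intro mult_mono pr_nonneg) auto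
        also have "\<dots> = pa i * pb i * ?R i"
          using 1 True by (simp add: pair_weight_def zero apart_def power2_eq_square)
        finally show ?thesis .
      next
        case False
        have "pr (deleted_open K d shared x a i) \<le> pa i"
          using pr_deleted_open_relax[OF wa, of i shared 0] far_disjoint[OF False] by (simp add: pa_def)
        moreover have "pr (deleted_open K d shared x b i) \<le> pb i"
          using pr_deleted_open_relax[OF wb, of i shared 0] far_disjoint[OF False] by (simp add: pb_def)
        ultimately have "pr (deleted_open K d shared x a i) * pr (deleted_open K d shared x b i) \<le> pa i * pb i"
          using pos[of i] by (intro mult_mono pr_nonneg) auto
        then show ?thesis using 1 False by (simp add: pair_weight_def zero apart_def)
      qed
      finally show ?thesis .
    next
      case 2
      have "pr (E i) = pr (deleted_open K d shared x a i)"
        using 2 by (simp add: E_def[abs_def])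
      also have "\<dots> \<le> pa i * \<theta> * 1" using lea by (simp add: mult.commute)
      also have "\<dots> \<le> pa i * \<theta> * (pb i / q0)"
        using q[of i] bb_pos pos[of i] \<theta>_ge_1 by (intro mult_left_mono) auto
      also have "\<dots> = pa i * pb i * ?R i"
        using 2 by (simp add: pair_weight_def zero both_def)
      finally show ?thesis .
    next
      case 3
      have "card (P i) = 3"
      proof -
        have ne: "?w (2 * i) \<noteq> ?w (2 * i + 1)" "?w' (2 * i) \<noteq> ?w' (2 * i + 1)"
          unfolding A.walk_eq_iff B.walk_eq_iff by simp_all
        have ne': "?w (2 * i) \<noteq> ?w' (2 * i + 1)" "?w' (2 * i) \<noteq> ?w (2 * i + 1)"
          using walks_meet[of "2 * i" "2 * i + 1"] walks_meet[of "2 * i + 1" "2 * i"] by auto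
        from 3 have "?w (2 * i) = ?w' (2 * i) \<and> ?w (2 * i + 1) \<noteq> ?w' (2 * i + 1) \<or>
            ?w (2 * i) \<noteq> ?w' (2 * i) \<and> ?w (2 * i + 1) = ?w' (2 * i + 1)"
          unfolding apart_def both_def by blast
        then show ?thesis
        proof (elim disjE conjE)
          assume e: "?w (2 * i) = ?w' (2 * i)" "?w (2 * i + 1) \<noteq> ?w' (2 * i + 1)"
          then have "P i = {?w (2 * i), ?w (2 * i + 1), ?w' (2 * i + 1)}" by (auto simp: P_def)
          then show ?thesis using e ne ne' by simp
        next
          assume e: "?w (2 * i) \<noteq> ?w' (2 * i)" "?w (2 * i + 1) = ?w' (2 * i + 1)"
          then have "P i = {?w (2 * i), ?w' (2 * i), ?w (2 * i + 1)}" by (auto simp: P_def)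
          then show ?thesis using e ne ne' by simp
        qed
      qed
      moreover have "pr (E i) = pr (\<lambda>y. \<forall>u\<in>P i. y u < K)" using 3 by (simp add: E_def[abs_def])
      ultimately have "pr (E i) = \<tau> ^ 3 * (1 * 1)"
        using pr_all_low[of "P i"] A.walk_point B.walk_point by (auto simp: P_def)
      also have "\<dots> \<le> \<tau> ^ 3 * ((pa i / q0) * (pb i / q0))"
        using q[of i] bb_pos pos[of i] \<tau>_bounds by (intro mult_left_mono mult_mono) auto
      also have "\<dots> = pa i * pb i * ?R i"
        using 3 by (auto simp: pair_weight_def zero both_def apart_def power2_eq_square)
      finally show ?thesis .
    qed
  qed
  have "pr (\<lambda>y. path_open K d n x a y \<and> path_open K d n x b y) \<le> pr (\<lambda>y. \<forall>i\<in>{..<n}. E i y)"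
  proof (rule pr_mono[OF _ imp])
    show "regular (\<lambda>y. \<forall>i\<in>{..<n}. E i y)"
      by (rule regularI[OF _ _ depends_on_all[OF depT]]) (use finT in auto)
  qed
  also have "\<dots> = (\<Prod>i<n. pr (E i))"
    by (rule pr_indep[OF _ _ _ depT dis]) (use finT in auto)
  also have "\<dots> \<le> (\<Prod>i<n. pa i * pb i * ?R i)"
    by (intro prod_mono conjI pr_nonneg single) auto
  also have "\<dots> = pr (path_open K d n x a) * pr (path_open K d n x b) * (\<Prod>i<n. ?R i)"
    by (simp only: prod.distrib pr_path_open[OF wa] pr_path_open[OF wb] pa_def pb_def)
  finally show ?thesis .
qed

end

section \<open>Long open paths\<close>

definition reach :: "nat \<Rightarrow> nat \<Rightarrow> nat \<Rightarrow> (nat \<Rightarrow> int) \<Rightarrow> ((nat \<Rightarrow> int) \<Rightarrow> nat) \<Rightarrow> bool" where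
  "reach K d n x y \<longleftrightarrow> (\<exists>a\<in>words d (2 * n + 2). path_open K d n x a y)"

lemma direction_word_words:
  assumes "d \<ge> 1" "x \<in> int_points d" "a \<in> words d m"
  shows "direction_word d x a"
proof
  show "a i \<in> {1..d}" for i
    using assms by (cases "i < m") (auto simp: words_def)
qed fact

text \<open>The last letter read is \<open>a (2 * i + 2)\<close>, in
  \<open>flip x a (2 * i + 1)\<close>.\<close>

lemma deleted_open_cong:
  assumes "\<And>k. k < 2 * i + 3 \<Longrightarrow> a k = b k"
  shows "deleted_open K d D x a i = deleted_open K d D x b i"
proof -
  have w: "walk x a m = walk x b m" if "m \<le> 2 * i + 2" for m
    using that assms by (intro walk_cong) auto
  have f: "flip x a m = flip x b m" if "m \<le> 2 * i + 1" for m
    using that assms w[of m] by (simp add: flip_def)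
  have "side d x a m = side d x b m" "corner x a m = corner x b m" if "m \<le> 2 * i + 1" for m
    using that w[of m] w[of "m - 1"] w[of "Suc m"] f[of m] f[of "m - 2"] by (simp_all add: side_def corner_def)
  then show ?thesis using w[of "2 * i"] w[of "2 * i + 1"] by (simp add: deleted_open_def)
qed

text \<open>Makes the events decreasing in \<open>n\<close>, as continuity from above
  requires.\<close>

lemma reach_Suc:
  assumes "d \<ge> 1" "reach K d (Suc n) x y" shows "reach K d n x y"
proof -
  obtain a where a: "a \<in> words d (2 * Suc n + 2)" "path_open K d (Suc n) x a y"
    using assms(2) by (auto simp: reach_def)
  define a' where "a' i = (if i < 2 * n + 2 then a i else 1)" for i
  have "a' \<in> words d (2 * n + 2)" using a(1) by (auto simp: words_def a'_def)
  moreover have "deleted_open K d {} x a' i y" if "i < n" for i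
  proof -
    have "deleted_open K d {} x a' i = deleted_open K d {} x a i"
      using that by (intro deleted_open_cong) (auto simp: a'_def)
    then show ?thesis using a(2) that by (simp add: path_open_def)
  qed
  ultimately show ?thesis unfolding reach_def path_open_def by blast
qed

definition diag :: "nat \<Rightarrow> nat \<Rightarrow> nat \<Rightarrow> int" where
  "diag d N = (\<lambda>i. if i \<in> {1..d} then int N else 0)"

lemma diag_point: "diag d N \<in> int_points d"
  by (auto simp: diag_def int_points_def)

context lattice_field
begin

definition reach_support :: "nat \<Rightarrow> (nat \<Rightarrow> int) \<Rightarrow> (nat \<Rightarrow> int) set" where
  "reach_support n x = (\<Union>a\<in>words d (2 * n + 2). \<Union>i\<in>{..<n}.
     {walk x a (2 * i), walk x a (2 * i + 1)} \<union> (shell d x a i - {}))"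

lemma depends_reach:
  assumes x: "x \<in> int_points d" shows "depends_on (reach_support n x) (reach K d n x)"
proof -
  have "depends_on (\<Union>i\<in>{..<n}. {walk x a (2 * i), walk x a (2 * i + 1)} \<union> (shell d x a i - {}))
      (path_open K d n x a)" if "a \<in> words d (2 * n + 2)" for a
    unfolding path_open_def[abs_def]
    by (intro depends_on_all direction_word.depends_deleted_open direction_word_words[OF d x that])
  from depends_on_ex[OF this] show ?thesis
    unfolding reach_support_def reach_def[abs_def] by simp
qed

text \<open>Walks never decrease the first coordinate and neighbours lower it by at most 1. A start
  with large first coordinate therefore has a support that misses any given finite set.\<close>

lemma reach_support:
  assumes x: "x \<in> int_points d"
  shows "finite (reach_support n x)" "reach_support n x \<subseteq> int_points d"
    "u \<in> reach_support n x \<Longrightarrow> x 1 - 1 \<le> u 1"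
proof -
  have dw: "direction_word d x a" if "a \<in> words d m" for a m
    using direction_word_words[OF d x that] .
  show "finite (reach_support n x)"
    unfolding reach_support_def
    by (intro finite_UN_I finite_words) (auto intro: direction_word.finite_shell[OF dw])
  show "reach_support n x \<subseteq> int_points d"
    unfolding reach_support_def
    using direction_word.shell_points[OF dw] direction_word.walk_point[OF dw] by (auto dest: subsetD)
  have w: "x 1 \<le> walk x a m 1" for a m
    by (induction m) (auto simp: walk.simps(2) unit_vector_def)
  assume "u \<in> reach_support n x"
  then obtain a i where a: "a \<in> words d (2 * n + 2)" and u: "u = walk x a (2 * i) \<or> u = walk x a (2 * i + 1) \<or> u \<in> shell d x a i"
    unfolding reach_support_def by auto
  interpret direction_word d x a by (rule dw[OF a])
  have "x 1 - 1 \<le> u 1" if "u \<in> surround d x a m" for m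
    using nbr_coord[OF walk_point surround_nbrs[OF that], of 1] w[of a m] by (auto simp: unit_vector_def)
  then show "x 1 - 1 \<le> u 1" using u w[of a "2 * i"] w[of a "2 * i + 1"] by (auto simp: shell_def)
qed

lemma regular_reach: "x \<in> int_points d \<Longrightarrow> regular (reach K d n x)"
  using regularI[OF reach_support(1,2) depends_reach] .

lemma reach_ge:
  assumes d68: "d \<ge> 68" and x: "x \<in> int_points d" and nn: "0 \<le> \<kappa>" "0 \<le> B" "0 \<le> \<beta>" "0 \<le> \<eta>" "0 \<le> \<rho>"
    and rf: "\<theta> / q0 \<le> \<rho> * (real d)\<^sup>2" and rp: "\<tau> ^ 3 / q0\<^sup>2 \<le> \<beta> * real d"
    and rn: "\<theta>\<^sup>2 \<le> 1 + \<eta> / real d"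
    and zero: "\<rho> * (1 + \<kappa> / real d + B) + \<beta> * (1 + \<kappa> / real d + B / real d) \<le> B"
    and near: "\<beta> * (1 + \<kappa> / real d + B) + \<eta> + B + \<eta> * (\<kappa> + B) / real d \<le> \<kappa> / 4624"
  shows "1 / potential \<kappa> B d 0 \<le> pr (reach K d n x)"
proof -
  let ?W = "words d (2 * n + 2)"
  let ?A = "\<lambda>a. {\<omega>\<in>space M. path_open K d n x a (\<lambda>v. Y v \<omega>)}"
  let ?R = "pair_weight (\<theta> / q0) (\<tau> ^ 3 / q0\<^sup>2) (\<theta>\<^sup>2) d"
  have dw: "direction_word d x a" if "a \<in> ?W" for a using direction_word_words[OF d x that] .
  have nnR: "0 \<le> \<theta> / q0" "0 \<le> \<tau> ^ 3 / q0\<^sup>2" "1 \<le> \<theta>\<^sup>2"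
    using \<theta>_ge_1 bb_pos \<tau>_bounds by (auto simp: one_le_power)
  have Rnn: "0 \<le> ?R y z" for y z
    using nnR by (simp add: pair_weight_def)
  have "1 / potential \<kappa> B d 0 \<le> prob (\<Union>a\<in>?W. ?A a)"
  proof (rule second_moment)
    show "finite ?W" by (rule finite_words)
    show "?W \<noteq> {}" using card_words[of d "2 * n + 2"] d by auto
    show "?A a \<in> events" if "a \<in> ?W" for a using event[OF regular_path_open[OF dw[OF that]]] .
    show "prob (?A a) > 0" if "a \<in> ?W" for a using pr_path_open_pos[OF dw[OF that], of n] by (simp add: pr_def)
    show "potential \<kappa> B d 0 > 0" using potential_ge_1[OF nn(1,2), of d 0] by linarith
    have "prob (?A a \<inter> ?A b) / (prob (?A a) * prob (?A b)) \<le>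
        (\<Prod>i<n. ?R (walk_diff a b (2 * i)) (walk_diff a b (2 * i + 1)))" if "a \<in> ?W" "b \<in> ?W" for a b
    proof -
      have "?A a \<inter> ?A b = {\<omega>\<in>space M. path_open K d n x a (\<lambda>v. Y v \<omega>) \<and> path_open K d n x b (\<lambda>v. Y v \<omega>)}"
        by auto
      then show ?thesis
        using pr_pair_le[OF dw[OF that(1)] dw[OF that(2)], of n]
          pr_path_open_pos[OF dw[OF that(1)], of n] pr_path_open_pos[OF dw[OF that(2)], of n]
        by (simp add: pr_def divide_le_eq mult.commute)
    qed
    then have "(\<Sum>a\<in>?W. \<Sum>b\<in>?W. prob (?A a \<inter> ?A b) / (prob (?A a) * prob (?A b))) \<le>
      (\<Sum>a\<in>?W. \<Sum>b\<in>?W. \<Prod>i<n. ?R (walk_diff a b (2 * i)) (walk_diff a b (2 * i + 1)))"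
      by (intro sum_mono)
    also have "\<dots> \<le> potential \<kappa> B d 0 * (real (card ?W))\<^sup>2"
    proof (rule pair_words_bound)
      show "avg d (\<lambda>y. ?R z y * avg d (potential \<kappa> B d) y) z \<le> potential \<kappa> B d z" for z
        by (rule potential_supersolution[OF d68 nn nnR(1) rf nnR(2) rp nnR(3) rn zero near])
    qed (use d Rnn potential_ge_1[OF nn(1,2)] in auto)
    finally show "(\<Sum>a\<in>?W. \<Sum>b\<in>?W. prob (?A a \<inter> ?A b) / (prob (?A a) * prob (?A b))) \<le>
        potential \<kappa> B d 0 * (real (card ?W))\<^sup>2" .
  qed
  moreover have "(\<Union>a\<in>?W. ?A a) = {\<omega>\<in>space M. reach K d n x (\<lambda>v. Y v \<omega>)}"
    by (auto simp: reach_def)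
  ultimately show ?thesis unfolding pr_def by (simp only:)
qed

text \<open>Zero-one argument by hand: each new diagonal start lies beyond the finite support examined
  so far, so the events that it fails to reach far are independent of the past.\<close>

lemma AE_reach:
  assumes c: "0 < c" and ge: "\<And>n x. x \<in> int_points d \<Longrightarrow> c \<le> pr (reach K d n x)"
  shows "AE \<omega> in M. \<exists>N. \<forall>n. reach K d n (diag d N) (\<lambda>v. Y v \<omega>)"
proof -
  define R where "R n N = {\<omega>\<in>space M. reach K d n (diag d N) (\<lambda>v. Y v \<omega>)}" for n N
  define Bad where "Bad = {\<omega>\<in>space M. \<forall>N. \<exists>n. \<not> reach K d n (diag d N) (\<lambda>v. Y v \<omega>)}"
  have R: "R n N \<in> events" for n N
    unfolding R_def by (rule event[OF regular_reach[OF diag_point]])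
  have "Bad = (\<Inter>N. \<Union>n. space M - R n N)" by (auto simp: Bad_def R_def)
  then have Bad: "Bad \<in> events" using R by auto
  \<comment> \<open>On \<open>Bad\<close> every start fails at some finite \<open>n\<close>, so the
    events \<open>Bad \<inter> R n N\<close> decrease to the empty set.\<close>
  have eps: "\<exists>n. prob (Bad \<inter> R n N) \<le> \<epsilon>" if "\<epsilon> > 0" for N \<epsilon>
  proof -
    have "decseq (\<lambda>n. Bad \<inter> R n N)"
      unfolding decseq_Suc_iff R_def using reach_Suc[OF d] by auto
    then have "(\<lambda>n. prob (Bad \<inter> R n N)) \<longlonglongrightarrow> prob (\<Inter>n. Bad \<inter> R n N)"
      using R Bad by (intro finite_Lim_measure_decseq) auto
    moreover have "(\<Inter>n. Bad \<inter> R n N) = {}" by (auto simp: Bad_def R_def)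
    ultimately have "(\<lambda>n. prob (Bad \<inter> R n N)) \<longlonglongrightarrow> 0" by simp
    from order_tendstoD(2)[OF this that] obtain n where "prob (Bad \<inter> R n N) < \<epsilon>"
      by (auto simp: eventually_sequentially)
    then show ?thesis by (auto intro: less_imp_le)
  qed
  have c1: "c \<le> 1" using ge[OF diag_point[of d 0], of 0] pr_le_1[of "reach K d 0 (diag d 0)"] by linarith
  \<comment> \<open>\<open>Q\<close> says that \<open>k\<close> starts, chosen one after the other,
    have all failed. The length at which each is tested is so large that being in \<open>Bad\<close>
    without having failed costs at most \<open>\<epsilon>\<close> per start.\<close>
  have step: "\<exists>S Q. finite S \<and> S \<subseteq> int_points d \<and> depends_on S Q \<and> pr Q \<le> (1 - c) ^ k \<and>
      prob (Bad \<inter> {\<omega>\<in>space M. \<not> Q (\<lambda>v. Y v \<omega>)}) \<le> real k * \<epsilon>" if \<epsilon>: "\<epsilon> > 0" for \<epsilon> k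
  proof (induction k)
    case 0
    show ?case
      by (rule exI[of _ "{}"], rule exI[of _ "\<lambda>_. True"]) (simp add: depends_on_def pr_le_1)
  next
    case (Suc k)
    then obtain S Q where S: "finite S" "S \<subseteq> int_points d" "depends_on S Q" "pr Q \<le> (1 - c) ^ k"
      and Q: "prob (Bad \<inter> {\<omega>\<in>space M. \<not> Q (\<lambda>v. Y v \<omega>)}) \<le> real k * \<epsilon>" by blast
    obtain N0 where N0: "\<And>u. u \<in> S \<Longrightarrow> nat \<bar>u 1\<bar> \<le> N0"
    proof
      show "nat \<bar>u 1\<bar> \<le> Max ((\<lambda>u. nat \<bar>u 1\<bar>) ` S)" if "u \<in> S" for u using that S(1) by simp
    qed
    \<comment> \<open>The support of the new start has first coordinate at least
      \<open>N - 1 = N0 + 1\<close>, beyond all of \<open>S\<close>.\<close>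
    define N where "N = N0 + 2"
    obtain n where n: "prob (Bad \<inter> R n N) \<le> \<epsilon>" using eps[OF \<epsilon>] by blast
    let ?x = "diag d N" let ?T = "reach_support n ?x"
    note T = reach_support[OF diag_point[of d N], where n = n] and depT = depends_reach[OF diag_point[of d N], where n = n]
    have dis: "S \<inter> ?T = {}"
    proof (rule ccontr)
      assume "S \<inter> ?T \<noteq> {}"
      then obtain u where u: "u \<in> S" "u \<in> ?T" by auto
      have "int N - 1 \<le> u 1" using T(3)[OF u(2)] d by (simp add: diag_def)
      then show False using N0[OF u(1)] by (simp add: N_def)
    qed
    let ?Q = "\<lambda>y. Q y \<and> \<not> reach K d n ?x y"
    have "pr ?Q = pr Q * pr (\<lambda>y. \<not> reach K d n ?x y)"
      by (rule pr_indep2[OF S(1) T(1) S(2) T(2) S(3) depends_on_not[OF depT] dis])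
    also have "\<dots> = pr Q * (1 - pr (reach K d n ?x))"
      by (simp add: pr_not[OF regular_reach[OF diag_point]])
    also have "\<dots> \<le> (1 - c) ^ k * (1 - c)"
      using S(4) ge[OF diag_point[of d N], of n] c1 pr_le_1 by (intro mult_mono) auto
    finally have prQ: "pr ?Q \<le> (1 - c) ^ Suc k" by (simp add: mult.commute)
    have evQ: "{\<omega>\<in>space M. \<not> Q (\<lambda>v. Y v \<omega>)} \<in> events"
      by (rule event[OF regularI[OF S(1,2) depends_on_not[OF S(3)]]])
    have "prob (Bad \<inter> {\<omega>\<in>space M. \<not> ?Q (\<lambda>v. Y v \<omega>)}) \<le>
        prob ((Bad \<inter> {\<omega>\<in>space M. \<not> Q (\<lambda>v. Y v \<omega>)}) \<union> (Bad \<inter> R n N))"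
      using Bad R evQ by (intro finite_measure_mono) (auto simp: R_def)
    also have "\<dots> \<le> prob (Bad \<inter> {\<omega>\<in>space M. \<not> Q (\<lambda>v. Y v \<omega>)}) + prob (Bad \<inter> R n N)"
      using Bad R evQ by (intro measure_Un_le) auto
    also have "\<dots> \<le> real (Suc k) * \<epsilon>" using Q n by (simp add: algebra_simps)
    finally have "prob (Bad \<inter> {\<omega>\<in>space M. \<not> ?Q (\<lambda>v. Y v \<omega>)}) \<le> real (Suc k) * \<epsilon>" .
    then show ?case
      using prQ S(1,2) T(1,2) depends_on_conj[OF S(3) depends_on_not[OF depT]]
      by (intro exI[of _ "S \<union> ?T"] exI[of _ ?Q]) auto
  qed
  have le: "prob Bad \<le> (1 - c) ^ k + real k * \<epsilon>" if \<epsilon>: "\<epsilon> > 0" for k \<epsilon>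
  proof -
    obtain S Q where S: "finite S" "S \<subseteq> int_points d" "depends_on S Q" "pr Q \<le> (1 - c) ^ k"
      and Q: "prob (Bad \<inter> {\<omega>\<in>space M. \<not> Q (\<lambda>v. Y v \<omega>)}) \<le> real k * \<epsilon>" using step[OF \<epsilon>] by blast
    have ev: "{\<omega>\<in>space M. \<not> Q (\<lambda>v. Y v \<omega>)} \<in> events" "{\<omega>\<in>space M. Q (\<lambda>v. Y v \<omega>)} \<in> events"
      by (rule event[OF regularI[OF S(1,2) depends_on_not[OF S(3)]]], rule event[OF regularI[OF S(1,2,3)]])
    have "prob Bad \<le> prob ({\<omega>\<in>space M. Q (\<lambda>v. Y v \<omega>)} \<union> (Bad \<inter> {\<omega>\<in>space M. \<not> Q (\<lambda>v. Y v \<omega>)}))"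
      using Bad ev by (intro finite_measure_mono) (auto simp: Bad_def)
    also have "\<dots> \<le> pr Q + prob (Bad \<inter> {\<omega>\<in>space M. \<not> Q (\<lambda>v. Y v \<omega>)})"
      unfolding pr_def using Bad ev by (intro measure_Un_le) auto
    finally show ?thesis using S(4) Q by linarith
  qed
  have "prob Bad \<le> (1 - c) ^ k" for k
  proof (rule field_le_epsilon)
    fix e :: real assume e: "e > 0"
    have "prob Bad \<le> (1 - c) ^ k + real k * (e / (real k + 1))" using e by (intro le) auto
    also have "real k * (e / (real k + 1)) \<le> e" using e by (simp add: field_simps)
    finally show "prob Bad \<le> (1 - c) ^ k + e" by simp
  qed
  moreover have "(\<lambda>k. (1 - c) ^ k) \<longlonglongrightarrow> 0" using c c1 by (intro LIMSEQ_power_zero) auto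
  ultimately have "prob Bad \<le> 0" by (intro LIMSEQ_le_const) auto
  then have "prob Bad = 0" using measure_nonneg[of M Bad] by linarith
  then have "Bad \<in> null_sets M" using Bad by (simp add: null_sets_def emeasure_eq_measure)
  then show ?thesis
    by (rule AE_I') (auto simp: Bad_def)
qed

end

section \<open>From long open paths to an infinite path in the layer set\<close>

lemma walk_Cons: "walk v a (Suc m) = walk (v + unit_vector (a 0)) (\<lambda>i. a (Suc i)) m"
proof (induction m)
  case (Suc m)
  show ?case
    by (subst walk.simps(2), subst Suc) (simp only: walk.simps(2))
qed (simp add: walk.simps)

text \<open>Koenig's lemma. If no successor of an alive vertex were alive, each of the
  \<open>d\<close> directions would have a length at which its walks fail, and a walk longer than
  the maximum of these would contradict the one for its first letter.\<close>

lemma infinite_walk: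
  assumes ex: "\<And>n. \<exists>a. (\<forall>i. a i \<in> {1..d}) \<and> (\<forall>m<n. walk v a m \<in> T)"
  shows "\<exists>p. p 0 = v \<and> (\<forall>i. p i \<in> T \<and> (\<exists>j\<in>{1..d}. p (Suc i) = p i + unit_vector j))"
proof -
  define alive where "alive v \<longleftrightarrow> (\<forall>n. \<exists>a. (\<forall>i. a i \<in> {1..d}) \<and> (\<forall>m<n. walk v a m \<in> T))" for v
  have aliveT: "v \<in> T" if "alive v" for v
    using that unfolding alive_def by (metis lessI walk.simps(1))
  have next_alive: "\<exists>j\<in>{1..d}. alive (v + unit_vector j)" if v: "alive v" for v
  proof (rule ccontr)
    assume "\<not> (\<exists>j\<in>{1..d}. alive (v + unit_vector j))"
    then have "\<forall>j\<in>{1..d}. \<exists>n. \<not> (\<exists>a. (\<forall>i. a i \<in> {1..d}) \<and> (\<forall>m<n. walk (v + unit_vector j) a m \<in> T))"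
      unfolding alive_def by blast
    then obtain f where f: "\<And>j. j \<in> {1..d} \<Longrightarrow> \<not> (\<exists>a. (\<forall>i. a i \<in> {1..d}) \<and> (\<forall>m<f j. walk (v + unit_vector j) a m \<in> T))"
      by metis
    obtain N where N: "\<And>j. j \<in> {1..d} \<Longrightarrow> f j \<le> N"
    proof
      show "f j \<le> Max (f ` {1..d})" if "j \<in> {1..d}" for j using that by simp
    qed
    obtain a where a: "\<forall>i. a i \<in> {1..d}" "\<forall>m<Suc N. walk v a m \<in> T"
      using v unfolding alive_def by blast
    have "walk (v + unit_vector (a 0)) (\<lambda>i. a (Suc i)) m \<in> T" if "m < f (a 0)" for m
    proof -
      have "Suc m < Suc N" using that N[of "a 0"] a(1) by (meson Suc_mono less_le_trans)
      then show ?thesis using a(2) walk_Cons by metis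
    qed
    moreover have "\<forall>i. a (Suc i) \<in> {1..d}" using a(1) by blast
    moreover have "a 0 \<in> {1..d}" using a(1) by blast
    ultimately show False using f[of "a 0"] by (metis (no_types))
  qed
  have "\<exists>p. p 0 = v \<and> (\<forall>i. alive (p i) \<and> (\<exists>j\<in>{1..d}. p (Suc i) = p i + unit_vector j))"
  proof -
    define nxt where "nxt v = v + unit_vector (SOME j. j \<in> {1..d} \<and> alive (v + unit_vector j))" for v
    have nxt: "alive (nxt v) \<and> (\<exists>j\<in>{1..d}. nxt v = v + unit_vector j)" if "alive v" for v
    proof -
      let ?j = "SOME j. j \<in> {1..d} \<and> alive (v + unit_vector j)"
      have "\<exists>j. j \<in> {1..d} \<and> alive (v + unit_vector j)" using next_alive[OF that] by blast
      from someI_ex[OF this] have "?j \<in> {1..d}" "alive (v + unit_vector ?j)" by blast+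
      then show ?thesis unfolding nxt_def by blast
    qed
    have "alive v" using ex by (simp add: alive_def)
    then have "alive ((nxt ^^ i) v)" for i by (induction i) (use nxt in auto)
    then show ?thesis using nxt by (intro exI[of _ "\<lambda>i. (nxt ^^ i) v"]) auto
  qed
  then show ?thesis using aliveT by blast
qed

text \<open>Smaller neighbours can only be on the side, or the walk neighbour in the adjacent block,
  or the partner in the same block if its cell is not larger: \<open>2 + 1 + 0\<close> or
  \<open>1 + 1 + 1\<close> in total. Flips off the walk are in cell \<open>K\<close> and hence not
  smaller.\<close>

lemma path_open_layer:
  assumes dw: "direction_word d x a" and op: "path_open K d n x a y" and m: "m < 2 * n"
    and mono: "\<And>u v. X u \<le> X v \<Longrightarrow> y u \<le> y v"
  shows "walk x a m \<in> layer_set 4 (int_lattice d) X"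
proof -
  interpret direction_word d x a by (rule dw)
  define v where "v = walk x a m"
  define i where "i = m div 2"
  have i: "i < n" using m by (auto simp: i_def)
  have bo: "deleted_open K d {} x a i y" if "i < n" for i
    using op that by (simp add: path_open_def)
  have corner: "y u = K" if "u \<in> corner x a k" "k < 2 * n" for u k
  proof -
    have "deleted_open K d {} x a (k div 2) y" using that by (intro bo) auto
    moreover have "k = 2 * (k div 2) \<or> k = 2 * (k div 2) + 1" by presburger
    ultimately show ?thesis using that(1) unfolding deleted_open_def block_open_def by auto
  qed
  \<comment> \<open>\<open>w\<close> is the partner inside the block and \<open>z\<close> the walk
    neighbour outside it. For \<open>m = 0\<close> the truncated index makes \<open>z\<close> equal
    to \<open>v\<close>, which only enlarges the covering set.\<close>
  define w where "w = (if even m then walk x a (m + 1) else walk x a (m - 1))"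
  define z where "z = (if even m then walk x a (m - 1) else walk x a (m + 1))"
  have blk: "y v < K" "card {u\<in>side d x a m. y u \<le> y v} \<le> (if y v < y w then 2 else 1)"
  proof -
    have "y v < K \<and> card {u\<in>side d x a m. y u \<le> y v} \<le> (if y v < y w then 2 else 1)"
    proof (cases "even m")
      case True
      then have "m = 2 * i" by (simp add: i_def)
      then show ?thesis using bo[OF i] True by (simp add: deleted_open_def block_open_def v_def w_def)
    next
      case False
      then have "m = 2 * i + 1" by (auto simp: i_def elim: oddE)
      then show ?thesis using bo[OF i] False by (simp add: deleted_open_def block_open_def v_def w_def)
    qed
    then show "y v < K" "card {u\<in>side d x a m. y u \<le> y v} \<le> (if y v < y w then 2 else 1)" by auto
  qed
  let ?L = "{u \<in> nbrs d v. X u < X v}" let ?A = "{u\<in>side d x a m. y u \<le> y v}"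
  have Lle: "y u \<le> y v" if "u \<in> ?L" for u using that mono by auto
  have sub: "?L \<subseteq> ?A \<union> {z} \<union> (if y v < y w then {} else {w})"
  proof
    fix u assume u: "u \<in> ?L"
    have uw: "u \<noteq> w" if "y v < y w"
      using that Lle[OF u] by auto
    \<comment> \<open>For \<open>m = 1\<close> the truncated index \<open>m - 2 = 0\<close> leads to
      \<open>walk x a 1 = v\<close>, which \<open>u \<noteq> v\<close> excludes.\<close>
    have flips: "u = walk x a (m - 1) \<or> u = walk x a (m + 1)" if "u = flip x a k" "k = m \<or> k = m - 2" for k
    proof -
      have "u \<notin> corner x a k"
      proof
        assume "u \<in> corner x a k"
        moreover have "k < 2 * n" using that(2) m by auto
        ultimately have "y u = K" by (rule corner)
        then show False using Lle[OF u] blk(1) by simp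
      qed
      then have uk: "u = walk x a (Suc k)" using that(1) by (simp add: corner_def)
      moreover have "u \<noteq> v" using u by auto
      ultimately show ?thesis using that(2) by (cases "m \<le> 1") (auto simp: v_def numeral_2_eq_2 Suc_diff_Suc le_Suc_eq)
    qed
    show "u \<in> ?A \<union> {z} \<union> (if y v < y w then {} else {w})"
    proof (cases "u \<in> side d x a m")
      case True
      then show ?thesis using Lle[OF u] by simp
    next
      case False
      then have "u = walk x a (m - 1) \<or> u = walk x a (m + 1)"
        using u flips[of m] flips[of "m - 2"] by (auto simp: side_def v_def)
      then have "u = w \<or> u = z" by (auto simp: w_def z_def)
      then show ?thesis using uw by auto
    qed
  qed
  have finA: "finite ?A"
    using finite_nbrs[OF walk_point[of m]] by (auto simp: side_def)
  have "card ?L \<le> card (?A \<union> {z} \<union> (if y v < y w then {} else {w}))"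
    using finA by (intro card_mono sub) auto
  also have "\<dots> \<le> card ?A + card {z} + card (if y v < y w then {} else {w})"
    by (intro order_trans[OF card_Un_le] add_mono card_Un_le order_refl)
  also have "\<dots> \<le> 3" using blk(2) by (auto split: if_splits)
  finally have "card ?L \<le> 3" .
  moreover have "finite ?L" using finite_nbrs[OF walk_point[of m]] by (auto simp: v_def)
  ultimately show ?thesis
    using walk_point[of m] by (simp add: layer_set_def v_def verts_def int_lattice_def)
qed

text \<open>Negative reals fall into cell 0 through \<open>nat\<close>, so boundedness and
  monotonicity hold for every real and not only almost surely.\<close>

definition cell :: "nat \<Rightarrow> real \<Rightarrow> real \<Rightarrow> nat" where
  "cell K h z = (if z < real K * h then nat \<lfloor>z / h\<rfloor> else K)"

lemma cell_le: "0 < h \<Longrightarrow> cell K h z \<le> K"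
proof -
  assume h: "0 < h"
  have "nat \<lfloor>z / h\<rfloor> \<le> K" if "z < real K * h"
  proof -
    have "z / h < real K" using that h by (simp add: field_simps)
    then show ?thesis by linarith
  qed
  then show ?thesis by (auto simp: cell_def)
qed

lemma cell_le_iff:
  assumes "0 < h" "p < K" shows "cell K h z \<le> p \<longleftrightarrow> z < (real p + 1) * h"
proof (cases "z < real K * h")
  case True
  have "nat \<lfloor>z / h\<rfloor> \<le> p \<longleftrightarrow> z / h < real p + 1" by linarith
  then show ?thesis using True assms by (simp add: cell_def field_simps)
next
  case False
  have "(real p + 1) * h \<le> real K * h" using assms by (intro mult_right_mono) auto
  then have "\<not> z < (real p + 1) * h" using False by linarith
  then show ?thesis using False assms by (simp add: cell_def)
qed

lemma cell_mono: 
  assumes h: "0 < h" and le: "z \<le> z'" shows "cell K h z \<le> cell K h z'"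
proof (cases "z' < real K * h")
  case True
  then show ?thesis using le h by (auto simp: cell_def intro!: nat_mono floor_mono divide_right_mono)
next
  case False
  then show ?thesis using cell_le[OF h, of K z] by (simp add: cell_def)
qed

lemma lattice_field_cells:
  assumes iid: "iid_uniform_ages M (int_lattice d) X" and d: "d \<ge> 1"
    and h: "0 < h" "real K * h < 1" and bb: "block_bound K (2 * d) h > 0"
  shows "lattice_field M d (\<lambda>v \<omega>. cell K h (X v \<omega>)) K h"
proof -
  interpret prob_space M using iid by (simp add: iid_uniform_ages_def)
  have ind: "indep_vars (\<lambda>_. borel) X (int_points d)"
    and dist: "\<And>v. v \<in> int_points d \<Longrightarrow> distr M borel (X v) = uniform_measure lborel {0..1}"
    using iid by (auto simp: iid_uniform_ages_def int_lattice_def verts_def)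
  have meas: "cell K h \<in> borel \<rightarrow>\<^sub>M count_space UNIV"
  proof -
    have "(\<lambda>z::real. nat \<lfloor>z / h\<rfloor>) \<in> borel \<rightarrow>\<^sub>M count_space UNIV"
      by measurable
    then show ?thesis unfolding cell_def[abs_def] by measurable
  qed
  show ?thesis
  proof
    show "indep_vars (\<lambda>_. count_space UNIV) (\<lambda>v \<omega>. cell K h (X v \<omega>)) (int_points d)"
      by (rule indep_vars_compose2[OF ind]) (rule meas)
    show "cell K h (X v \<omega>) \<le> K" for v \<omega> by (rule cell_le[OF h(1)])
    show "prob {\<omega> \<in> space M. cell K h (X v \<omega>) \<le> p} = (real p + 1) * h" if "v \<in> int_points d" "p < K" for v p
    proof -
      let ?c = "(real p + 1) * h"
      have rv: "X v \<in> borel_measurable M" using ind that(1) by (auto simp: indep_vars_def)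
      have "?c \<le> real K * h" using that h by (intro mult_right_mono) auto
      then have c: "?c \<le> 1" using h by linarith
      have c0: "0 \<le> ?c" using h by simp
      have "{\<omega> \<in> space M. cell K h (X v \<omega>) \<le> p} = X v -` {..< ?c} \<inter> space M"
        by (auto simp: cell_le_iff[OF h(1) that(2)])
      then have "prob {\<omega> \<in> space M. cell K h (X v \<omega>) \<le> p} = measure (distr M borel (X v)) {..< ?c}"
        using rv by (simp add: measure_distr)
      also have "\<dots> = measure (uniform_measure lborel {0..1::real}) {..< ?c}"
        by (simp add: dist[OF that(1)])
      also have "\<dots> = measure lborel ({0..1::real} \<inter> {..< ?c})"
        by (simp add: measure_uniform_measure)
      also have "{0..1::real} \<inter> {..< ?c} = {0..< ?c}" using c by auto
      also have "measure lborel {0..< ?c} = ?c" using c0 by simp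
      finally show ?thesis .
    qed
  qed (use h d bb in auto)
qed

lemma infinite_path_of_walk:
  assumes p0: "p 0 \<in> nonneg_orthant d" and p: "\<And>i. p i \<in> T"
    and step: "\<And>i. \<exists>j\<in>{1..d}. p (Suc i) = p i + unit_vector j"
  shows "infinite_path (induced_subgraph (int_lattice d) (T \<inter> nonneg_orthant d)) p"
    and "p (Suc i) - p i \<in> {unit_vector j | j. j \<in> {1..d}}"
proof -
  have orth: "p i \<in> nonneg_orthant d" for i
  proof (induction i)
    case (Suc i)
    obtain j where j: "j \<in> {1..d}" "p (Suc i) = p i + unit_vector j" using step by blast
    then have "p (Suc i) \<in> int_points d" using Suc add_unit_point by (simp add: nonneg_orthant_def)
    moreover have "0 \<le> p (Suc i) k" if "k \<in> {1..d}" for k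
      using Suc that j(2) by (auto simp: nonneg_orthant_def unit_vector_def)
    ultimately show ?case by (simp add: nonneg_orthant_def)
  qed (rule p0)
  then have pt: "p i \<in> int_points d" for i by (auto simp: nonneg_orthant_def)
  have lev: "level d (p i) = level d (p 0) + int i" for i
  proof (induction i)
    case (Suc i)
    obtain j where j: "j \<in> {1..d}" "p (Suc i) = p i + unit_vector j" using step by blast
    have "level d (p (Suc i)) = level d (p i) + 1" unfolding j(2) by (rule level_unit[OF j(1)])
    then show ?case using Suc by simp
  qed simp
  have "inj p"
    by (rule injI) (metis add_left_cancel lev of_nat_eq_iff)
  moreover have "{p i, p (Suc i)} \<in> edges (int_lattice d)" for i
  proof -
    obtain j where "j \<in> {1..d}" "p (Suc i) = p i + unit_vector j" using step by blast
    then have "p (Suc i) \<in> nbrs d (p i)" using add_unit_nbr[OF pt] by simp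
    then show ?thesis by (simp add: neighbors_def insert_commute)
  qed
  ultimately show "infinite_path (induced_subgraph (int_lattice d) (T \<inter> nonneg_orthant d)) p"
    using p orth pt by (auto simp: infinite_path_def induced_subgraph_def verts_def edges_def int_lattice_def)
  obtain j where "j \<in> {1..d}" "p (Suc i) = p i + unit_vector j" using step by blast
  moreover from this have "p (Suc i) - p i = unit_vector j" by simp
  ultimately show "p (Suc i) - p i \<in> {unit_vector j | j. j \<in> {1..d}}" by blast
qed

section \<open>Choice of the constants and conclusion\<close>

theorem theorem4p1:
  "\<exists>d0::nat. \<forall>d\<ge>d0. \<forall>(M :: 'w measure) (X :: (nat \<Rightarrow> int) \<Rightarrow> 'w \<Rightarrow> real).
     iid_uniform_ages M (int_lattice d) X \<longrightarrow>
     (AE \<omega> in M. \<exists>v :: nat \<Rightarrow> nat \<Rightarrow> int.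
        infinite_path
          (induced_subgraph (int_lattice d)
             (layer_set 4 (int_lattice d) (\<lambda>u. X u \<omega>) \<inter> nonneg_orthant d)) v \<and>
        (\<forall>i. v (Suc i) - v i \<in> {unit_vector j | j. j \<in> {1..d}}))"
proof -
  obtain d1 where d1: "\<And>d. d \<ge> d1 \<Longrightarrow> 105 / 100 / (real d)\<^sup>2 \<le> block_bound 30 (2 * d) (1 / (8 * real d))"
    using block_bound_large unfolding eventually_sequentially by blast
  show ?thesis
  \<comment> \<open>The size \<open>10 ^ 11\<close> makes \<open>\<kappa> / d\<close> less than
    0.006. The balance at \<open>0\<close> below has slack about 1, and \<open>\<kappa> / d\<close>
    enters it with the factor \<open>98/100 + 48\<close>.\<close>
  proof (intro exI[of _ "max d1 (10 ^ 11)"] allI impI)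
    fix d :: nat and M :: "'w measure" and X :: "(nat \<Rightarrow> int) \<Rightarrow> 'w \<Rightarrow> real"
    assume dge: "max d1 (10 ^ 11) \<le> d" and iid: "iid_uniform_ages M (int_lattice d) X"
    define h where "h = 1 / (8 * real d)"
    define \<tau> where "\<tau> = real 30 * h"
    have D: "real d \<ge> 10 ^ 11" and d68: "d \<ge> 68" "d \<ge> 1"
    proof -
      have "10 ^ 11 \<le> d" using dge by simp
      then have "real (10 ^ 11) \<le> real d" by (rule of_nat_mono)
      then show "real d \<ge> 10 ^ 11" by simp
      show "d \<ge> 68" "d \<ge> 1" using \<open>10 ^ 11 \<le> d\<close> by simp_all
    qed
    have h: "0 < h" "real 30 * h < 1" using D by (auto simp: h_def field_simps)
    have q: "105 / 100 / (real d)\<^sup>2 \<le> block_bound 30 (2 * d) h" using d1 dge by (simp add: h_def)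
    then have q_pos: "block_bound 30 (2 * d) h > 0"
      by (rule less_le_trans[rotated]) (use D in simp)
    interpret F: lattice_field M d "\<lambda>v \<omega>. cell 30 h (X v \<omega>)" 30 h
      by (rule lattice_field_cells[OF iid d68(2) h q_pos])
    have \<tau>: "\<tau> = 15 / 4 / real d" by (simp add: \<tau>_def h_def)
    \<comment> \<open>With \<open>56 = 2 * 28\<close> deleted vertices and
      \<open>\<tau> = 15 / (4 d)\<close>, Bernoulli gives \<open>56 * 15 / 4 = 210\<close>; doubling
      this pays for taking the inverse.\<close>
    have th2: "F.\<theta>\<^sup>2 \<le> 1 + 420 / real d"
    proof -
      have "-1 \<le> - \<tau>" using h by (simp add: \<tau>_def)
      from Bernoulli_inequality[OF this, of 56] have B: "1 - 210 / real d \<le> (1 - \<tau>) ^ 56" by (simp add: \<tau>)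
      have "1 \<le> (1 + 420 / real d) * (1 - 210 / real d)" using D by (simp add: field_simps)
      also have "\<dots> \<le> (1 + 420 / real d) * (1 - \<tau>) ^ 56" using B D by (intro mult_left_mono) auto
      finally have 1: "1 \<le> (1 + 420 / real d) * (1 - \<tau>) ^ 56" .
      have "F.\<theta>\<^sup>2 = 1 / (1 - \<tau>) ^ 56"
        unfolding F.\<theta>_def \<tau>_def by (simp add: power_divide flip: power_mult)
      moreover have "0 < (1 - \<tau>) ^ 56" using h by (simp add: \<tau>_def)
      ultimately show ?thesis using 1 by (simp only: pos_divide_le_eq)
    qed
    have th: "F.\<theta> \<le> 102 / 100"
    proof -
      have "420 / real d \<le> 1 / 100" using D by (simp add: field_simps)
      then have "F.\<theta>\<^sup>2 \<le> (102 / 100)\<^sup>2" using th2 by (simp add: power2_eq_square)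
      then show ?thesis by (rule power2_le_imp_le) simp
    qed
    have qinv: "1 / block_bound 30 (2 * d) h \<le> 100 / 105 * (real d)\<^sup>2"
      using q q_pos D by (simp add: field_simps)
    \<comment> \<open>\<open>102 / 105 < 98 / 100\<close>: the gap between 1.05 and 1 survives the
      factor \<open>\<theta>\<close>, so the ratio at a common block stays below 1.\<close>
    have rf: "F.\<theta> / block_bound 30 (2 * d) h \<le> 98 / 100 * (real d)\<^sup>2"
    proof -
      have "F.\<theta> * (1 / block_bound 30 (2 * d) h) \<le> 102 / 100 * (100 / 105 * (real d)\<^sup>2)"
        using th qinv F.\<theta>_ge_1 q_pos by (intro mult_mono) auto
      also have "\<dots> \<le> 98 / 100 * (real d)\<^sup>2" by simp
      finally show ?thesis by simp
    qed
    \<comment> \<open>The constant \<open>(15/4)^3 * (100/105)^2\<close> is about 47.8.\<close>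
    have rp: "(real 30 * h) ^ 3 / (block_bound 30 (2 * d) h)\<^sup>2 \<le> 48 * real d"
    proof -
      have "(real 30 * h) ^ 3 * (1 / block_bound 30 (2 * d) h)\<^sup>2 \<le> \<tau> ^ 3 * (100 / 105 * (real d)\<^sup>2)\<^sup>2"
        unfolding \<tau>_def using qinv q_pos h by (intro mult_left_mono power_mono) auto
      also have "\<dots> = (15 / 4) ^ 3 * (100 / 105)\<^sup>2 * real d"
      proof -
        have "(s / z) ^ 3 * (r * z\<^sup>2)\<^sup>2 = s ^ 3 * r\<^sup>2 * z" if "z \<noteq> 0" for s r z :: real
          using that by (simp add: power2_eq_square power3_eq_cube)
        from this[of "real d" "15 / 4" "100 / 105"] show ?thesis unfolding \<tau> using d68 by linarith
      qed
      also have "\<dots> \<le> 48 * real d" using D by (intro mult_right_mono) (simp_all add: power2_eq_square power3_eq_cube)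
      finally show ?thesis by (simp add: power_divide)
    qed
    \<comment> \<open>Up to terms of order \<open>1/d\<close>, the condition at \<open>0\<close>
      reads \<open>98/100 + 48 \<le> B / 50\<close>, that is \<open>B \<ge> 2449\<close>; here
      \<open>B = 2500\<close>. Then \<open>\<kappa> = 4624 * 123100\<close>, where 123100 exceeds
      \<open>48 * 2501 + 420 + 2500 = 122968\<close>.\<close>
    define c where "c = 1 / potential 569214400 2500 d 0"
    have "0 < c" using potential_ge_1[of 569214400 2500 d 0] by (simp add: c_def)
    moreover have "c \<le> F.pr (reach 30 d n x)" if "x \<in> int_points d" for n x
      unfolding c_def
    proof (rule F.reach_ge[OF d68(1) that, where \<beta> = 48 and \<eta> = 420 and \<rho> = "98 / 100"])
      show "98 / 100 * (1 + 569214400 / real d + 2500) + 48 * (1 + 569214400 / real d + 2500 / real d) \<le> (2500 :: real)"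
        "48 * (1 + 569214400 / real d + 2500) + 420 + 2500 + 420 * (569214400 + 2500) / real d \<le> (569214400 / 4624 :: real)"
        using D by (simp_all add: field_simps)
    qed (use rf rp th2 in auto)
    ultimately have "AE \<omega> in M. \<exists>N. \<forall>n. reach 30 d n (diag d N) (\<lambda>v. cell 30 h (X v \<omega>))"
      by (rule F.AE_reach)
    then show "AE \<omega> in M. \<exists>v :: nat \<Rightarrow> nat \<Rightarrow> int.
        infinite_path
          (induced_subgraph (int_lattice d)
             (layer_set 4 (int_lattice d) (\<lambda>u. X u \<omega>) \<inter> nonneg_orthant d)) v \<and>
        (\<forall>i. v (Suc i) - v i \<in> {unit_vector j | j. j \<in> {1..d}})"
    proof (rule AE_mp, intro AE_I2 impI)
      fix \<omega> assume "\<exists>N. \<forall>n. reach 30 d n (diag d N) (\<lambda>v. cell 30 h (X v \<omega>))"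
      then obtain N where N: "\<And>n. reach 30 d n (diag d N) (\<lambda>v. cell 30 h (X v \<omega>))" by blast
      let ?T = "layer_set 4 (int_lattice d) (\<lambda>u. X u \<omega>)"
      have "\<exists>a. (\<forall>i. a i \<in> {1..d}) \<and> (\<forall>m<n. walk (diag d N) a m \<in> ?T)" for n
      proof -
        obtain a where a: "a \<in> words d (2 * n + 2)" "path_open 30 d n (diag d N) a (\<lambda>v. cell 30 h (X v \<omega>))"
          using N[of n] by (auto simp: reach_def)
        have dw: "direction_word d (diag d N) a" by (rule direction_word_words[OF d68(2) diag_point a(1)])
        have "walk (diag d N) a m \<in> ?T" if "m < n" for m
          by (rule path_open_layer[OF dw a(2)]) (use that cell_mono[OF h(1)] in auto)
        then show ?thesis using direction_word.a[OF dw] by blast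
      qed
      from infinite_walk[OF this] obtain p where p: "p 0 = diag d N" "\<And>i. p i \<in> ?T"
        "\<And>i. \<exists>j\<in>{1..d}. p (Suc i) = p i + unit_vector j" by blast
      have "p 0 \<in> nonneg_orthant d" using p(1) diag_point by (auto simp: nonneg_orthant_def diag_def)
      from infinite_path_of_walk[OF this p(2,3)]
      show "\<exists>v. infinite_path (induced_subgraph (int_lattice d) (?T \<inter> nonneg_orthant d)) v \<and>
          (\<forall>i. v (Suc i) - v i \<in> {unit_vector j | j. j \<in> {1..d}})" by blast
    qed
  qed
qed

end
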